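(* Let $n\geq 2$ and let $\Phi:\mathcal{K}^n\to\mathcal{K}^n$ be a continuous, translation invariant Minkowski valuation. Then $\Phi$ satisfies (VC) and is monotonic if and only if exactly one of the following possibilities occurs: (i) there are $g\in\mathrm{GL}(n)$ and $p\in\mathbb{R}^n$ such that $\Phi(K)=g(K+(-K))+p$ for every $K\in\mathcal{K}^n$; (ii) there are $L,S\in\mathcal{K}^n$ with $0\in S$, $\dim S=1$, $\dim L=n-1$ and $\dim(L+S)=n$ such that $\Phi(K)=L+V_n(K)S$ for every $K\in\mathcal{K}^n$.
   Context: $\mathcal{K}^n$ is the space of convex bodies in $\mathbb{R}^n$ with the Hausdorff metric and Minkowski addition; $-K=\{-x:x\in K\}$. A Minkowski valuation is a map $\Phi:\mathcal{K}^n\to\mathcal{K}^n$ with $\Phi(K)+\Phi(L)=\Phi(K\cup L)+\Phi(K\cap L)$ whenever $K,L,K\cup L\in\mathcal{K}^n$. Translation invariant: $\Phi(K+t)=\Phi(K)$ for all $t$. Monotonic: $K\subset L$ implies $\Phi(K)\subset\Phi(L)$. $V_n$ is volume, $\dim$ the dimension of the affine hull. (VC): there are $c,C>0$ with $cV_n(K)\le V_n(\Phi(K))\le CV_n(K)$ for all $K\in\mathcal{K}^n$. *)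

theory Defs
  imports "HOL-Analysis.Analysis"
begin

definition convex_body :: "(real^'n) set \<Rightarrow> bool" where
  "convex_body K \<longleftrightarrow> K \<noteq> {} \<and> compact K \<and> convex K"

definition msum :: "(real^'n) set \<Rightarrow> (real^'n) set \<Rightarrow> (real^'n) set" where
  "msum A B = {a + b | a b. a \<in> A \<and> b \<in> B}"

definition reflect :: "(real^'n) set \<Rightarrow> (real^'n) set" where
  "reflect K = uminus ` K"

definition vol :: "(real^'n) set \<Rightarrow> real" where
  "vol K = measure lebesgue K"

definition body_map :: "((real^'n) set \<Rightarrow> (real^'n) set) \<Rightarrow> bool" where
  "body_map \<Phi> \<longleftrightarrow> (\<forall>K. convex_body K \<longrightarrow> convex_body (\<Phi> K))"

definition hausdist :: "(real^'n) set \<Rightarrow> (real^'n) set \<Rightarrow> real" where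
  "hausdist A B = max (SUP a\<in>A. infdist a B) (SUP b\<in>B. infdist b A)"

definition hausdorff_continuous :: "((real^'n) set \<Rightarrow> (real^'n) set) \<Rightarrow> bool" where
  "hausdorff_continuous \<Phi> \<longleftrightarrow>
     (\<forall>K. convex_body K \<longrightarrow> (\<forall>e>0. \<exists>d>0. \<forall>L. convex_body L \<and> hausdist L K < d
        \<longrightarrow> hausdist (\<Phi> L) (\<Phi> K) < e))"

definition minkowski_valuation :: "((real^'n) set \<Rightarrow> (real^'n) set) \<Rightarrow> bool" where
  "minkowski_valuation \<Phi> \<longleftrightarrow>
     (\<forall>K L. convex_body K \<and> convex_body L \<and> convex_body (K \<union> L) \<longrightarrow>
        msum (\<Phi> K) (\<Phi> L) = msum (\<Phi> (K \<union> L)) (\<Phi> (K \<inter> L)))"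

definition translation_invariant :: "((real^'n) set \<Rightarrow> (real^'n) set) \<Rightarrow> bool" where
  "translation_invariant \<Phi> \<longleftrightarrow>
     (\<forall>K t. convex_body K \<longrightarrow> \<Phi> ((\<lambda>x. x + t) ` K) = \<Phi> K)"

definition monotonic :: "((real^'n) set \<Rightarrow> (real^'n) set) \<Rightarrow> bool" where
  "monotonic \<Phi> \<longleftrightarrow>
     (\<forall>K L. convex_body K \<and> convex_body L \<and> K \<subseteq> L \<longrightarrow> \<Phi> K \<subseteq> \<Phi> L)"

definition VC :: "((real^'n) set \<Rightarrow> (real^'n) set) \<Rightarrow> bool" where
  "VC \<Phi> \<longleftrightarrow> (\<exists>c C. c > 0 \<and> C > 0 \<and>
     (\<forall>K. convex_body K \<longrightarrow> c * vol K \<le> vol (\<Phi> K) \<and> vol (\<Phi> K) \<le> C * vol K))"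

end

theory Submission
  imports Defs
begin

text \<open>The support function of the image of a parallelotope is multiaffine in the edge lengths, so the
  image is a Minkowski sum of bodies, one for each set \<open>I\<close> of edges, scaled by the product of the
  lengths in \<open>I\<close>. By the volume constraint, the sets belonging to any basis of segments taken from
  these bodies partition the set of all edges, and comparing different frames leaves two cases.
  Either only the empty set and the full set occur; then the image is a fixed body plus a part that is
  a simple valuation, hence a multiple of the volume. Or exactly the singletons occur; then the images
  of segments are segments depending linearly on the direction, up to sign, and an arbitrary body is
  squeezed between a segment and a parallelotope of the same width.\<close>

section \<open>Support functions\<close>

text \<open>The volume constraint is exploited through segments. Adding the coefficients for
  \<open>u\<close> and \<open>-u\<close> turns them into support functions of symmetric bodies
  containing 0, whose vectors, suitably scaled, are differences of points of the image; n
  independent segments in a body bound its volume from below. Which of the two cases occurs depends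
  on whether the image of a point is again a point. In the case of singletons the obstacle is signs.
  The image of the segment from 0 to x determines its direction vector only up to sign, so linearity
  in x cannot be read off from a chosen vector. The roles are therefore exchanged: for a fixed
  direction u, the width of the image is the absolute value of a linear functional of x, by a
  parallelogram inequality. Comparing both descriptions on the axis vectors and on sums of two of
  them yields one linear map. That the image of a segment is centrally symmetric is seen by
  comparing two independent segments, which requires dimension at least 2.\<close>

definition sf :: "(real^'n) set \<Rightarrow> real^'n \<Rightarrow> real" where
  "sf K u = (SUP x\<in>K. x \<bullet> u)"

lemma sf_attained:
  assumes "convex_body K"
  obtains x where "x \<in> K" "x \<bullet> u = sf K u" "\<And>y. y \<in> K \<Longrightarrow> y \<bullet> u \<le> sf K u"
proof -
  have "continuous_on K (\<lambda>x. x \<bullet> u)" by (intro continuous_intros)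
  then obtain x where x: "x \<in> K" "\<And>y. y \<in> K \<Longrightarrow> y \<bullet> u \<le> x \<bullet> u"
    using continuous_attains_sup[of K "\<lambda>x. x \<bullet> u"] assms unfolding convex_body_def by blast
  then have "sf K u = x \<bullet> u" unfolding sf_def by (intro cSup_eq_maximum) auto
  with x that show ?thesis by auto
qed

lemma sf_upper: "convex_body K \<Longrightarrow> y \<in> K \<Longrightarrow> y \<bullet> u \<le> sf K u"
  using sf_attained by metis

lemma sf_least: "convex_body K \<Longrightarrow> (\<And>y. y \<in> K \<Longrightarrow> y \<bullet> u \<le> c) \<Longrightarrow> sf K u \<le> c"
  using sf_attained by metis

lemma sf_mono: "convex_body K \<Longrightarrow> convex_body L \<Longrightarrow> K \<subseteq> L \<Longrightarrow> sf K u \<le> sf L u"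
  by (meson sf_least sf_upper subsetD)

lemma convex_body_msum:
  assumes "convex_body A" "convex_body B" shows "convex_body (msum A B)"
proof -
  have "compact (msum A B)" using assms compact_sums[of A B] unfolding convex_body_def msum_def by simp
  moreover have "convex (msum A B)"
  proof -
    have "msum A B = (\<Union>x\<in>A. \<Union>y\<in>B. {x + y})" unfolding msum_def by auto
    then show ?thesis using assms convex_sums[of A B] unfolding convex_body_def by simp
  qed
  moreover have "msum A B \<noteq> {}" using assms unfolding convex_body_def msum_def by auto
  ultimately show ?thesis unfolding convex_body_def by blast
qed

lemma sf_msum:
  assumes "convex_body A" "convex_body B" shows "sf (msum A B) u = sf A u + sf B u"
proof (rule antisym)
  show "sf (msum A B) u \<le> sf A u + sf B u"
    by (rule sf_least[OF convex_body_msum[OF assms]])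
      (auto simp: msum_def inner_add_left intro!: add_mono sf_upper assms)
  obtain a where "a \<in> A" "a \<bullet> u = sf A u" using sf_attained[OF assms(1)] by metis
  moreover obtain b where "b \<in> B" "b \<bullet> u = sf B u" using sf_attained[OF assms(2)] by metis
  ultimately show "sf A u + sf B u \<le> sf (msum A B) u"
    using sf_upper[OF convex_body_msum[OF assms], of "a + b" u]
    by (auto simp: msum_def inner_add_left)
qed

lemma sf_add_le:
  assumes "convex_body K" shows "sf K (u + v) \<le> sf K u + sf K v"
  by (rule sf_least[OF assms]) (auto simp: inner_add_right intro!: add_mono sf_upper assms)

lemma sf_scaleR:
  assumes "convex_body K" "t \<ge> 0" shows "sf K (t *\<^sub>R u) = t * sf K u"
proof (rule antisym)
  show "sf K (t *\<^sub>R u) \<le> t * sf K u"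
    by (rule sf_least[OF assms(1)]) (auto intro!: mult_left_mono sf_upper assms)
  show "t * sf K u \<le> sf K (t *\<^sub>R u)"
    using sf_attained[OF assms(1), of u] sf_upper[OF assms(1), of _ "t *\<^sub>R u"]
    by (metis inner_scaleR_right)
qed

lemma sf_singleton: "sf {p} u = p \<bullet> u"
  unfolding sf_def by simp

lemma subset_of_sf:
  assumes "convex_body A" "convex_body B" "\<And>u. sf A u \<le> sf B u"
  shows "A \<subseteq> B"
proof
  fix x assume x: "x \<in> A"
  show "x \<in> B"
  proof (rule ccontr)
    assume "x \<notin> B"
    then obtain a b where ab: "a \<bullet> x < b" "\<And>y. y \<in> B \<Longrightarrow> a \<bullet> y > b"
      using separating_hyperplane_closed_point[of B x] assms(2)
      unfolding convex_body_def by (metis compact_imp_closed)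
    have "sf B (-a) \<le> -b"
      by (rule sf_least[OF assms(2)]) (use ab(2) in \<open>auto simp: inner_commute less_imp_le\<close>)
    moreover have "- (a \<bullet> x) \<le> sf A (-a)" using sf_upper[OF assms(1) x, of "-a"] by (simp add: inner_commute)
    ultimately show False using ab(1) assms(3)[of "-a"] by simp
  qed
qed

lemma convex_body_eqI:
  assumes "convex_body A" "convex_body B" "\<And>u. sf A u = sf B u"
  shows "A = B"
  using subset_of_sf[OF assms(1,2)] subset_of_sf[OF assms(2,1)] assms(3) by simp

section \<open>Bodies with a prescribed support function\<close>

definition sublin :: "(real^'n \<Rightarrow> real) \<Rightarrow> bool" where
  "sublin f \<longleftrightarrow> (\<forall>u v. f (u + v) \<le> f u + f v) \<and> (\<forall>t\<ge>0. \<forall>u. f (t *\<^sub>R u) = t * f u)"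

lemma sublin_add: "sublin f \<Longrightarrow> f (u + v) \<le> f u + f v"
  and sublin_scaleR: "sublin f \<Longrightarrow> t \<ge> 0 \<Longrightarrow> f (t *\<^sub>R u) = t * f u"
  unfolding sublin_def by auto

lemma sublin_0: "sublin f \<Longrightarrow> f 0 = 0"
  using sublin_scaleR[of f 0 0] by simp

text \<open>For sublinear \<open>f\<close> this is the body with support function \<open>f\<close>.
  It turns coefficients that arise only as limits of support functions back into bodies.\<close>

definition wulff :: "(real^'n \<Rightarrow> real) \<Rightarrow> (real^'n) set" where
  "wulff f = {v. \<forall>u. v \<bullet> u \<le> f u}"

text \<open>A hyperplane separating the closed convex epigraph from the point at distance \<epsilon>
  below \<open>(u0, f u0)\<close> is the graph of a linear minorant of \<open>f\<close>, up to a
  constant that homogeneity removes.\<close>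

lemma wulff_approx:
  fixes f :: "real^'n \<Rightarrow> real"
  assumes f: "sublin f" and e: "\<epsilon> > 0"
  obtains v where "v \<in> wulff f" "v \<bullet> u0 > f u0 - \<epsilon>"
proof -
  have cvx: "convex_on UNIV f"
  proof (rule convex_onI)
    fix t :: real and x y :: "real^'n" assume "0 < t" "t < 1"
    then show "f ((1 - t) *\<^sub>R x + t *\<^sub>R y) \<le> (1 - t) * f x + t * f y"
      using sublin_add[OF f, of "(1 - t) *\<^sub>R x" "t *\<^sub>R y"] sublin_scaleR[OF f] by simp
  qed auto
  then have cont: "continuous_on UNIV f"
    by (intro convex_on_continuous) auto
  let ?E = "epigraph UNIV f"
  have "convex ?E" using cvx convex_epigraph by blast
  moreover have "closed ?E"
  proof -
    have "?E = {z. f (fst z) \<le> snd z}" unfolding epigraph_def by auto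
    moreover have "continuous_on UNIV (\<lambda>z::(real^'n)\<times>real. f (fst z))"
      by (rule continuous_on_compose2[OF cont continuous_on_fst[OF continuous_on_id]]) auto
    ultimately show ?thesis by (simp add: closed_Collect_le continuous_on_snd)
  qed
  moreover have "(u0, f u0 - \<epsilon>) \<notin> ?E" using e unfolding epigraph_def by simp
  ultimately obtain z b where z: "z \<bullet> (u0, f u0 - \<epsilon>) < b" "\<And>y. y \<in> ?E \<Longrightarrow> z \<bullet> y > b"
    using separating_hyperplane_closed_point by metis
  obtain a \<alpha> where za: "z = (a, \<alpha>)" by fastforce
  have pos: "a \<bullet> u + \<alpha> * s > b" if "f u \<le> s" for u s
    using z(2)[of "(u, s)"] that za unfolding epigraph_def by simp
  have b0: "b < 0" using pos[of 0 0] sublin_0[OF f] by simp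
  \<comment> \<open>The epigraph is a cone: scaling a point with negative value \<open>?q\<close> by
    \<open>b / ?q\<close> would bring the value down to \<open>b\<close> itself.\<close>
  have nn: "a \<bullet> u + \<alpha> * s \<ge> 0" if "f u \<le> s" for u s
  proof (rule ccontr)
    let ?q = "a \<bullet> u + \<alpha> * s"
    assume "\<not> ?q \<ge> 0"
    then have q: "?q < 0" by simp
    let ?t = "b / ?q"
    have t: "?t \<ge> 0" using q b0 by (simp add: divide_nonpos_neg)
    have le: "f (?t *\<^sub>R u) \<le> ?t * s" using sublin_scaleR[OF f t] that t by (metis mult_left_mono)
    have "a \<bullet> (t *\<^sub>R u) + \<alpha> * (t * s) = t * ?q" for t by (simp add: algebra_simps)
    with pos[OF le] have "?t * ?q > b" by metis
    then show False using q by simp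
  qed
  \<comment> \<open>The separating hyperplane is not vertical: the functional is nonnegative at
    \<open>(u0, f u0)\<close> and negative a distance \<epsilon> below.\<close>
  have "\<alpha> * \<epsilon> > 0"
    using z(1) za nn[of u0 "f u0"] b0 by (simp add: algebra_simps)
  then have al: "\<alpha> > 0" using e by (simp add: zero_less_mult_iff)
  let ?v = "(-1/\<alpha>) *\<^sub>R a"
  have "?v \<bullet> u \<le> f u" for u
    using nn[of u "f u"] al by (simp add: field_simps)
  moreover have "?v \<bullet> u0 > f u0 - \<epsilon>"
  proof -
    have "a \<bullet> u0 + \<alpha> * (f u0 - \<epsilon>) < 0" using z(1) za b0 by simp
    then show ?thesis using al by (simp add: field_simps)
  qed
  ultimately show ?thesis using that unfolding wulff_def by blast
qed

lemma convex_body_wulff: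
  assumes f: "sublin f" shows "convex_body (wulff f)"
proof -
  obtain v where "v \<in> wulff f" using wulff_approx[OF f, of 1] by auto
  then have "wulff f \<noteq> {}" by auto
  moreover have eq: "wulff f = (\<Inter>u. {v. u \<bullet> v \<le> f u})"
    unfolding wulff_def by (auto simp: inner_commute)
  moreover have "closed (wulff f)" unfolding eq by (intro closed_INT ballI closed_halfspace_le)
  moreover have "convex (wulff f)" unfolding eq by (intro convex_INT convex_halfspace_le)
  moreover have "bounded (wulff f)"
  proof -
    have "norm v \<le> (\<Sum>i\<in>UNIV. max (f (axis i 1)) (f (- axis i 1)))" if "v \<in> wulff f" for v
    proof -
      have "\<bar>v $ i\<bar> \<le> max (f (axis i 1)) (f (- axis i 1))" for i
      proof -
        have "v \<bullet> axis i 1 \<le> f (axis i 1)" "v \<bullet> (- axis i 1) \<le> f (- axis i 1)"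
          using that unfolding wulff_def by blast+
        then show ?thesis by (simp add: inner_axis inner_minus_right)
      qed
      then show ?thesis using norm_le_l1_cart[of v] by (meson order_trans sum_mono)
    qed
    then show ?thesis by (auto simp: bounded_iff)
  qed
  ultimately show ?thesis unfolding convex_body_def by (auto simp: compact_eq_bounded_closed)
qed

lemma sf_wulff:
  assumes f: "sublin f" shows "sf (wulff f) u = f u"
proof (rule antisym)
  show "sf (wulff f) u \<le> f u"
    by (rule sf_least[OF convex_body_wulff[OF f]]) (auto simp: wulff_def)
  show "f u \<le> sf (wulff f) u"
  proof (rule field_le_epsilon)
    fix e :: real assume "e > 0"
    then obtain v where "v \<in> wulff f" "v \<bullet> u > f u - e" using wulff_approx[OF f] by metis
    then show "f u \<le> sf (wulff f) u + e"
      using sf_upper[OF convex_body_wulff[OF f], of v u] by simp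
  qed
qed

section \<open>Parallelotopes and multiaffine functions\<close>

definition cmb :: "('n \<Rightarrow> real^'n) \<Rightarrow> ('n \<Rightarrow> real) \<Rightarrow> real^'n" where
  "cmb e t = (\<Sum>i\<in>UNIV. t i *\<^sub>R e i)"

definition frame :: "('n \<Rightarrow> real^'n) \<Rightarrow> bool" where
  "frame e \<longleftrightarrow> (\<forall>t. cmb e t = 0 \<longrightarrow> (\<forall>i. t i = 0))"

definition bx :: "('n \<Rightarrow> real^'n) \<Rightarrow> ('n \<Rightarrow> real) \<Rightarrow> (real^'n) set" where
  "bx e l = {cmb e t | t. \<forall>i. 0 \<le> t i \<and> t i \<le> l i}"

definition ind :: "'n set \<Rightarrow> real \<Rightarrow> 'n \<Rightarrow> real" where
  "ind I t i = (if i \<in> I then t else 0)"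

lemma ind_simps [simp]: "i \<in> I \<Longrightarrow> ind I t i = t" "i \<notin> I \<Longrightarrow> ind I t i = 0"
  unfolding ind_def by auto

lemma ind_nonneg [simp]: "t \<ge> 0 \<Longrightarrow> 0 \<le> ind I t i"
  unfolding ind_def by auto

lemma cmb_0 [simp]: "cmb e (\<lambda>_. 0) = 0"
  unfolding cmb_def by simp

lemma cmb_add: "cmb e (\<lambda>i. s i + t i) = cmb e s + cmb e t"
  unfolding cmb_def by (simp add: scaleR_left_distrib sum.distrib)

lemma cmb_diff: "cmb e (\<lambda>i. s i - t i) = cmb e s - cmb e t"
  unfolding cmb_def by (simp add: scaleR_left_diff_distrib sum_subtractf)

lemma cmb_scaleR: "cmb e (\<lambda>i. c * t i) = c *\<^sub>R cmb e t"
  unfolding cmb_def by (simp add: scaleR_sum_right)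

lemma cmb_upd: "cmb e (t(i := s)) = cmb e t + (s - t i) *\<^sub>R e i"
proof -
  have "cmb e (t(i := s)) = (\<Sum>j\<in>UNIV. t j *\<^sub>R e j + (if j = i then (s - t i) *\<^sub>R e i else 0))"
    unfolding cmb_def by (rule sum.cong) (auto simp: algebra_simps)
  then show ?thesis unfolding cmb_def by (simp add: sum.distrib)
qed

lemma cmb_frame_upd: "cmb (e(i := v)) t = cmb e t + t i *\<^sub>R (v - e i)"
proof -
  have "cmb (e(i := v)) t = (\<Sum>j\<in>UNIV. t j *\<^sub>R e j + (if j = i then t i *\<^sub>R (v - e i) else 0))"
    unfolding cmb_def by (rule sum.cong) (auto simp: algebra_simps)
  then show ?thesis unfolding cmb_def by (simp add: sum.distrib)
qed

lemma cmb_single: "cmb e (ind {i} t) = t *\<^sub>R e i"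
proof -
  have "ind {i} t = (\<lambda>_. 0)(i := t)" unfolding ind_def by auto
  then show ?thesis by (simp add: cmb_upd)
qed

lemma frame_inj: "frame e \<Longrightarrow> cmb e s = cmb e t \<Longrightarrow> s = t"
  unfolding frame_def using cmb_diff[of e s t] by fastforce

lemma frameD: "frame e \<Longrightarrow> cmb e t = 0 \<Longrightarrow> t i = 0"
  unfolding frame_def by blast

lemma frame_nonzero: "frame e \<Longrightarrow> e i \<noteq> 0"
  using frameD[of e "ind {i} 1" i] cmb_single[of e i 1] by auto

lemma bx_image: "bx e l = (\<lambda>x. \<Sum>i\<in>UNIV. x $ i *\<^sub>R e i) ` cbox 0 (\<chi> i. l i)"
proof
  show "bx e l \<subseteq> (\<lambda>x. \<Sum>i\<in>UNIV. x $ i *\<^sub>R e i) ` cbox 0 (\<chi> i. l i)"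
  proof
    fix y assume "y \<in> bx e l"
    then obtain t where t: "y = cmb e t" "\<forall>i. 0 \<le> t i \<and> t i \<le> l i" unfolding bx_def by auto
    then have "(\<chi> i. t i) \<in> cbox 0 (\<chi> i. l i)" by (simp add: mem_box_cart)
    then show "y \<in> (\<lambda>x. \<Sum>i\<in>UNIV. x $ i *\<^sub>R e i) ` cbox 0 (\<chi> i. l i)"
      by (rule rev_image_eqI) (simp add: t cmb_def)
  qed
  show "(\<lambda>x. \<Sum>i\<in>UNIV. x $ i *\<^sub>R e i) ` cbox 0 (\<chi> i. l i) \<subseteq> bx e l"
    unfolding bx_def cmb_def by (auto simp: mem_box_cart)
qed

lemma linear_frame: "linear (\<lambda>x::real^'n. \<Sum>i\<in>UNIV. x $ i *\<^sub>R e i)"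
  by (rule linearI) (simp_all add: scaleR_left_distrib sum.distrib scaleR_sum_right)

lemma convex_body_bx:
  assumes "\<And>i. 0 \<le> l i" shows "convex_body (bx e l)"
  unfolding convex_body_def
proof (intro conjI)
  have "cmb e (\<lambda>_. 0) \<in> bx e l" unfolding bx_def using assms by blast
  then show "bx e l \<noteq> {}" by auto
  show "compact (bx e l)" unfolding bx_image
    by (intro compact_continuous_image continuous_intros) simp
  show "convex (bx e l)" unfolding bx_image
    by (rule convex_linear_image[OF linear_frame convex_box(1)])
qed

lemma bxI: "(\<And>i. 0 \<le> t i \<and> t i \<le> l i) \<Longrightarrow> cmb e t \<in> bx e l"
  unfolding bx_def by auto

lemma bxE:
  assumes "x \<in> bx e l" obtains t where "x = cmb e t" "\<And>i. 0 \<le> t i" "\<And>i. t i \<le> l i"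
  using assms unfolding bx_def by auto

lemma bx_mono: "(\<And>i. l i \<le> m i) \<Longrightarrow> bx e l \<subseteq> bx e m"
  unfolding bx_def by (blast intro: order_trans)

lemma bx_0: "bx e (\<lambda>_. 0) = {0}"
proof -
  have "(\<forall>i. 0 \<le> t i \<and> t i \<le> 0) \<longleftrightarrow> t = (\<lambda>_. 0)" for t :: "'a \<Rightarrow> real"
    by (auto simp: fun_eq_iff intro: antisym)
  then show ?thesis unfolding bx_def by auto
qed

lemma bx_scaled: "bx (\<lambda>i. l i *\<^sub>R e i) (\<lambda>_. 1) = bx e l" if "\<And>i. 0 \<le> l i"
proof (intro set_eqI iffI)
  fix x assume "x \<in> bx (\<lambda>i. l i *\<^sub>R e i) (\<lambda>_. 1)"
  then obtain t where t: "x = cmb (\<lambda>i. l i *\<^sub>R e i) t" "\<And>i. 0 \<le> t i" "\<And>i. t i \<le> 1" by (rule bxE) blast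
  then have "x = cmb e (\<lambda>i. t i * l i)" by (simp add: cmb_def)
  then show "x \<in> bx e l" using t that by (auto intro!: bxI mult_left_le_one_le)
next
  fix x assume "x \<in> bx e l"
  then obtain t where t: "x = cmb e t" "\<And>i. 0 \<le> t i" "\<And>i. t i \<le> l i" by (rule bxE) blast
  have "x = cmb (\<lambda>i. l i *\<^sub>R e i) (\<lambda>i. t i / l i)"
    unfolding t(1) cmb_def
  proof (rule sum.cong)
    fix i show "t i *\<^sub>R e i = (t i / l i) *\<^sub>R l i *\<^sub>R e i"
      using t(2,3)[of i] by (cases "l i = 0") auto
  qed auto
  moreover have "0 \<le> t i / l i \<and> t i / l i \<le> 1" for i
    using t(2,3)[of i] that[of i] by (cases "l i = 0") (auto simp: divide_simps)
  ultimately show "x \<in> bx (\<lambda>i. l i *\<^sub>R e i) (\<lambda>_. 1)" by (auto intro!: bxI)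
qed

lemma bx_split:
  assumes "s \<ge> 0" "r \<ge> 0"
  shows "bx e (l(i := s + r)) = bx e (l(i := s)) \<union> (\<lambda>x. x + s *\<^sub>R e i) ` bx e (l(i := r))"
proof (intro set_eqI iffI)
  fix x assume "x \<in> bx e (l(i := s + r))"
  then obtain t where t: "x = cmb e t" "\<And>j. 0 \<le> t j" "\<And>j. t j \<le> (l(i := s + r)) j" by (rule bxE) blast
  show "x \<in> bx e (l(i := s)) \<union> (\<lambda>x. x + s *\<^sub>R e i) ` bx e (l(i := r))"
  proof (cases "t i \<le> s")
    case True
    have "t j \<le> (l(i := s)) j" for j using True t(3)[of j] by (cases "j = i") auto
    then show ?thesis using t bxI[of t] by auto
  next
    case False
    have "x = cmb e (t(i := t i - s)) + s *\<^sub>R e i" by (simp add: cmb_upd t)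
    moreover have "cmb e (t(i := t i - s)) \<in> bx e (l(i := r))"
    proof (rule bxI)
      fix j show "0 \<le> (t(i := t i - s)) j \<and> (t(i := t i - s)) j \<le> (l(i := r)) j"
        using False t(2,3)[of j] by (cases "j = i") auto
    qed
    ultimately show ?thesis by blast
  qed
next
  fix x assume x: "x \<in> bx e (l(i := s)) \<union> (\<lambda>x. x + s *\<^sub>R e i) ` bx e (l(i := r))"
  show "x \<in> bx e (l(i := s + r))"
  proof (cases "x \<in> bx e (l(i := s))")
    case True
    have "(l(i := s)) j \<le> (l(i := s + r)) j" for j using assms by auto
    then show ?thesis using True bx_mono[of "l(i := s)"] by blast
  next
    case False
    then obtain t where t: "x = cmb e t + s *\<^sub>R e i" "\<And>j. 0 \<le> t j" "\<And>j. t j \<le> (l(i := r)) j"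
      using x by (auto elim!: bxE)
    then have "x = cmb e (t(i := t i + s))" by (simp add: cmb_upd)
    moreover have "0 \<le> (t(i := t i + s)) j \<and> (t(i := t i + s)) j \<le> (l(i := s + r)) j" for j
      using t(2,3)[of j] assms by (cases "j = i") auto
    ultimately show ?thesis using bxI[of "t(i := t i + s)"] by simp
  qed
qed

text \<open>Coordinates in a frame are unique, so a common point satisfies
  \<open>t i = q i + s\<close> with \<open>t i \<le> s\<close> and \<open>q i \<ge> 0\<close>,
  whence \<open>q i = 0\<close>. Together with \<open>bx_split\<close>, a box becomes a union of two
  boxes sharing a face, to which the valuation property applies.\<close>

lemma bx_split_Int:
  assumes "frame e" "s \<ge> 0" "r \<ge> 0"
  shows "bx e (l(i := s)) \<inter> (\<lambda>x. x + s *\<^sub>R e i) ` bx e (l(i := r)) = (\<lambda>x. x + s *\<^sub>R e i) ` bx e (l(i := 0))"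
proof (intro set_eqI iffI)
  fix x assume x: "x \<in> bx e (l(i := s)) \<inter> (\<lambda>x. x + s *\<^sub>R e i) ` bx e (l(i := r))"
  then have "x \<in> bx e (l(i := s))" "x \<in> (\<lambda>x. x + s *\<^sub>R e i) ` bx e (l(i := r))" by auto
  obtain t where t: "x = cmb e t" "\<And>j. 0 \<le> t j" "\<And>j. t j \<le> (l(i := s)) j"
    using \<open>x \<in> bx e (l(i := s))\<close> by (rule bxE) blast
  obtain q where q: "x = cmb e q + s *\<^sub>R e i" "\<And>j. 0 \<le> q j" "\<And>j. q j \<le> (l(i := r)) j"
    using \<open>x \<in> (\<lambda>x. x + s *\<^sub>R e i) ` bx e (l(i := r))\<close> by (auto elim!: bxE)
  have "cmb e t = cmb e (q(i := q i + s))" using t(1) q(1) by (simp add: cmb_upd)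
  then have tq: "t = q(i := q i + s)" using frame_inj[OF assms(1)] by blast
  then have qi: "q i = 0" using q(2)[of i] t(3)[of i] by simp
  have "q j \<le> (l(i := 0)) j" for j using q(3)[of j] qi by (cases "j = i") auto
  then show "x \<in> (\<lambda>x. x + s *\<^sub>R e i) ` bx e (l(i := 0))" using q bxI[of q] by auto
next
  fix x assume "x \<in> (\<lambda>x. x + s *\<^sub>R e i) ` bx e (l(i := 0))"
  then obtain t where t: "x = cmb e t + s *\<^sub>R e i" "\<And>j. 0 \<le> t j" "\<And>j. t j \<le> (l(i := 0)) j"
    by (auto elim!: bxE)
  have ti: "t i = 0" using t(2)[of i] t(3)[of i] by simp
  have "x = cmb e (t(i := s))" using t(1) ti by (simp add: cmb_upd)
  moreover have "0 \<le> (t(i := s)) j \<and> (t(i := s)) j \<le> (l(i := s)) j" for j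
    using t(2,3)[of j] assms by (cases "j = i") auto
  ultimately have "x \<in> bx e (l(i := s))" using bxI[of "t(i := s)"] by simp
  moreover have "t j \<le> (l(i := r)) j" for j using t(3)[of j] ti assms by (cases "j = i") auto
  then have "x \<in> (\<lambda>x. x + s *\<^sub>R e i) ` bx e (l(i := r))" using t bxI[of t] by auto
  ultimately show "x \<in> bx e (l(i := s)) \<inter> (\<lambda>x. x + s *\<^sub>R e i) ` bx e (l(i := r))" by blast
qed

text \<open>Cauchy's equation with monotonicity in place of continuity: if m is the integer part of
  n s, both \<open>n * g s\<close> and \<open>n * s * g 1\<close> lie between \<open>m * g 1\<close>
  and \<open>(m + 1) * g 1\<close>. Their difference is thus bounded independently of n.\<close>

lemma monotone_additive_linear:
  fixes g :: "real \<Rightarrow> real"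
  assumes add: "\<And>s t. 0 \<le> s \<Longrightarrow> 0 \<le> t \<Longrightarrow> g (s + t) = g s + g t"
    and mono: "\<And>s t. 0 \<le> s \<Longrightarrow> s \<le> t \<Longrightarrow> g s \<le> g t" and s: "s \<ge> 0"
  shows "g s = s * g 1"
proof -
  have g0: "g 0 = 0" using add[of 0 0] by simp
  have mult: "g (real n * r) = real n * g r" if "r \<ge> 0" for n r
  proof (induction n)
    case (Suc n)
    have "g (real (Suc n) * r) = g (real n * r + r)" by (simp add: algebra_simps)
    also have "\<dots> = real (Suc n) * g r" using add[of "real n * r" r] that Suc by (simp add: algebra_simps)
    finally show ?case .
  qed (simp add: g0)
  have g1: "g 1 \<ge> 0" using mono[of 0 1] g0 by simp
  have "\<bar>g s - s * g 1\<bar> = 0"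
  proof (rule real_archimedian_rdiv_eq_0[where c = "g 1"])
    fix n :: nat assume "n > 0"
    define m where "m = nat \<lfloor>real n * s\<rfloor>"
    have m: "real m \<le> real n * s" "real n * s \<le> real (Suc m)"
      using s unfolding m_def by (simp_all add: of_nat_nat) linarith
    have "real m * g 1 \<le> real n * g s"
      using mono[OF _ m(1)] mult[of s n] mult[of 1 m] s by simp
    moreover have "real n * g s \<le> real (Suc m) * g 1"
      using mono[OF _ m(2)] mult[of s n] mult[of 1 "Suc m"] s by simp
    moreover have "real m * g 1 \<le> real n * s * g 1" "real n * s * g 1 \<le> real (Suc m) * g 1"
      using m g1 by (auto intro: mult_right_mono)
    ultimately have "\<bar>real n * g s - real n * s * g 1\<bar> \<le> g 1" by (simp add: algebra_simps abs_le_iff)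
    then show "real n * \<bar>g s - s * g 1\<bar> \<le> g 1"
      by (metis abs_mult abs_of_nat mult.assoc right_diff_distrib)
  qed (use g1 in auto)
  then show ?thesis by simp
qed

text \<open>Induction on the variables: fixing the new one at 0 and at 1 gives two expansions in the
  remaining ones, and being affine in the new variable interpolates between them. Hence the
  coefficients of sets containing \<open>a\<close> are differences.\<close>

lemma multiaffine_expansion:
  fixes F :: "('n::finite \<Rightarrow> real) \<Rightarrow> real"
  assumes "finite A"
    and "\<And>i l s. i \<in> A \<Longrightarrow> (\<And>j. 0 \<le> l j) \<Longrightarrow> 0 \<le> s \<Longrightarrow>
      F (l(i := s)) = F (l(i := 0)) + s * (F (l(i := 1)) - F (l(i := 0)))"
  shows "\<exists>c. \<forall>l. (\<forall>i. 0 \<le> l i) \<longrightarrow> (\<forall>i. i \<notin> A \<longrightarrow> l i = 0) \<longrightarrow> F l = (\<Sum>I\<in>Pow A. c I * (\<Prod>i\<in>I. l i))"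
  using assms
proof (induction A arbitrary: F rule: finite_induct)
  case empty
  show ?case
  proof (intro exI[of _ "\<lambda>_. F (\<lambda>_. 0)"] allI impI)
    fix l :: "'n \<Rightarrow> real" assume "\<forall>i. i \<notin> {} \<longrightarrow> l i = 0"
    then have "l = (\<lambda>_. 0)" by auto
    then show "F l = (\<Sum>I\<in>Pow {}. F (\<lambda>_. 0) * (\<Prod>i\<in>I. l i))" by simp
  qed
next
  case (insert a A)
  have aff: "(F ((l(i := s))(a := r))) = F ((l(i := 0))(a := r)) + s * (F ((l(i := 1))(a := r)) - F ((l(i := 0))(a := r)))"
    if "i \<in> A" "\<And>j. 0 \<le> l j" "0 \<le> s" "r \<ge> 0" for i l s r
  proof -
    have "i \<noteq> a" using that insert.hyps(2) by auto
    then have tw: "(l(i := q))(a := r) = (l(a := r))(i := q)" for q by (simp add: fun_upd_twist)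
    show ?thesis unfolding tw by (rule insert.prems) (use that in auto)
  qed
  have "\<exists>c. \<forall>l. (\<forall>i. 0 \<le> l i) \<longrightarrow> (\<forall>i. i \<notin> A \<longrightarrow> l i = 0) \<longrightarrow> F (l(a := 0)) = (\<Sum>I\<in>Pow A. c I * (\<Prod>i\<in>I. l i))"
    by (rule insert.IH[of "\<lambda>l. F (l(a := 0))"]) (rule aff, simp_all)
  then obtain c0 where c0: "\<forall>l. (\<forall>i. 0 \<le> l i) \<longrightarrow> (\<forall>i. i \<notin> A \<longrightarrow> l i = 0) \<longrightarrow>
      F (l(a := 0)) = (\<Sum>I\<in>Pow A. c0 I * (\<Prod>i\<in>I. l i))" ..
  have "\<exists>c. \<forall>l. (\<forall>i. 0 \<le> l i) \<longrightarrow> (\<forall>i. i \<notin> A \<longrightarrow> l i = 0) \<longrightarrow> F (l(a := 1)) = (\<Sum>I\<in>Pow A. c I * (\<Prod>i\<in>I. l i))"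
    by (rule insert.IH[of "\<lambda>l. F (l(a := 1))"]) (rule aff, simp_all)
  then obtain c1 where c1: "\<forall>l. (\<forall>i. 0 \<le> l i) \<longrightarrow> (\<forall>i. i \<notin> A \<longrightarrow> l i = 0) \<longrightarrow>
      F (l(a := 1)) = (\<Sum>I\<in>Pow A. c1 I * (\<Prod>i\<in>I. l i))" ..
  define c where "c I = (if a \<in> I then c1 (I - {a}) - c0 (I - {a}) else c0 I)" for I
  show ?case
  proof (intro exI[of _ c] allI impI)
    fix l :: "'n \<Rightarrow> real" assume l: "\<forall>i. 0 \<le> l i" "\<forall>i. i \<notin> insert a A \<longrightarrow> l i = 0"
    let ?m = "l(a := 0)"
    have m: "\<forall>i. 0 \<le> ?m i" "\<forall>i. i \<notin> A \<longrightarrow> ?m i = 0" using l by auto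
    have pr: "(\<Prod>i\<in>I. ?m i) = (\<Prod>i\<in>I. l i)" if "I \<in> Pow A" for I
      by (rule prod.cong) (use that insert.hyps in auto)
    have "F l = F (?m(a := 0)) + l a * (F (?m(a := 1)) - F (?m(a := 0)))"
      using insert.prems[of a l "l a"] l unfolding fun_upd_triv fun_upd_upd by blast
    also have "\<dots> = (\<Sum>I\<in>Pow A. c0 I * (\<Prod>i\<in>I. ?m i)) + l a * ((\<Sum>I\<in>Pow A. c1 I * (\<Prod>i\<in>I. ?m i)) - (\<Sum>I\<in>Pow A. c0 I * (\<Prod>i\<in>I. ?m i)))"
      by (simp only: c0[THEN spec, THEN mp, THEN mp, OF m] c1[THEN spec, THEN mp, THEN mp, OF m])
    also have "\<dots> = (\<Sum>I\<in>Pow A. c0 I * (\<Prod>i\<in>I. l i)) + l a * ((\<Sum>I\<in>Pow A. c1 I * (\<Prod>i\<in>I. l i)) - (\<Sum>I\<in>Pow A. c0 I * (\<Prod>i\<in>I. l i)))"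
      using pr by simp
    also have "\<dots> = (\<Sum>I\<in>Pow A. c0 I * (\<Prod>i\<in>I. l i)) + (\<Sum>I\<in>Pow A. (c1 I - c0 I) * (l a * (\<Prod>i\<in>I. l i)))"
      by (simp add: sum_distrib_left sum_subtractf[symmetric] algebra_simps)
    also have "\<dots> = (\<Sum>I\<in>Pow A. c I * (\<Prod>i\<in>I. l i)) + (\<Sum>I\<in>insert a ` Pow A. c I * (\<Prod>i\<in>I. l i))"
    proof -
      have "(\<Sum>I\<in>insert a ` Pow A. c I * (\<Prod>i\<in>I. l i)) = (\<Sum>I\<in>Pow A. c (insert a I) * (\<Prod>i\<in>insert a I. l i))"
        by (rule sum.reindex[unfolded comp_def]) (use insert.hyps in \<open>auto simp: inj_on_def\<close>)
      also have "\<dots> = (\<Sum>I\<in>Pow A. (c1 I - c0 I) * (l a * (\<Prod>i\<in>I. l i)))"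
      proof (rule sum.cong)
        fix I assume "I \<in> Pow A"
        then have "a \<notin> I" "finite I" using insert.hyps by auto
        then show "c (insert a I) * (\<Prod>i\<in>insert a I. l i) = (c1 I - c0 I) * (l a * (\<Prod>i\<in>I. l i))"
          unfolding c_def by simp
      qed auto
      moreover have "(\<Sum>I\<in>Pow A. c I * (\<Prod>i\<in>I. l i)) = (\<Sum>I\<in>Pow A. c0 I * (\<Prod>i\<in>I. l i))"
        by (rule sum.cong) (use insert.hyps in \<open>auto simp: c_def\<close>)
      ultimately show ?thesis by simp
    qed
    also have "\<dots> = (\<Sum>I\<in>Pow (insert a A). c I * (\<Prod>i\<in>I. l i))"
      unfolding Pow_insert by (rule sum.union_disjoint[symmetric]) (use insert.hyps in auto)
    finally show "F l = (\<Sum>I\<in>Pow (insert a A). c I * (\<Prod>i\<in>I. l i))" .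
  qed
qed

section \<open>Volume of parallelotopes\<close>

lemma convex_body_translate: "convex_body K \<Longrightarrow> convex_body ((\<lambda>x. x + t) ` K)"
  unfolding convex_body_def using compact_translation[of K t] convex_translation[of K t]
  by (simp add: add.commute)

lemma convex_body_sing: "convex_body {x}"
  unfolding convex_body_def by simp

lemma convex_body_reflect: "convex_body K \<Longrightarrow> convex_body (reflect K)"
  unfolding convex_body_def reflect_def by (simp add: compact_negations convex_negations)

lemma sf_reflect: "convex_body K \<Longrightarrow> sf (reflect K) u = sf K (-u)"
  unfolding sf_def reflect_def by (simp add: image_image)

section \<open>Width, segments and vanishing volume\<close>

definition width :: "(real^'n) set \<Rightarrow> real^'n \<Rightarrow> real" where
  "width K u = sf K u + sf K (-u)"

lemma width_eq_sf: "convex_body K \<Longrightarrow> width K u = sf (msum K (reflect K)) u"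
  unfolding width_def by (simp add: sf_msum convex_body_reflect sf_reflect)

lemma width_nonneg: assumes "convex_body K" shows "width K u \<ge> 0"
proof -
  obtain x where "x \<in> K" using assms unfolding convex_body_def by auto
  then show ?thesis using sf_upper[OF assms, of x u] sf_upper[OF assms, of x "-u"] unfolding width_def by simp
qed

text \<open>The width is the support function of the difference body, so the hypothesis says that
  \<open>v\<close> is a difference of two points of \<open>K\<close>.\<close>

lemma segment_of_width:
  assumes K: "convex_body K" and v: "\<And>u. v \<bullet> u \<le> width K u"
  obtains a where "a \<in> K" "a + v \<in> K"
proof -
  have "{v} \<subseteq> msum K (reflect K)"
    by (rule subset_of_sf)
      (use K v in \<open>auto simp: convex_body_sing convex_body_msum convex_body_reflect sf_singleton width_eq_sf\<close>)
  then obtain a b where "a \<in> K" "b \<in> K" "v = a - b" unfolding msum_def reflect_def by auto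
  then show ?thesis using that[of b] by simp
qed

lemma convex_body_lmeasurable: "convex_body K \<Longrightarrow> K \<in> lmeasurable"
  unfolding convex_body_def by (simp add: lmeasurable_compact)

lemma vol_mono: "convex_body K \<Longrightarrow> convex_body L \<Longrightarrow> K \<subseteq> L \<Longrightarrow> vol K \<le> vol L"
  unfolding vol_def by (intro measure_mono_fmeasurable) (auto simp: convex_body_lmeasurable fmeasurableD)

lemma vol_translate: "vol ((\<lambda>x. x + t) ` K) = vol K"
  unfolding vol_def using measure_translation[of t K] by (simp add: add.commute)

lemma vol_nonneg: "vol K \<ge> 0" unfolding vol_def by simp

lemma vol_0_hyperplane:
  assumes "u \<noteq> 0" "\<And>x. x \<in> K \<Longrightarrow> u \<bullet> x = c" shows "vol K = 0"
proof -
  have "negligible {x. u \<bullet> x = c}" using negligible_hyperplane assms(1) by blast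
  then have "negligible K" by (rule negligible_subset) (use assms(2) in auto)
  then show ?thesis unfolding vol_def by (rule negligible_imp_measure0)
qed

lemma vol_0_width:
  assumes "convex_body K" "u \<noteq> 0" "width K u = 0" shows "vol K = 0"
proof (rule vol_0_hyperplane[OF assms(2)])
  fix x assume x: "x \<in> K"
  show "u \<bullet> x = sf K u"
    using sf_upper[OF assms(1) x, of u] sf_upper[OF assms(1) x, of "-u"] assms(3)
    unfolding width_def by (simp add: inner_commute)
qed

text \<open>This is the absolute value of the determinant of the frame; the rules for determinants
  are derived below from properties of volume.\<close>

definition kap :: "('n \<Rightarrow> real^'n) \<Rightarrow> real" where "kap e = vol (bx e (\<lambda>_. 1))"

lemma cmb_vec: "(\<Sum>i\<in>UNIV. x $ i *\<^sub>R e i) = cmb e (\<lambda>i. x $ i)"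
  by (simp add: cmb_def)

lemma frame_linear_inj: "frame e \<Longrightarrow> inj (\<lambda>x::real^'n. \<Sum>i\<in>UNIV. x $ i *\<^sub>R e i)"
  by (rule injI) (auto simp: cmb_vec vec_eq_iff dest: frame_inj fun_cong)

lemma frame_span: fixes e :: "'n \<Rightarrow> real^'n" assumes "frame e" obtains a where "v = cmb e a"
proof -
  have "surj (\<lambda>x::real^'n. \<Sum>i\<in>UNIV. x $ i *\<^sub>R e i)"
    using linear_injective_imp_surjective[OF linear_frame frame_linear_inj[OF assms]] by simp
  then obtain x where "v = (\<Sum>i\<in>UNIV. x $ i *\<^sub>R e i)" by blast
  then show ?thesis using that by (simp add: cmb_vec)
qed

lemma open_image_open_cube: "open ((\<lambda>x::real^'n. \<Sum>i\<in>UNIV. x $ i *\<^sub>R e i) ` box 0 1)" if "frame e"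
  using open_surjective_linear_image[OF open_box linear_frame]
    linear_injective_imp_surjective[OF linear_frame frame_linear_inj[OF that]] by blast

lemma kap_pos: fixes e :: "'n \<Rightarrow> real^'n" assumes "frame e" shows "kap e > 0"
proof -
  let ?f = "\<lambda>x::real^'n. \<Sum>i\<in>UNIV. x $ i *\<^sub>R e i"
  have "box (0::real^'n) 1 \<noteq> {}" unfolding interval_ne_empty_cart by simp
  then have "\<not> negligible (?f ` box 0 1)"
    using open_not_negligible[OF open_image_open_cube[OF assms]] by simp
  moreover have "?f ` box 0 1 \<subseteq> bx e (\<lambda>_. 1)"
    unfolding bx_image by (rule image_mono) (auto simp: mem_box_cart less_imp_le)
  ultimately have "\<not> negligible (bx e (\<lambda>_. 1))" using negligible_subset by blast
  then have "vol (bx e (\<lambda>_. 1)) \<noteq> 0"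
    unfolding vol_def
    using negligible_iff_measure0[OF convex_body_lmeasurable[OF convex_body_bx[of "\<lambda>_. 1" e]]] by simp
  then show ?thesis unfolding kap_def using vol_nonneg[of "bx e (\<lambda>_. 1)"] by linarith
qed

text \<open>The other n - 1 vectors leave room for a nonzero normal \<open>x\<close>. It cannot be
  orthogonal to \<open>e i\<close> as well, since it would then be orthogonal to itself.\<close>

lemma frame_dual:
  fixes e :: "'n \<Rightarrow> real^'n"
  assumes "frame e"
  obtains u where "e i \<bullet> u = 1" "\<And>j. j \<noteq> i \<Longrightarrow> e j \<bullet> u = 0"
proof -
  let ?S = "e ` (UNIV - {i})"
  have "dim ?S \<le> card ?S" by (rule dim_le_card') simp
  also have "\<dots> \<le> card (UNIV - {i})" by (rule card_image_le) simp
  also have "\<dots> < DIM(real^'n)" by (simp add: card_Diff_subset)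
  finally obtain x where x: "x \<noteq> 0" "\<And>y. y \<in> span ?S \<Longrightarrow> orthogonal x y"
    using orthogonal_to_subspace_exists by blast
  have 0: "e j \<bullet> x = 0" if "j \<noteq> i" for j
    using x(2)[of "e j"] that by (simp add: orthogonal_def inner_commute span_base)
  obtain a where a: "x = cmb e a" using frame_span[OF assms] by metis
  have "x \<bullet> x = (\<Sum>j\<in>UNIV. a j * (e j \<bullet> x))"
    by (subst (1) a) (simp add: cmb_def inner_sum_left)
  also have "\<dots> = (\<Sum>j\<in>UNIV. if j = i then a i * (e i \<bullet> x) else 0)"
    by (rule sum.cong) (auto simp: 0)
  finally have "x \<bullet> x = a i * (e i \<bullet> x)" by simp
  then have "e i \<bullet> x \<noteq> 0" using x(1) by (metis inner_eq_zero_iff mult_zero_right)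
  then have "e i \<bullet> ((1 / (e i \<bullet> x)) *\<^sub>R x) = 1" by simp
  then show ?thesis using that[of "(1 / (e i \<bullet> x)) *\<^sub>R x"] 0 by simp
qed

lemma multihomogeneous_prod:
  fixes F :: "('n::finite \<Rightarrow> real) \<Rightarrow> real"
  assumes hom: "\<And>i l s. (\<And>j. 0 \<le> l j) \<Longrightarrow> 0 \<le> s \<Longrightarrow> F (l(i := s)) = s * F (l(i := 1))"
    and l: "\<And>i. 0 \<le> l i"
  shows "F l = F (\<lambda>_. 1) * (\<Prod>i\<in>UNIV. l i)"
proof -
  have "F (\<lambda>i. if i \<in> A then l i else 1) = F (\<lambda>_. 1) * (\<Prod>i\<in>A. l i)" if "finite A" for A
    using that
  proof (induction A rule: finite_induct)
    case (insert a A)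
    let ?m = "\<lambda>i. if i \<in> A then l i else 1"
    have "(\<lambda>i. if i \<in> insert a A then l i else 1) = ?m(a := l a)" by auto
    moreover have "?m(a := 1) = ?m" using insert.hyps by auto
    ultimately have "F (\<lambda>i. if i \<in> insert a A then l i else 1) = l a * F ?m"
      using hom[of ?m "l a" a] l by auto
    then show ?case using insert by simp
  qed simp
  from this[of UNIV] show ?thesis by simp
qed

text \<open>Cutting across one edge splits the box into two boxes that overlap in a hyperplane, so
  the volume is additive and monotone, hence linear, in each edge length.\<close>

lemma vol_bx:
  assumes e: "frame e" and l: "\<And>i. 0 \<le> l i"
  shows "vol (bx e l) = kap e * (\<Prod>i\<in>UNIV. l i)"
  unfolding kap_def
proof (rule multihomogeneous_prod[OF _ l, where F = "\<lambda>l. vol (bx e l)"])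
  fix i and l :: "'a \<Rightarrow> real" and s :: real
  assume l: "\<And>j. 0 \<le> l j" and s: "0 \<le> s"
  have cb: "convex_body (bx e (l(i := r)))" if "r \<ge> 0" for r
    by (rule convex_body_bx) (use l that in auto)
  show "vol (bx e (l(i := s))) = s * vol (bx e (l(i := 1)))"
  proof (rule monotone_additive_linear[OF _ _ s, where g = "\<lambda>s. vol (bx e (l(i := s)))"])
    fix r q :: real assume rq: "0 \<le> r" "0 \<le> q"
    let ?A = "bx e (l(i := r))" and ?B = "(\<lambda>x. x + r *\<^sub>R e i) ` bx e (l(i := q))"
    obtain u where u: "e i \<bullet> u = 1" "\<And>j. j \<noteq> i \<Longrightarrow> e j \<bullet> u = 0" using frame_dual[OF e] by metis
    have "u \<noteq> 0" using u(1) by auto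
    have "vol (?A \<inter> ?B) = 0"
    proof (rule vol_0_hyperplane[OF \<open>u \<noteq> 0\<close>])
      fix x assume "x \<in> ?A \<inter> ?B"
      then have "x \<in> (\<lambda>x. x + r *\<^sub>R e i) ` bx e (l(i := 0))" using bx_split_Int[OF e rq] by blast
      then obtain t where t: "x = cmb e t + r *\<^sub>R e i" "\<And>j. 0 \<le> t j" "\<And>j. t j \<le> (l(i := 0)) j"
        by (auto elim!: bxE)
      have "t i = 0" using t(2,3)[of i] by simp
      have "t j * (e j \<bullet> u) = 0" for j using u(2)[of j] \<open>t i = 0\<close> by (cases "j = i") auto
      then have "cmb e t \<bullet> u = 0" unfolding cmb_def inner_sum_left inner_scaleR_left by (intro sum.neutral) blast
      then show "u \<bullet> x = r" using t(1) u(1) by (simp add: inner_add_left inner_commute[of u])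
    qed
    then show "vol (bx e (l(i := r + q))) = vol ?A + vol (bx e (l(i := q)))"
      unfolding bx_split[OF rq] vol_translate[of "r *\<^sub>R e i" "bx e (l(i := q))", symmetric]
      unfolding vol_def
      by (subst measure_Un3) (auto intro!: convex_body_lmeasurable convex_body_translate cb rq)
  next
    fix r q :: real assume rq: "0 \<le> r" "r \<le> q"
    then show "vol (bx e (l(i := r))) \<le> vol (bx e (l(i := q)))"
      by (intro vol_mono cb bx_mono) auto
  qed
qed

lemma kap_scaled: "frame e \<Longrightarrow> (\<And>i. 0 \<le> c i) \<Longrightarrow> kap (\<lambda>i. c i *\<^sub>R e i) = kap e * (\<Prod>i\<in>UNIV. c i)"
  unfolding kap_def[of "\<lambda>i. c i *\<^sub>R e i"] by (simp add: bx_scaled vol_bx)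

lemma frame_exchange:
  assumes "frame b" "v = cmb b a" "a k \<noteq> 0" shows "frame (b(k := v))"
  unfolding frame_def
proof (intro allI impI)
  fix t i assume 0: "cmb (b(k := v)) t = 0"
  have "cmb b (\<lambda>i. t i + (t k * a i - ind {k} (t k) i)) = cmb (b(k := v)) t"
    unfolding cmb_add cmb_diff cmb_scaleR cmb_single cmb_frame_upd assms(2)
    by (simp add: algebra_simps)
  then have *: "t i + (t k * a i - ind {k} (t k) i) = 0" for i
    using frameD[OF assms(1)] 0 by metis
  have "t k = 0" using *[of k] assms(3) by simp
  then show "t i = 0" using *[of i] by (simp add: ind_def split: if_splits)
qed

lemma frame_from_spanning:
  fixes S :: "(real^'n) set"
  assumes S: "\<And>u. u \<noteq> 0 \<Longrightarrow> \<exists>v\<in>S. v \<bullet> u \<noteq> 0"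
  obtains b :: "'n \<Rightarrow> real^'n" where "frame b" "\<And>k. b k \<in> S"
proof -
  have dimS: "dim S = CARD('n)"
  proof (rule ccontr)
    assume "dim S \<noteq> CARD('n)"
    then have "dim S < DIM(real^'n)" using dim_subset_UNIV[of S] by simp
    then obtain x where "x \<noteq> 0" "\<And>y. y \<in> span S \<Longrightarrow> orthogonal x y"
      using orthogonal_to_subspace_exists by blast
    then show False using S[of x] by (metis inner_commute orthogonal_def span_base)
  qed
  obtain B where B: "B \<subseteq> S" "independent B" "card B = dim S"
    using basis_exists[of S] by metis
  have finB: "finite B" using B(2) independent_imp_finite by blast
  obtain b where b: "bij_betw b (UNIV::'n set) B"
    using finite_same_card_bij[of "UNIV::'n set" B] finB B(3) dimS by auto
  have "frame b" unfolding frame_def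
  proof (intro allI impI)
    fix t i assume "cmb b t = 0"
    define q where "q v = t (inv_into UNIV b v)" for v
    have q: "q (b i) = t i" for i unfolding q_def using b by (simp add: bij_betw_def)
    have "(\<Sum>v\<in>B. q v *\<^sub>R v) = (\<Sum>i\<in>UNIV. q (b i) *\<^sub>R b i)"
      using sum.reindex_bij_betw[OF b, of "\<lambda>v. q v *\<^sub>R v"] by simp
    then have "(\<Sum>v\<in>B. q v *\<^sub>R v) = 0" using \<open>cmb b t = 0\<close> by (simp add: q cmb_def)
    then have "\<forall>v\<in>B. q v = 0" using B(2) dependent_finite[OF finB] by blast
    then show "t i = 0" using q[of i] b by (auto simp: bij_betw_def)
  qed
  moreover have "b k \<in> S" for k using b B(1) by (auto simp: bij_betw_def)
  ultimately show ?thesis using that by blast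
qed

text \<open>By convexity \<open>K\<close> contains the average of its n segments from
  \<open>a k\<close> to \<open>a k + v k\<close>. This average is a translate of the parallelotope
  with edges \<open>v k\<close> divided by n, which explains the factor n to the power n.\<close>

lemma vol_ge_kap:
  fixes v :: "'n \<Rightarrow> real^'n"
  assumes K: "convex_body K" and v: "frame v" and a: "\<And>k. a k \<in> K" "\<And>k. a k + v k \<in> K"
  shows "kap v \<le> real CARD('n) ^ CARD('n) * vol K"
proof -
  let ?n = "real CARD('n)"
  have n: "?n > 0" by simp
  let ?c = "\<Sum>k\<in>UNIV. (1/?n) *\<^sub>R a k"
  let ?T = "(\<lambda>x. x + ?c) ` bx v (\<lambda>_. 1/?n)"
  have sub: "?T \<subseteq> K"
  proof
    fix y assume "y \<in> ?T"
    then obtain t where t: "y = cmb v t + ?c" "\<And>k. 0 \<le> t k" "\<And>k. t k \<le> 1/?n"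
      by (auto elim!: bxE)
    have "y = (\<Sum>k\<in>UNIV. (1/?n) *\<^sub>R (a k + (?n * t k) *\<^sub>R v k))"
      unfolding t(1) cmb_def by (simp add: scaleR_right_distrib sum.distrib)
    also have "\<dots> \<in> K"
    proof (rule convex_sum)
      show "convex K" using K unfolding convex_body_def by blast
      fix k
      have "?n * t k \<le> 1" using t(3)[of k] n by (simp add: field_simps)
      moreover have "a k + (?n * t k) *\<^sub>R v k = (1 - ?n * t k) *\<^sub>R a k + (?n * t k) *\<^sub>R (a k + v k)"
        by (simp add: algebra_simps)
      ultimately show "a k + (?n * t k) *\<^sub>R v k \<in> K"
        using convexD_alt[OF \<open>convex K\<close> a(1)[of k] a(2)[of k], of "?n * t k"] t(2)[of k] by simp
    qed auto
    finally show "y \<in> K" .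
  qed
  have cb: "convex_body ?T" by (intro convex_body_translate convex_body_bx) simp
  have "kap v * (1/?n) ^ CARD('n) = vol ?T"
    by (simp only: vol_translate) (simp add: vol_bx[OF v])
  also have "\<dots> \<le> vol K" using vol_mono[OF cb K sub] .
  finally show ?thesis using n by (simp add: field_simps)
qed

lemma bx_reindex_subset:
  assumes "bij_betw p J' J" "\<And>j. j \<in> J' \<Longrightarrow> e' j = e (p j)" "t \<ge> 0"
  shows "bx e' (ind J' t) \<subseteq> bx e (ind J t)"
proof
  fix x assume "x \<in> bx e' (ind J' t)"
  then obtain s where s: "x = cmb e' s" "\<And>j. 0 \<le> s j" "\<And>j. s j \<le> ind J' t j" by (rule bxE) blast
  define r where "r k = (if k \<in> J then s (inv_into J' p k) else 0)" for k
  have s0: "s j = 0" if "j \<notin> J'" for j using s(2)[of j] s(3)[of j] that by simp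
  have inv: "inv_into J' p (p j) = j" if "j \<in> J'" for j
    using assms(1) that by (simp add: bij_betw_def)
  have "x = (\<Sum>j\<in>J'. s j *\<^sub>R e' j)" unfolding s(1) cmb_def
    by (rule sum.mono_neutral_right) (auto simp: s0)
  also have "\<dots> = (\<Sum>j\<in>J'. r (p j) *\<^sub>R e (p j))"
    by (rule sum.cong) (use assms inv in \<open>auto simp: r_def bij_betw_def\<close>)
  also have "\<dots> = (\<Sum>k\<in>J. r k *\<^sub>R e k)"
    using sum.reindex_bij_betw[OF assms(1), of "\<lambda>k. r k *\<^sub>R e k"] .
  also have "\<dots> = cmb e r" unfolding cmb_def
    by (rule sum.mono_neutral_left) (auto simp: r_def)
  finally have "x = cmb e r" .
  moreover have "0 \<le> r k \<and> r k \<le> ind J t k" for k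
    using s(2,3)[of "inv_into J' p k"] inv_into_into[of k p J'] assms(1)
    by (auto simp: r_def bij_betw_def)
  ultimately show "x \<in> bx e (ind J t)" using bxI by metis
qed

lemma bx_reindex:
  assumes "bij_betw p J' J" "\<And>j. j \<in> J' \<Longrightarrow> e' j = e (p j)" "t \<ge> 0"
  shows "bx e' (ind J' t) = bx e (ind J t)"
proof
  show "bx e' (ind J' t) \<subseteq> bx e (ind J t)" by (rule bx_reindex_subset[OF assms(1) _ assms(3)]) (rule assms(2))
  have "e k = e' (inv_into J' p k)" if "k \<in> J" for k
    using assms(1,2) that by (metis bij_betw_imp_surj_on f_inv_into_f inv_into_into)
  then show "bx e (ind J t) \<subseteq> bx e' (ind J' t)"
    using bx_reindex_subset[OF bij_betw_inv_into[OF assms(1)] _ assms(3)] by blast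
qed

text \<open>Small \<open>t\<close> excludes exponent 0, large \<open>t\<close> excludes exponents
  above 1.\<close>

lemma power_growth_unique:
  fixes A B :: real
  assumes A: "A > 0" and le: "\<And>t. t > 0 \<Longrightarrow> A * t ^ m \<le> B * t"
  shows "m = 1"
proof (rule ccontr)
  assume "m \<noteq> 1"
  then consider "m = 0" | "m \<ge> 2" by linarith
  then show False
  proof cases
    case 1
    have "B > 0" using le[of 1] A 1 by simp
    then show False using le[of "A / (2 * B)"] A 1 by (simp add: field_simps)
  next
    case 2
    let ?t = "max 1 (B / A + 1)"
    have t: "?t \<ge> 1" by simp
    have "A * ?t ^ 2 \<le> A * ?t ^ m" using A power_increasing[OF 2 t] by (intro mult_left_mono) auto
    also have "\<dots> \<le> B * ?t" using le[of ?t] t by linarith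
    finally have "(A * ?t) * ?t \<le> B * ?t" by (simp add: power2_eq_square)
    then have "A * ?t \<le> B" using t by (simp add: mult_le_cancel_right)
    moreover have "A * (B / A + 1) \<le> A * ?t" using A by (intro mult_left_mono) auto
    moreover have "A * (B / A + 1) = B + A" using A by (simp add: field_simps)
    ultimately show False using A by linarith
  qed
qed

section \<open>Simple valuations\<close>

lemma cmb_axis_nth: "cmb (\<lambda>i. axis i 1) t $ i = t i" for t :: "'n::finite \<Rightarrow> real"
  unfolding cmb_def by (simp add: axis_def if_distrib[of "\<lambda>x. _ * x"] cong: if_cong)

lemma frame_axis: "frame (\<lambda>i. axis i 1 :: real^'n)"
  unfolding frame_def by (metis cmb_axis_nth zero_index)

lemma coordinate_halfspaces:
  "closed {x::real^'n. x $ i \<le> c}" "closed {x::real^'n. x $ i \<ge> c}"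
  "convex {x::real^'n. x $ i \<le> c}" "convex {x::real^'n. x $ i \<ge> c}"
proof -
  have "{x::real^'n. x $ i \<le> c} = {x. axis i 1 \<bullet> x \<le> c}" "{x::real^'n. x $ i \<ge> c} = {x. axis i 1 \<bullet> x \<ge> c}"
    by (auto simp: inner_axis')
  then show "closed {x::real^'n. x $ i \<le> c}" "closed {x::real^'n. x $ i \<ge> c}"
    "convex {x::real^'n. x $ i \<le> c}" "convex {x::real^'n. x $ i \<ge> c}"
    by (simp_all add: closed_halfspace_le closed_halfspace_ge convex_halfspace_le convex_halfspace_ge)
qed

lemma convex_body_Int: "convex_body K \<Longrightarrow> closed S \<Longrightarrow> convex S \<Longrightarrow> K \<inter> S \<noteq> {} \<Longrightarrow> convex_body (K \<inter> S)"
  unfolding convex_body_def by (simp add: compact_Int_closed convex_Int)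

lemmas convex_body_Int_halfspace =
  convex_body_Int[OF _ coordinate_halfspaces(1) coordinate_halfspaces(3)]
  convex_body_Int[OF _ coordinate_halfspaces(2) coordinate_halfspaces(4)]

text \<open>Cutting orthogonally to an axis makes \<psi> additive in each edge length, and
  monotonicity makes it linear there, exactly as for volume.\<close>

lemma simple_valuation_box:
  fixes \<psi> :: "(real^'n) set \<Rightarrow> real"
  assumes tr: "\<And>K t. convex_body K \<Longrightarrow> \<psi> ((\<lambda>x. x + t) ` K) = \<psi> K"
    and mono: "\<And>K L. convex_body K \<Longrightarrow> convex_body L \<Longrightarrow> K \<subseteq> L \<Longrightarrow> \<psi> K \<le> \<psi> L"
    and cut: "\<And>K i c. convex_body K \<Longrightarrow> K \<inter> {x. x $ i \<le> c} \<noteq> {} \<Longrightarrow> K \<inter> {x. x $ i \<ge> c} \<noteq> {} \<Longrightarrow>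
      \<psi> K = \<psi> (K \<inter> {x. x $ i \<le> c}) + \<psi> (K \<inter> {x. x $ i \<ge> c})"
    and ab: "\<And>i. a $ i \<le> b $ i"
  shows "\<psi> (cbox a b) = \<psi> (cbox 0 1) * measure lborel (cbox a b)"
proof -
  have box0: "\<psi> (cbox 0 (\<chi> i. l i)) = \<psi> (cbox 0 (\<chi> i. 1)) * (\<Prod>i\<in>UNIV. l i)" if l: "\<And>i. 0 \<le> l i" for l
  proof (rule multihomogeneous_prod[OF _ l, where F = "\<lambda>l. \<psi> (cbox 0 (\<chi> i. l i))"])
    fix i and l :: "'n \<Rightarrow> real" and s :: real
    assume l: "\<And>j. 0 \<le> l j" and s: "0 \<le> s"
    let ?Q = "\<lambda>r. cbox 0 (\<chi> j. (l(i := r)) j)"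
    have memQ: "x \<in> ?Q r \<longleftrightarrow> 0 \<le> x $ i \<and> x $ i \<le> r \<and> (\<forall>j. j \<noteq> i \<longrightarrow> 0 \<le> x $ j \<and> x $ j \<le> l j)" for x r
      by (auto simp: mem_box_cart)
    have cb: "convex_body (?Q r)" if "r \<ge> 0" for r
    proof -
      have "0 \<in> ?Q r" using memQ l that by auto
      then show ?thesis unfolding convex_body_def using convex_box(1) compact_cbox by blast
    qed
    show "\<psi> (?Q s) = s * \<psi> (?Q 1)"
    proof (rule monotone_additive_linear[OF _ _ s, where g = "\<lambda>s. \<psi> (?Q s)"])
      fix r q :: real assume rq: "0 \<le> r" "0 \<le> q"
      have 1: "?Q (r + q) \<inter> {x. x $ i \<le> r} = ?Q r" using memQ rq by auto
      have 2: "?Q (r + q) \<inter> {x. x $ i \<ge> r} = (\<lambda>x. x + axis i r) ` ?Q q"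
      proof (intro set_eqI iffI)
        fix x assume x: "x \<in> ?Q (r + q) \<inter> {x. x $ i \<ge> r}"
        then have "x - axis i r \<in> ?Q q" using memQ by (auto simp: axis_def)
        then show "x \<in> (\<lambda>x. x + axis i r) ` ?Q q" by (rule rev_image_eqI) simp
      next
        fix x assume "x \<in> (\<lambda>x. x + axis i r) ` ?Q q"
        then show "x \<in> ?Q (r + q) \<inter> {x. x $ i \<ge> r}" using memQ rq by (auto simp: axis_def)
      qed
      have "?Q r \<noteq> {}" "?Q q \<noteq> {}" using cb[OF rq(1)] cb[OF rq(2)] unfolding convex_body_def by blast+
      then have "\<psi> (?Q (r + q)) = \<psi> (?Q r) + \<psi> ((\<lambda>x. x + axis i r) ` ?Q q)"
        using cut[of "?Q (r + q)" i r] cb[of "r + q"] rq 1 2 by simp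
      then show "\<psi> (?Q (r + q)) = \<psi> (?Q r) + \<psi> (?Q q)" using tr[OF cb[OF rq(2)]] by simp
    next
      fix r q :: real assume rq: "0 \<le> r" "r \<le> q"
      then have "?Q r \<subseteq> ?Q q" using memQ by auto
      then show "\<psi> (?Q r) \<le> \<psi> (?Q q)" using mono cb rq by simp
    qed
  qed
  have ne: "cbox 0 (b - a) \<noteq> {}" using ab by (simp add: interval_ne_empty_cart)
  have "\<psi> (cbox a b) = \<psi> ((\<lambda>x. x + a) ` cbox 0 (b - a))"
    using cbox_translation[of a 0 "b - a"] by (simp add: add.commute)
  also have "\<dots> = \<psi> (cbox 0 (b - a))"
    by (rule tr) (use ne in \<open>auto simp: convex_body_def convex_box\<close>)
  also have "\<dots> = \<psi> (cbox 0 1) * (\<Prod>i\<in>UNIV. b $ i - a $ i)"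
    using box0[of "\<lambda>i. b $ i - a $ i"] ab by (simp add: vec_eq_iff one_vec_def minus_vec_def)
  also have "(\<Prod>i\<in>UNIV. b $ i - a $ i) = measure lborel (cbox a b)"
    using ab by (simp add: content_cbox_cart interval_ne_empty_cart)
  finally show ?thesis .
qed

text \<open>The function \<open>\<psi> (K \<inter> k)\<close> of a cell \<open>k\<close> is additive
  under division of boxes. On a fine division it agrees with \<open>\<psi> (cbox 0 1)\<close> times
  the volume of the cell or with 0, except for cells tagged on the frontier, which is negligible. So
  \<psi> K is the gauge integral of a multiple of the indicator of the interior.\<close>

lemma simple_valuation_eq_vol:
  fixes \<psi> :: "(real^'n) set \<Rightarrow> real"
  assumes tr: "\<And>K t. convex_body K \<Longrightarrow> \<psi> ((\<lambda>x. x + t) ` K) = \<psi> K"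
    and mono: "\<And>K L. convex_body K \<Longrightarrow> convex_body L \<Longrightarrow> K \<subseteq> L \<Longrightarrow> \<psi> K \<le> \<psi> L"
    and cut: "\<And>K i c. convex_body K \<Longrightarrow> K \<inter> {x. x $ i \<le> c} \<noteq> {} \<Longrightarrow> K \<inter> {x. x $ i \<ge> c} \<noteq> {} \<Longrightarrow>
      \<psi> K = \<psi> (K \<inter> {x. x $ i \<le> c}) + \<psi> (K \<inter> {x. x $ i \<ge> c})"
    and deg: "\<And>K i c. convex_body K \<Longrightarrow> K \<subseteq> {x. x $ i = c} \<Longrightarrow> \<psi> K = 0"
    and K: "convex_body K"
  shows "\<psi> K = \<psi> (cbox 0 1) * vol K"
proof -
  define c where "c = \<psi> (cbox 0 1)"
  have nonneg: "\<psi> M \<ge> 0" if M: "convex_body M" for M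
  proof -
    obtain p where "p \<in> M" using M unfolding convex_body_def by auto
    then have "\<psi> {p} \<le> \<psi> M" using mono M by (simp add: convex_body_sing)
    then show ?thesis using deg[of "{p}" undefined "p $ undefined"] by (simp add: convex_body_sing)
  qed
  have c0: "c \<ge> 0" unfolding c_def
    by (rule nonneg) (simp add: convex_body_def convex_box interval_ne_empty_cart)
  have cK: "closed K" "convex K" "bounded K" "compact K" using K unfolding convex_body_def
    by (auto simp: compact_imp_closed compact_imp_bounded)
  obtain a b where sub: "K \<subseteq> cbox a b" using bounded_subset_cbox_symmetric[OF cK(3)] by metis
  \<comment> \<open>The empty set is not a body and \<psi> is not controlled there; the value 0
    keeps \<open>g\<close> additive when part of a cell misses \<open>K\<close>.\<close>
  define g where "g S = (if K \<inter> S = {} then 0 else \<psi> (K \<inter> S))" for S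
  note cbI = convex_body_Int[OF K]
  have op: "operative plus (0::real) g"
  proof (intro operative.intro operative_axioms.intro)
    show "comm_monoid_set plus (0::real)" by (rule sum.comm_monoid_set_axioms)
    fix a b :: "real^'n" assume "box a b = {}"
    then obtain i where i: "b $ i \<le> a $ i" by (auto simp: interval_eq_empty_cart)
    show "g (cbox a b) = 0"
    proof (cases "K \<inter> cbox a b = {}")
      case False
      have "x $ i = a $ i" if "x \<in> cbox a b" for x
        using i that[unfolded mem_box_cart, rule_format, of i] by linarith
      then have "K \<inter> cbox a b \<subseteq> {x. x $ i = a $ i}" by auto
      then have "\<psi> (K \<inter> cbox a b) = 0"
        by (rule deg[OF cbI[OF closed_cbox convex_box(1) False]])
      then show ?thesis by (simp add: g_def)
    qed (simp add: g_def)
  next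
    fix a b k :: "real^'n" and d :: real assume "k \<in> Basis"
    then obtain i where k: "k = axis i 1" by (auto simp: Basis_vec_def)
    have xk: "x \<bullet> k = x $ i" for x unfolding k by (simp add: inner_axis)
    let ?S = "cbox a b" and ?L = "{x::real^'n. x $ i \<le> d}" and ?G = "{x::real^'n. x $ i \<ge> d}"
    have LG: "?L \<union> ?G = UNIV" by auto
    have "g ?S = g (?S \<inter> ?L) + g (?S \<inter> ?G)"
    proof (cases "K \<inter> ?S \<inter> ?L = {} \<or> K \<inter> ?S \<inter> ?G = {}")
      case True
      then consider "K \<inter> (?S \<inter> ?L) = {}" "K \<inter> (?S \<inter> ?G) = K \<inter> ?S"
        | "K \<inter> (?S \<inter> ?G) = {}" "K \<inter> (?S \<inter> ?L) = K \<inter> ?S"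
        using LG by blast
      then show ?thesis by cases (simp_all add: g_def)
    next
      case False
      then have "K \<inter> ?S \<noteq> {}" by blast
      then have "\<psi> (K \<inter> ?S) = \<psi> (K \<inter> ?S \<inter> ?L) + \<psi> (K \<inter> ?S \<inter> ?G)"
        using cut[OF cbI[OF closed_cbox convex_box(1)]] False by blast
      then show ?thesis using False \<open>K \<inter> ?S \<noteq> {}\<close> by (simp add: g_def Int_assoc)
    qed
    then show "g ?S = g (?S \<inter> {x. x \<bullet> k \<le> d}) + g (?S \<inter> {x. d \<le> x \<bullet> k})" by (simp add: xk)
  qed
  have gsum: "(\<Sum>(x, k)\<in>D. g k) = g (cbox a b)" if "D tagged_division_of (cbox a b)" for D
    using operative.tagged_division[OF op that] by (simp add: sum_def)
  have gab: "g (cbox a b) = \<psi> K"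
    using sub K unfolding g_def convex_body_def by (simp add: Int_absorb2)
  define f where "f x = (if x \<in> interior K then c else 0)" for x
  have "negligible (frontier K)" by (rule negligible_convex_frontier[OF cK(2)])
  then have fr: "(indicat_real (frontier K) has_integral 0) (cbox a b)" by (simp add: negligible)
  have frK: "frontier K = K - interior K" unfolding frontier_def using cK(1) by simp
  have "(f has_integral \<psi> K) (cbox a b)"
    unfolding has_integral
  proof (intro allI impI)
    fix e :: real assume e: "e > 0"
    \<comment> \<open>The denominator \<open>c + 1\<close> admits c = 0 and still makes
      \<open>c * (e / (c + 1))\<close> strictly smaller than \<open>e\<close>.\<close>
    then have e1: "e / (c + 1) > 0" using c0 by simp
    then obtain \<gamma>1 where \<gamma>1: "gauge \<gamma>1"
      "\<And>D. D tagged_division_of (cbox a b) \<Longrightarrow> \<gamma>1 fine D \<Longrightarrow>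
        norm ((\<Sum>(x, k)\<in>D. measure lborel k *\<^sub>R indicat_real (frontier K) x) - 0) < e / (c + 1)"
      using fr[unfolded has_integral] by meson
    \<comment> \<open>Cells tagged in the interior are forced into \<open>K\<close>, cells tagged
      outside are forced off \<open>K\<close>, and cells tagged on the frontier are left to
      \<gamma>1.\<close>
    define \<gamma>2 where "\<gamma>2 x = (if x \<in> interior K then interior K else if x \<in> K then UNIV else - K)" for x
    have g2: "gauge \<gamma>2" unfolding gauge_def \<gamma>2_def using cK(1) by auto
    show "\<exists>\<gamma>. gauge \<gamma> \<and> (\<forall>D. D tagged_division_of (cbox a b) \<and> \<gamma> fine D \<longrightarrow>
        norm ((\<Sum>(x, k)\<in>D. measure lborel k *\<^sub>R f x) - \<psi> K) < e)"
    proof (intro exI[of _ "\<lambda>x. \<gamma>1 x \<inter> \<gamma>2 x"] conjI allI impI)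
      show "gauge (\<lambda>x. \<gamma>1 x \<inter> \<gamma>2 x)" using gauge_Int \<gamma>1(1) g2 by blast
      fix D assume "D tagged_division_of (cbox a b) \<and> (\<lambda>x. \<gamma>1 x \<inter> \<gamma>2 x) fine D"
      then have D: "D tagged_division_of (cbox a b)" "\<gamma>1 fine D" "\<gamma>2 fine D" by (auto simp: fine_Int)
      have trm: "\<bar>measure lborel k *\<^sub>R f x - g k\<bar> \<le> c * (measure lborel k *\<^sub>R indicat_real (frontier K) x)"
        if xk: "(x, k) \<in> D" for x k
      proof -
        have xink: "x \<in> k" using tagged_division_ofD(2)[OF D(1) xk] .
        obtain p q where kpq: "k = cbox p q" using tagged_division_ofD(4)[OF D(1) xk] by blast
        have fine: "k \<subseteq> \<gamma>2 x" using D(3) xk unfolding fine_def by auto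
        have cbk: "convex_body k" using xink unfolding kpq convex_body_def by (auto simp: convex_box)
        have pq: "p $ i \<le> q $ i" for i using xink unfolding kpq by (metis mem_box_cart(2) order_trans)
        have psik: "\<psi> k = c * measure lborel k"
          unfolding kpq c_def by (rule simple_valuation_box[OF tr mono cut pq])
        consider "x \<in> interior K" | "x \<in> K" "x \<notin> interior K" | "x \<notin> K" by blast
        then show ?thesis
        proof cases
          case 1
          then have "k \<subseteq> K" using fine interior_subset unfolding \<gamma>2_def by auto
          then have "g k = \<psi> k" using xink unfolding g_def by (auto simp: Int_absorb1)
          then show ?thesis using 1 psik by (simp add: f_def frK)
        next
          case 2
          then have ne: "K \<inter> k \<noteq> {}" using xink by blast
          have cbKk: "convex_body (K \<inter> k)" using cbI[of k] ne unfolding kpq by (simp add: convex_box closed_cbox)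
          have "g k = \<psi> (K \<inter> k)" using ne by (simp add: g_def)
          moreover have "\<psi> (K \<inter> k) \<le> \<psi> k" by (rule mono[OF cbKk cbk]) auto
          moreover have "\<psi> (K \<inter> k) \<ge> 0" by (rule nonneg[OF cbKk])
          ultimately show ?thesis using 2 psik by (simp add: f_def frK)
        next
          case 3
          then have "K \<inter> k = {}" using fine interior_subset[of K] unfolding \<gamma>2_def by (auto split: if_splits)
          then show ?thesis using 3 interior_subset[of K] by (auto simp: g_def f_def frK)
        qed
      qed
      let ?s = "\<Sum>(x, k)\<in>D. measure lborel k *\<^sub>R indicat_real (frontier K) x"
      have "(\<Sum>(x, k)\<in>D. measure lborel k *\<^sub>R f x) - \<psi> K = (\<Sum>(x, k)\<in>D. measure lborel k *\<^sub>R f x - g k)"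
        using gsum[OF D(1)] gab by (simp add: sum_subtractf case_prod_beta')
      then have "norm ((\<Sum>(x, k)\<in>D. measure lborel k *\<^sub>R f x) - \<psi> K) \<le> (\<Sum>(x, k)\<in>D. \<bar>measure lborel k *\<^sub>R f x - g k\<bar>)"
        using sum_abs[of "\<lambda>(x, k). measure lborel k *\<^sub>R f x - g k" D] by (simp add: case_prod_beta')
      also have "\<dots> \<le> (\<Sum>(x, k)\<in>D. c * (measure lborel k *\<^sub>R indicat_real (frontier K) x))"
        by (rule sum_mono) (use trm in auto)
      also have "\<dots> = c * ?s" by (simp add: sum_distrib_left case_prod_beta')
      also have "\<dots> \<le> c * (e / (c + 1))"
        using \<gamma>1(2)[OF D(1,2)] c0 by (intro mult_left_mono) auto
      also have "\<dots> < e" using e c0 by (simp add: field_simps)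
      finally show "norm ((\<Sum>(x, k)\<in>D. measure lborel k *\<^sub>R f x) - \<psi> K) < e" .
    qed
  qed
  then have "\<psi> K = integral (cbox a b) f" by (rule integral_unique[symmetric])
  also have "f = (\<lambda>x. c * indicat_real (interior K) x)" by (auto simp: f_def)
  also have "integral (cbox a b) (\<lambda>x. c * indicat_real (interior K) x) = c * measure lebesgue (interior K)"
  proof -
    have "interior K \<inter> cbox a b = interior K" using sub interior_subset by blast
    then show ?thesis using integral_indicator[of "interior K" "cbox a b"] cK(3)
      by (simp add: lmeasurable_interior)
  qed
  also have "measure lebesgue (interior K) = vol K"
    unfolding vol_def by (rule measure_interior[OF cK(3)]) (rule negligible_convex_frontier[OF cK(2)])
  finally show ?thesis unfolding c_def .
qed

section \<open>Linear images and the difference body\<close>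

lemma cmb_linear: "linear g \<Longrightarrow> g (cmb e t) = cmb (\<lambda>i. g (e i)) t"
  unfolding cmb_def by (simp add: linear_sum linear_scale)

lemma bx_linear: "linear g \<Longrightarrow> g ` bx e l = bx (\<lambda>i. g (e i)) l"
  unfolding bx_def setcompr_eq_image image_image by (simp add: cmb_linear)

lemma linear_inj_of_frames:
  assumes "linear g" "frame v" "frame (\<lambda>i. g (v i))" shows "inj g"
  unfolding linear_injective_0[OF assms(1)]
proof (intro allI impI)
  fix x assume "g x = 0"
  obtain a where a: "x = cmb v a" using frame_span[OF assms(2)] by metis
  then have "cmb (\<lambda>i. g (v i)) a = 0" using \<open>g x = 0\<close> cmb_linear[OF assms(1)] by metis
  then have "a = (\<lambda>_. 0)" using frameD[OF assms(3)] by blast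
  then show "x = 0" using a by simp
qed

lemma frame_map:
  fixes v w :: "'n \<Rightarrow> real^'n"
  assumes "frame v"
  obtains g where "linear g" "\<And>k. g (v k) = w k"
proof -
  let ?f = "\<lambda>x::real^'n. \<Sum>i\<in>UNIV. x $ i *\<^sub>R v i"
  obtain h where h: "linear h" "h \<circ> ?f = id"
    using linear_injective_left_inverse[OF linear_frame frame_linear_inj[OF assms]] by blast
  let ?g = "\<lambda>x. \<Sum>i\<in>UNIV. h x $ i *\<^sub>R w i"
  have "linear ?g" using linear_compose[OF h(1) linear_frame[of w]] by (simp add: comp_def)
  moreover have "?g (v k) = w k" for k
  proof -
    have ax: "(\<Sum>i\<in>UNIV. axis k 1 $ i *\<^sub>R z i) = z k" for z :: "'n \<Rightarrow> real^'n"
      by (simp add: axis_def if_distrib[of "\<lambda>x. x *\<^sub>R _"] cong: if_cong)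
    have "h (v k) = axis k 1" using fun_cong[OF h(2), of "axis k 1"] ax[of v] by simp
    then show ?thesis by (simp only: ax)
  qed
  ultimately show ?thesis using that by blast
qed

lemma convex_body_linear_image: "linear g \<Longrightarrow> convex_body K \<Longrightarrow> convex_body (g ` K)"
  unfolding convex_body_def
  by (simp add: convex_linear_image compact_continuous_image linear_continuous_on linear_conv_bounded_linear)

text \<open>The volume of the image is itself a simple, monotone, translation invariant valuation,
  hence a multiple of volume; the unit cube gives the factor.\<close>

lemma vol_linear_image:
  fixes g :: "real^'n \<Rightarrow> real^'n"
  assumes g: "linear g" "inj g" and K: "convex_body K"
  shows "vol (g ` K) = vol (g ` cbox 0 1) * vol K"
proof (rule simple_valuation_eq_vol[OF _ _ _ _ K])
  fix K :: "(real^'n) set" assume K: "convex_body K"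
  show "vol (g ` (\<lambda>x. x + t) ` K) = vol (g ` K)" for t
  proof -
    have "g ` (\<lambda>x. x + t) ` K = (\<lambda>x. x + g t) ` g ` K" by (simp add: image_image linear_add[OF g(1)])
    then show ?thesis by (simp add: vol_translate)
  qed
  show "vol (g ` K) \<le> vol (g ` L)" if "convex_body L" "K \<subseteq> L" for L
    using that K by (intro vol_mono convex_body_linear_image g(1)) auto
  have deg: "vol (g ` M) = 0" if M: "M \<subseteq> {x. x $ i = c}" for M i c
  proof -
    have "negligible {x::real^'n. axis i 1 \<bullet> x = c}" by (rule negligible_hyperplane) auto
    then have "negligible M" by (rule negligible_subset) (use M in \<open>auto simp: inner_axis'\<close>)
    then have "negligible (g ` M)"
      using negligible_differentiable_image_negligible[OF order_refl _ linear_imp_differentiable_on[OF g(1)]] by blast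
    then show ?thesis unfolding vol_def by (rule negligible_imp_measure0)
  qed
  then show "K \<subseteq> {x. x $ i = c} \<Longrightarrow> vol (g ` K) = 0" for i c by blast
  show "vol (g ` K) = vol (g ` (K \<inter> {x. x $ i \<le> c})) + vol (g ` (K \<inter> {x. x $ i \<ge> c}))"
    if ne: "K \<inter> {x. x $ i \<le> c} \<noteq> {}" "K \<inter> {x. x $ i \<ge> c} \<noteq> {}" for i c
  proof -
    let ?A = "K \<inter> {x. x $ i \<le> c}" and ?B = "K \<inter> {x. x $ i \<ge> c}"
    have "convex_body ?A" "convex_body ?B" by (rule convex_body_Int_halfspace[OF K] ne)+
    then have m: "g ` ?A \<in> lmeasurable" "g ` ?B \<in> lmeasurable"
      by (auto intro!: convex_body_lmeasurable convex_body_linear_image g)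
    have "K = ?A \<union> ?B" by auto
    then have "g ` K = g ` ?A \<union> g ` ?B" by (metis image_Un)
    moreover have "g ` ?A \<inter> g ` ?B = g ` (?A \<inter> ?B)" using image_Int[OF g(2)] by blast
    moreover have "vol (g ` (?A \<inter> ?B)) = 0" by (rule deg[of _ i c]) auto
    ultimately show ?thesis using measure_Un3[OF m] unfolding vol_def by simp
  qed
qed

section \<open>Rules for determinants\<close>

lemma kap_linear:
  fixes g :: "real^'n \<Rightarrow> real^'n"
  shows "linear g \<Longrightarrow> inj g \<Longrightarrow> kap (\<lambda>i. g (e i)) = vol (g ` cbox 0 1) * kap e"
  unfolding kap_def bx_linear[symmetric] by (rule vol_linear_image) (auto simp: convex_body_bx)

text \<open>Let \<open>c t\<close> be the volume factor of the shear \<open>G t\<close> that adds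
  \<open>t *\<^sub>R w\<close> to \<open>v k\<close>. Applying \<open>G 1\<close> twice gives
  \<open>G 2\<close>, so \<open>c 2 = c 1 * c 1\<close>. The map \<open>D\<close> that fixes
  \<open>v k\<close> and doubles the other vectors conjugates \<open>G 1\<close> into
  \<open>G 2\<close>, so \<open>c 1 = c 2\<close>. Hence \<open>c 1 = 1\<close>.\<close>

lemma kap_shear:
  fixes v :: "'n \<Rightarrow> real^'n"
  assumes v: "frame v" and w: "w = cmb v a" "a k = 0"
  shows "kap (v(k := v k + w)) = kap v"
proof -
  let ?v = "\<lambda>t::real. v(k := v k + t *\<^sub>R w)"
  have fr: "frame (?v t)" for t
  proof (rule frame_exchange[OF v])
    show "v k + t *\<^sub>R w = cmb v (\<lambda>i. ind {k} 1 i + t * a i)"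
      by (simp add: cmb_add cmb_scaleR cmb_single w)
  qed (use w in simp)
  have "\<exists>g. linear g \<and> (\<forall>i. g (v i) = ?v t i)" for t using frame_map[OF v] by metis
  then obtain G where G: "\<And>t. linear (G t)" "\<And>t i. G t (v i) = ?v t i" by metis
  have Gv: "(\<lambda>i. G t (v i)) = ?v t" for t using G(2) by blast
  have injG: "inj (G t)" for t
    by (rule linear_inj_of_frames[OF G(1) v]) (simp only: Gv fr)
  have Gw: "G t w = w" for t
    unfolding w(1) cmb_linear[OF G(1)] Gv by (simp add: cmb_frame_upd w(2))
  define c where "c t = vol (G t ` cbox 0 1)" for t
  have kG: "kap (\<lambda>i. G t (e i)) = c t * kap e" for t e
    unfolding c_def by (rule kap_linear[OF G(1) injG])
  have kv: "kap (?v t) = c t * kap v" for t using kG[of t v] by (simp only: Gv)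
  have "(\<lambda>i. G 1 (?v 1 i)) = ?v 2"
  proof
    fix i show "G 1 (?v 1 i) = ?v 2 i"
      using G(2)[of 1 i] Gw[of 1] by (cases "i = k") (auto simp: linear_add[OF G(1)] scaleR_2 add.assoc)
  qed
  then have sq: "kap (?v 2) = c 1 * (c 1 * kap v)" using kG[of 1 "?v 1"] kv[of 1] by simp
  obtain D where D: "linear D" "\<And>i. D (v i) = (if i = k then v i else 2 *\<^sub>R v i)"
    using frame_map[OF v, of "\<lambda>i. if i = k then v i else 2 *\<^sub>R v i"] by metis
  have Dv: "(\<lambda>i. D (v i)) = (\<lambda>i. (if i = k then 1 else 2) *\<^sub>R v i)" using D(2) by auto
  have frD: "frame (\<lambda>i. D (v i))"
    unfolding frame_def
  proof (intro allI impI)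
    fix t i assume "cmb (\<lambda>i. D (v i)) t = 0"
    then have "cmb v (\<lambda>i. t i * (if i = k then 1 else 2)) = 0" unfolding Dv cmb_def by simp
    then have "t i * (if i = k then 1 else 2) = 0" by (rule frameD[OF v])
    then show "t i = 0" by (simp split: if_splits)
  qed
  have injD: "inj D" by (rule linear_inj_of_frames[OF D(1) v frD])
  have Dw: "D w = 2 *\<^sub>R w"
  proof -
    have "D w = cmb v (\<lambda>i. 2 * a i)" unfolding w(1) cmb_linear[OF D(1)] Dv unfolding cmb_def
      by (rule sum.cong) (use w(2) in auto)
    then show ?thesis by (simp add: cmb_scaleR w(1))
  qed
  define d where "d = vol (D ` cbox 0 1)"
  have kD: "kap (\<lambda>i. D (e i)) = d * kap e" for e
    unfolding d_def by (rule kap_linear[OF D(1) injD])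
  have DG: "(\<lambda>i. D (?v 1 i)) = (\<lambda>i. G 2 (D (v i)))"
  proof
    fix i show "D (?v 1 i) = G 2 (D (v i))"
      using G(2)[of 2 i] D(2)[of i] Dw by (cases "i = k") (auto simp: linear_add[OF D(1)] linear_scale[OF G(1)])
  qed
  have "d * kap (?v 1) = kap (\<lambda>i. G 2 (D (v i)))" by (subst DG[symmetric]) (rule kD[symmetric])
  also have "\<dots> = c 2 * kap (\<lambda>i. D (v i))" by (rule kG)
  also have "\<dots> = c 2 * (d * kap v)" by (simp only: kD)
  finally have "d * (c 1 * kap v) = c 2 * (d * kap v)" by (simp only: kv)
  moreover have kvp: "kap v > 0" by (rule kap_pos[OF v])
  moreover have "d \<noteq> 0" using kD[of v] kap_pos[OF frD] by auto
  ultimately have "c 1 = c 2" by auto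
  moreover have "c 2 = c 1 * c 1" using sq kv[of 2] kvp by simp
  moreover have "c 1 \<noteq> 0" using kv[of 1] kap_pos[OF fr[of 1]] by auto
  ultimately have "c 1 = 1" by simp
  then show ?thesis using kv[of 1] by simp
qed

text \<open>The substitution of \<open>1 - t k\<close> for \<open>t k\<close> shows that the two
  parallelotopes are translates by \<open>v k\<close>.\<close>

lemma kap_flip:
  fixes v :: "'n \<Rightarrow> real^'n"
  shows "kap (v(k := - v k)) = kap v"
proof -
  let ?v = "v(k := - v k)"
  have key: "cmb ?v t + v k = cmb v (t(k := 1 - t k))" for t
    by (simp add: cmb_frame_upd cmb_upd vec_eq_iff algebra_simps)
  have "(\<lambda>x. x + v k) ` bx ?v (\<lambda>_. 1) = bx v (\<lambda>_. 1)"
  proof (intro set_eqI iffI)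
    fix x assume "x \<in> (\<lambda>x. x + v k) ` bx ?v (\<lambda>_. 1)"
    then obtain t where "x = cmb ?v t + v k" "\<And>i. 0 \<le> t i" "\<And>i. t i \<le> 1" by (auto elim!: bxE)
    then show "x \<in> bx v (\<lambda>_. 1)" unfolding key by (auto intro!: bxI)
  next
    fix x assume "x \<in> bx v (\<lambda>_. 1)"
    then obtain t where t: "x = cmb v t" "\<And>i. 0 \<le> t i" "\<And>i. t i \<le> 1" by (auto elim!: bxE)
    have "cmb ?v (t(k := 1 - t k)) + v k = x" unfolding key t(1) by simp
    moreover have "cmb ?v (t(k := 1 - t k)) \<in> bx ?v (\<lambda>_. 1)" using t by (intro bxI) auto
    ultimately show "x \<in> (\<lambda>x. x + v k) ` bx ?v (\<lambda>_. 1)" by blast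
  qed
  then show ?thesis unfolding kap_def by (metis vol_translate)
qed

lemma kap_scale_one:
  assumes "frame v" "r \<ge> 0" shows "kap (v(k := r *\<^sub>R v k)) = r * kap v"
proof -
  have "v(k := r *\<^sub>R v k) = (\<lambda>i. (if i = k then r else 1) *\<^sub>R v i)" by auto
  then show ?thesis using kap_scaled[OF assms(1), of "\<lambda>i. if i = k then r else 1"] assms(2) by simp
qed

text \<open>Cramer's rule: the exchange is a scaling of \<open>v k\<close> by \<open>a k\<close>,
  possibly with a change of sign, followed by a shear along the other vectors.\<close>

lemma kap_exchange:
  fixes v :: "'n \<Rightarrow> real^'n"
  assumes v: "frame v" and x: "x = cmb v a" and ak: "a k \<noteq> 0"
  shows "kap (v(k := x)) = \<bar>a k\<bar> * kap v"
proof -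
  let ?v = "v(k := a k *\<^sub>R v k)"
  let ?a = "a(k := 0)"
  have "frame ?v" by (rule frame_exchange[OF v, of _ "ind {k} (a k)"]) (use ak in \<open>simp_all add: cmb_single\<close>)
  moreover have "cmb v ?a = cmb ?v ?a" by (simp add: cmb_frame_upd)
  ultimately have "kap (?v(k := ?v k + cmb v ?a)) = kap ?v" by (rule kap_shear) simp
  moreover have "?v(k := ?v k + cmb v ?a) = v(k := x)" using x by (simp add: cmb_upd)
  moreover have "kap ?v = \<bar>a k\<bar> * kap v"
  proof (cases "a k \<ge> 0")
    case True
    then show ?thesis using kap_scale_one[OF v True] by simp
  next
    case False
    then have "kap (v(k := - a k *\<^sub>R v k)) = - a k * kap v" using kap_scale_one[OF v, of "- a k"] by simp
    moreover have "kap (v(k := - a k *\<^sub>R v k)) = kap ?v"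
      using kap_flip[of ?v k] by simp
    ultimately show ?thesis using False by simp
  qed
  ultimately show ?thesis by simp
qed

section \<open>Volume of the difference body\<close>

lemma vol_le_difference_body:
  assumes K: "convex_body K" shows "vol K \<le> vol (msum K (reflect K))"
proof -
  obtain x where x: "x \<in> K" using K unfolding convex_body_def by auto
  have "(\<lambda>y. y + (-x)) ` K \<subseteq> msum K (reflect K)" unfolding msum_def reflect_def using x by blast
  from vol_mono[OF convex_body_translate[OF K] convex_body_msum[OF K convex_body_reflect[OF K]] this]
  show ?thesis by (simp only: vol_translate)
qed

text \<open>A family of vectors of \<open>K - x0\<close> spanning at least half of the largest possible volume gives
  coordinates at most 2 to every point of \<open>K - x0\<close>.\<close>

lemma difference_body_vol_le:
  fixes K :: "(real^'n) set"
  assumes K: "convex_body K"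
  shows "vol (msum K (reflect K)) \<le> (8 * real CARD('n)) ^ CARD('n) * vol K"
proof -
  let ?n = "CARD('n)"
  obtain x0 where x0: "x0 \<in> K" using K unfolding convex_body_def by auto
  define M where "M = (\<lambda>y. y + (-x0)) ` K"
  have M: "convex_body M" unfolding M_def by (rule convex_body_translate[OF K])
  have M0: "0 \<in> M" unfolding M_def using x0 by force
  have volM: "vol M = vol K" unfolding M_def by (rule vol_translate)
  have KM: "x - x0 \<in> M" if "x \<in> K" for x unfolding M_def using that by auto
  have DK: "convex_body (msum K (reflect K))" using K by (intro convex_body_msum convex_body_reflect)
  show ?thesis
  proof (cases "\<forall>u. u \<noteq> 0 \<longrightarrow> (\<exists>x\<in>M. x \<bullet> u \<noteq> 0)")
    case False
    then obtain u where u: "u \<noteq> 0" "\<And>x. x \<in> M \<Longrightarrow> x \<bullet> u = 0" by blast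
    have "vol (msum K (reflect K)) = 0"
    proof (rule vol_0_hyperplane[OF u(1)])
      fix z assume "z \<in> msum K (reflect K)"
      then obtain x y where "x \<in> K" "y \<in> K" "z = x - y" unfolding msum_def reflect_def by auto
      then show "u \<bullet> z = 0" using u(2)[OF KM[of x]] u(2)[OF KM[of y]]
        by (simp add: inner_diff_left inner_diff_right inner_commute)
    qed
    then show ?thesis using vol_nonneg[of K] by simp
  next
    case True
    obtain b :: "'n \<Rightarrow> real^'n" where b: "frame b" "\<And>k. b k \<in> M" using frame_from_spanning[of M] True by blast
    define T where "T = {v. frame v \<and> (\<forall>k. v k \<in> M)}"
    have bd: "kap v \<le> real ?n ^ ?n * vol M" if "v \<in> T" for v
      by (rule vol_ge_kap[OF M, of _ "\<lambda>_. 0"]) (use that M0 in \<open>auto simp: T_def\<close>)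
    have bT: "b \<in> T" unfolding T_def using b by auto
    have bdd: "bdd_above (kap ` T)" using bd by (intro bdd_aboveI2)
    define S where "S = Sup (kap ` T)"
    have S: "kap v \<le> S" if "v \<in> T" for v unfolding S_def by (rule cSUP_upper[OF that bdd])
    have "S > 0" using S[OF bT] kap_pos[OF b(1)] by simp
    then have "S / 2 < Sup (kap ` T)" unfolding S_def by simp
    then obtain v where v: "v \<in> T" "S / 2 < kap v"
      using less_cSUP_iff[of T kap] bdd bT by blast
    have frv: "frame v" using v unfolding T_def by auto
    \<comment> \<open>Exchanging \<open>v k\<close> for this point multiplies \<open>kap v\<close>
      by the absolute value of \<open>a k\<close>, and the result is at most \<open>S\<close>, which
      is below \<open>2 * kap v\<close>.\<close>
    have coord: "\<bar>a k\<bar> \<le> 2" if "cmb v a \<in> M" for a k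
    proof (cases "a k = 0")
      case False
      have "v(k := cmb v a) \<in> T" unfolding T_def
        using frame_exchange[OF frv, of "cmb v a" a k] False that v(1) by (auto simp: T_def)
      from S[OF this] have "\<bar>a k\<bar> * kap v \<le> 2 * kap v"
        using kap_exchange[OF frv, of "cmb v a" a k] False v(2) by simp
      then show ?thesis using kap_pos[OF frv] by simp
    qed simp
    \<comment> \<open>A difference of two points with coordinates of size at most 2 has coordinates
      between -4 and 4; this is a box of side 8 starting at -4.\<close>
    have "msum K (reflect K) \<subseteq> (\<lambda>x. x + cmb v (\<lambda>_. -4)) ` bx v (\<lambda>_. 8)"
    proof
      fix z assume "z \<in> msum K (reflect K)"
      then obtain x y where xy: "x \<in> K" "y \<in> K" "z = x - y" unfolding msum_def reflect_def by auto
      obtain a where a: "x - x0 = cmb v a" using frame_span[OF frv] by metis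
      obtain c where c: "y - x0 = cmb v c" using frame_span[OF frv] by metis
      have ac: "\<bar>a k\<bar> \<le> 2" "\<bar>c k\<bar> \<le> 2" for k using coord KM xy a c by metis+
      have "z = cmb v (\<lambda>i. (a i - c i) - (-4)) + cmb v (\<lambda>_. -4)"
        unfolding cmb_diff using a c xy by (simp add: algebra_simps)
      moreover have "cmb v (\<lambda>i. (a i - c i) - (-4)) \<in> bx v (\<lambda>_. 8)"
      proof (rule bxI)
        fix i show "0 \<le> (a i - c i) - (-4) \<and> (a i - c i) - (-4) \<le> 8" using ac[of i] by linarith
      qed
      ultimately show "z \<in> (\<lambda>x. x + cmb v (\<lambda>_. -4)) ` bx v (\<lambda>_. 8)" by blast
    qed
    then have "vol (msum K (reflect K)) \<le> vol (bx v (\<lambda>_. 8))"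
      using vol_mono[OF DK convex_body_translate[OF convex_body_bx]] by (simp add: vol_translate)
    also have "\<dots> = kap v * 8 ^ ?n" by (simp add: vol_bx[OF frv])
    also have "\<dots> \<le> (real ?n ^ ?n * vol K) * 8 ^ ?n"
      using bd[OF v(1)] volM by (intro mult_right_mono) auto
    finally show ?thesis by (simp add: power_mult_distrib algebra_simps)
  qed
qed

section \<open>Valuations on parallelotopes\<close>

lemma prod_ind: "(\<Prod>i\<in>J. ind I t i) = (if J \<subseteq> I then t ^ card J else 0)" for I J :: "'n::finite set"
proof (cases "J \<subseteq> I")
  case True
  then have "(\<Prod>i\<in>J. ind I t i) = (\<Prod>i\<in>J. t)" by (intro prod.cong) auto
  then show ?thesis using True by simp
next
  case False
  then obtain i where "i \<in> J" "i \<notin> I" by blast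
  then have "(\<Prod>i\<in>J. ind I t i) = 0" by (intro prod_zero bexI[of _ i]) auto
  then show ?thesis using False by simp
qed

locale monotone_vc_valuation =
  fixes \<Phi> :: "(real^'n) set \<Rightarrow> (real^'n) set"
  assumes body_map: "body_map \<Phi>" and trans_inv: "translation_invariant \<Phi>"
    and valuation: "minkowski_valuation \<Phi>" and mono: "monotonic \<Phi>" and vc: "VC \<Phi>"
begin

lemma body: "convex_body K \<Longrightarrow> convex_body (\<Phi> K)"
  using body_map unfolding body_map_def by blast

lemma trans: "convex_body K \<Longrightarrow> \<Phi> ((\<lambda>x. x + t) ` K) = \<Phi> K"
  using trans_inv unfolding translation_invariant_def by blast

lemma sf_valuation:
  assumes "convex_body K" "convex_body L" "convex_body (K \<union> L)" "convex_body (K \<inter> L)"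
  shows "sf (\<Phi> K) u + sf (\<Phi> L) u = sf (\<Phi> (K \<union> L)) u + sf (\<Phi> (K \<inter> L)) u"
proof -
  have "msum (\<Phi> K) (\<Phi> L) = msum (\<Phi> (K \<union> L)) (\<Phi> (K \<inter> L))"
    using valuation assms unfolding minkowski_valuation_def by blast
  then show ?thesis using assms body by (metis sf_msum)
qed

lemma sf_\<Phi>_mono: "convex_body K \<Longrightarrow> convex_body L \<Longrightarrow> K \<subseteq> L \<Longrightarrow> sf (\<Phi> K) u \<le> sf (\<Phi> L) u"
  using mono unfolding monotonic_def by (intro sf_mono body) auto

text \<open>The two parts of a box cut across its i-th edge meet in a translate of the face with
  that edge 0. The increment over the value at this face is therefore additive in the edge length,
  and monotone because \<Phi> is.\<close>

lemma sf_box_affine: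
  assumes e: "frame e" and l: "\<And>j. 0 \<le> l j" and s: "0 \<le> s"
  shows "sf (\<Phi> (bx e (l(i := s)))) u = sf (\<Phi> (bx e (l(i := 0)))) u
    + s * (sf (\<Phi> (bx e (l(i := 1)))) u - sf (\<Phi> (bx e (l(i := 0)))) u)"
proof -
  define g where "g s = sf (\<Phi> (bx e (l(i := s)))) u - sf (\<Phi> (bx e (l(i := 0)))) u" for s
  have cb: "convex_body (bx e (l(i := r)))" if "r \<ge> 0" for r
    by (rule convex_body_bx) (use l that in auto)
  have "g s = s * g 1"
  proof (rule monotone_additive_linear[OF _ _ s])
    fix r q :: real assume rq: "0 \<le> r" "0 \<le> q"
    let ?A = "bx e (l(i := r))" and ?B = "(\<lambda>x. x + r *\<^sub>R e i) ` bx e (l(i := q))"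
    have "sf (\<Phi> ?A) u + sf (\<Phi> ?B) u = sf (\<Phi> (?A \<union> ?B)) u + sf (\<Phi> (?A \<inter> ?B)) u"
      by (rule sf_valuation) (use rq in \<open>auto simp: bx_split[symmetric] bx_split_Int[OF e] intro!: cb convex_body_translate\<close>)
    then show "g (r + q) = g r + g q"
      unfolding g_def bx_split[OF rq, symmetric] bx_split_Int[OF e rq]
      by (simp add: trans cb rq)
  next
    fix r q :: real assume "0 \<le> r" "r \<le> q"
    then show "g r \<le> g q" unfolding g_def
      using sf_\<Phi>_mono[OF cb cb bx_mono, of r q u] by simp
  qed
  then show ?thesis unfolding g_def by simp
qed

section \<open>Coefficients of the images of boxes\<close>

definition cf :: "('n \<Rightarrow> real^'n) \<Rightarrow> real^'n \<Rightarrow> 'n set \<Rightarrow> real" where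
  "cf e u = (SOME c. \<forall>l. (\<forall>i. 0 \<le> l i) \<longrightarrow> sf (\<Phi> (bx e l)) u = (\<Sum>I\<in>UNIV. c I * (\<Prod>i\<in>I. l i)))"

lemma sf_box_expansion:
  assumes "frame e" "\<And>i. 0 \<le> l i"
  shows "sf (\<Phi> (bx e l)) u = (\<Sum>I\<in>UNIV. cf e u I * (\<Prod>i\<in>I. l i))"
proof -
  have "\<exists>c. \<forall>l. (\<forall>i. 0 \<le> l i) \<longrightarrow> (\<forall>i. i \<notin> UNIV \<longrightarrow> l i = 0) \<longrightarrow>
      sf (\<Phi> (bx e l)) u = (\<Sum>I\<in>Pow UNIV. c I * (\<Prod>i\<in>I. l i))"
    by (rule multiaffine_expansion) (auto intro: sf_box_affine[OF assms(1)])
  then have "\<exists>c. \<forall>l. (\<forall>i. 0 \<le> l i) \<longrightarrow> sf (\<Phi> (bx e l)) u = (\<Sum>I\<in>UNIV. c I * (\<Prod>i\<in>I. l i))" by simp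
  from someI_ex[OF this] show ?thesis using assms(2) unfolding cf_def by blast
qed

text \<open>With edges \<open>t\<close> in \<open>I\<close> and 0 elsewhere, only subsets of
  \<open>I\<close> contribute, and proper subsets grow more slowly than the leading power. This
  shows that the chosen coefficients are unique and lets properties of support functions pass to
  them.\<close>

lemma cf_limit:
  assumes e: "frame e"
  shows "((\<lambda>t. sf (\<Phi> (bx e (ind I t))) u / t ^ card I) \<longlongrightarrow> cf e u I) at_top"
proof -
  have trm: "((\<lambda>t::real. cf e u J * (if J \<subseteq> I then t ^ card J else 0) / t ^ card I) \<longlongrightarrow> (if J = I then cf e u I else 0)) at_top"
    for J
  proof (cases "J \<subseteq> I")
    case True
    show ?thesis
    proof (cases "J = I")
      case True
      have "\<forall>\<^sub>F t::real in at_top. cf e u I * t ^ card I / t ^ card I = cf e u I"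
        using eventually_gt_at_top[of 0] by eventually_elim auto
      then show ?thesis using True by (simp add: tendsto_eventually)
    next
      case False
      then have c: "card J < card I" using True by (meson finite psubsetI psubset_card_mono)
      have "((\<lambda>t::real. cf e u J * inverse (t ^ (card I - card J))) \<longlongrightarrow> cf e u J * 0) at_top"
        using c by (intro tendsto_mult tendsto_const tendsto_inverse_0_at_top filterlim_pow_at_top filterlim_ident) auto
      moreover have "\<forall>\<^sub>F t::real in at_top. cf e u J * inverse (t ^ (card I - card J)) = cf e u J * t ^ card J / t ^ card I"
        using eventually_gt_at_top[of 0] by eventually_elim (use c in \<open>simp add: power_diff field_simps\<close>)
      ultimately show ?thesis using True False by (simp add: tendsto_cong)
    qed
  qed auto
  have "((\<lambda>t. \<Sum>J\<in>UNIV. cf e u J * (if J \<subseteq> I then t ^ card J else 0) / t ^ card I) \<longlongrightarrow>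
      (\<Sum>J\<in>UNIV. if J = I then cf e u I else 0)) at_top"
    by (intro tendsto_sum trm)
  moreover have "\<forall>\<^sub>F t::real in at_top. (\<Sum>J\<in>UNIV. cf e u J * (if J \<subseteq> I then t ^ card J else 0) / t ^ card I) =
      sf (\<Phi> (bx e (ind I t))) u / t ^ card I"
    using eventually_gt_at_top[of 0]
  proof eventually_elim
    case (elim t)
    then show ?case
      using sf_box_expansion[OF e, of "ind I t" u] by (simp add: prod_ind sum_divide_distrib)
  qed
  ultimately show ?thesis by (simp add: tendsto_cong)
qed

lemma tendsto_unique_at_top: "(f \<longlongrightarrow> a) at_top \<Longrightarrow> (f \<longlongrightarrow> b) at_top \<Longrightarrow> a = b" for f :: "real \<Rightarrow> real"
  by (rule tendsto_unique) auto

lemma cf_sublin: assumes e: "frame e" shows "sublin (\<lambda>u. cf e u I)"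
  unfolding sublin_def
proof (intro conjI allI impI)
  have cb: "convex_body (\<Phi> (bx e (ind I t)))" if "t > 0" for t
    using that by (intro body convex_body_bx) simp
  fix u v
  show "cf e (u + v) I \<le> cf e u I + cf e v I"
  proof (rule tendsto_le[OF _ tendsto_add[OF cf_limit[OF e] cf_limit[OF e]] cf_limit[OF e]])
    show "\<forall>\<^sub>F t in at_top. sf (\<Phi> (bx e (ind I t))) (u + v) / t ^ card I
      \<le> sf (\<Phi> (bx e (ind I t))) u / t ^ card I + sf (\<Phi> (bx e (ind I t))) v / t ^ card I"
      using eventually_gt_at_top[of 0]
      by eventually_elim (use sf_add_le[OF cb] in \<open>simp add: add_divide_distrib[symmetric] divide_right_mono\<close>)
  qed simp
next
  have cb: "convex_body (\<Phi> (bx e (ind I t)))" if "t > 0" for t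
    using that by (intro body convex_body_bx) simp
  fix r u assume r: "(0::real) \<le> r"
  have "((\<lambda>t. r * (sf (\<Phi> (bx e (ind I t))) u / t ^ card I)) \<longlongrightarrow> r * cf e u I) at_top"
    by (intro tendsto_mult tendsto_const cf_limit e)
  moreover have "\<forall>\<^sub>F t in at_top. r * (sf (\<Phi> (bx e (ind I t))) u / t ^ card I) = sf (\<Phi> (bx e (ind I t))) (r *\<^sub>R u) / t ^ card I"
    using eventually_gt_at_top[of 0] by eventually_elim (use sf_scaleR[OF cb r] in simp)
  ultimately have "((\<lambda>t. sf (\<Phi> (bx e (ind I t))) (r *\<^sub>R u) / t ^ card I) \<longlongrightarrow> r * cf e u I) at_top"
    by (rule Lim_transform_eventually)
  then show "cf e (r *\<^sub>R u) I = r * cf e u I" using tendsto_unique_at_top[OF cf_limit[OF e]] by blast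
qed

lemma cf_empty: "frame e \<Longrightarrow> cf e u {} = sf (\<Phi> {0}) u"
proof -
  assume e: "frame e"
  \<comment> \<open>The empty product is 1, so the term of the empty set survives when all edges are
    0.\<close>
  have "(\<Sum>J\<in>UNIV. cf e u J * 0 ^ card J) = (\<Sum>J\<in>(UNIV::'n set set). if J = {} then cf e u {} else 0)"
    by (rule sum.cong) (auto simp: power_0_left card_eq_0_iff)
  then show ?thesis
    using sf_box_expansion[OF e, of "\<lambda>_. 0" u] by (simp add: bx_0)
qed

text \<open>All boxes contain 0, so the support functions have a common lower bound, which
  disappears after division by a positive power of \<open>t\<close>. For the empty set there is no
  such power.\<close>

lemma cf_nonneg: assumes e: "frame e" and I: "I \<noteq> {}" shows "0 \<le> cf e u I"
proof (rule tendsto_le[OF _ cf_limit[OF e]])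
  have "card I > 0" using I by (simp add: card_gt_0_iff)
  then show "((\<lambda>t::real. sf (\<Phi> {0}) u * inverse (t ^ card I)) \<longlongrightarrow> 0) at_top"
    by (intro tendsto_mult_right_zero tendsto_inverse_0_at_top filterlim_pow_at_top filterlim_ident) auto
  show "\<forall>\<^sub>F t in at_top. sf (\<Phi> {0}) u * inverse (t ^ card I) \<le> sf (\<Phi> (bx e (ind I t))) u / t ^ card I"
    using eventually_gt_at_top[of 0]
  proof eventually_elim
    case (elim t)
    have "{0} \<subseteq> bx e (ind I t)" using bx_mono[of "\<lambda>_. 0" "ind I t" e] elim by (simp add: bx_0)
    then have "sf (\<Phi> {0}) u \<le> sf (\<Phi> (bx e (ind I t))) u"
      using elim by (intro sf_\<Phi>_mono convex_body_sing convex_body_bx) auto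
    then show ?case using elim by (simp add: divide_inverse mult_right_mono)
  qed
qed simp

text \<open>The limit defining the coefficient of \<open>J\<close> involves only edges in
  \<open>J\<close>. A coefficient therefore does not notice changes of the other frame vectors,
  which is what makes different frames comparable.\<close>

lemma cf_reindex:
  assumes "frame e" "frame e'" "bij_betw p J' J" "\<And>j. j \<in> J' \<Longrightarrow> e' j = e (p j)"
  shows "cf e' u J' = cf e u J"
proof -
  have "\<forall>\<^sub>F t in at_top. sf (\<Phi> (bx e (ind J t))) u / t ^ card J = sf (\<Phi> (bx e' (ind J' t))) u / t ^ card J'"
    using eventually_gt_at_top[of 0]
    by eventually_elim (use bx_reindex[OF assms(3), of e' e] assms(4) bij_betw_same_card[OF assms(3)] in simp)
  then have "((\<lambda>t. sf (\<Phi> (bx e' (ind J' t))) u / t ^ card J') \<longlongrightarrow> cf e u J) at_top"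
    using cf_limit[OF assms(1), of J u] by (simp add: tendsto_cong)
  then show ?thesis using tendsto_unique_at_top[OF cf_limit[OF assms(2)]] by blast
qed

definition wd :: "('n \<Rightarrow> real^'n) \<Rightarrow> real^'n \<Rightarrow> 'n set \<Rightarrow> real" where
  "wd e u I = cf e u I + cf e (-u) I"

text \<open>The block of \<open>I\<close>. As \<open>wd\<close> is even and nonnegative, it is
  symmetric and contains 0, independently of the position of the image.\<close>

definition W :: "('n \<Rightarrow> real^'n) \<Rightarrow> 'n set \<Rightarrow> (real^'n) set" where
  "W e I = wulff (\<lambda>u. wd e u I)"

lemma wd_sublin: assumes e: "frame e" shows "sublin (\<lambda>u. wd e u I)"
  unfolding sublin_def wd_def
proof (intro conjI allI impI)
  fix u v
  show "cf e (u + v) I + cf e (- (u + v)) I \<le> cf e u I + cf e (- u) I + (cf e v I + cf e (- v) I)"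
    using sublin_add[OF cf_sublin[OF e, of I], of u v] sublin_add[OF cf_sublin[OF e, of I], of "-u" "-v"] by simp
next
  fix t :: real and u assume t: "0 \<le> t"
  show "cf e (t *\<^sub>R u) I + cf e (- (t *\<^sub>R u)) I = t * (cf e u I + cf e (- u) I)"
    using sublin_scaleR[OF cf_sublin[OF e, of I] t, of u] sublin_scaleR[OF cf_sublin[OF e, of I] t, of "-u"]
    by (simp add: distrib_left)
qed

lemma wd_uminus: "wd e (-u) I = wd e u I"
  unfolding wd_def by simp

lemma wd_nonneg: "frame e \<Longrightarrow> 0 \<le> wd e u I"
  using sublin_add[OF wd_sublin, of e u "-u" I] sublin_0[OF wd_sublin, of e I] wd_uminus[of e u I] by simp

lemma wd_reindex:
  "frame e \<Longrightarrow> frame e' \<Longrightarrow> bij_betw p J' J \<Longrightarrow> (\<And>j. j \<in> J' \<Longrightarrow> e' j = e (p j)) \<Longrightarrow> wd e' u J' = wd e u J"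
  unfolding wd_def using cf_reindex by metis

lemma wd_cong: "frame e \<Longrightarrow> frame e' \<Longrightarrow> (\<And>j. j \<in> J \<Longrightarrow> e' j = e j) \<Longrightarrow> wd e' u J = wd e u J"
  by (rule wd_reindex[of e e' "\<lambda>x. x"]) (auto simp: bij_betw_def inj_on_def)

lemma width_box_expansion:
  "frame e \<Longrightarrow> (\<And>i. 0 \<le> l i) \<Longrightarrow> width (\<Phi> (bx e l)) u = (\<Sum>I\<in>UNIV. wd e u I * (\<Prod>i\<in>I. l i))"
  unfolding width_def wd_def by (simp add: sf_box_expansion sum.distrib distrib_right)

lemma wd_le_width:
  assumes "frame e" "\<And>i. 0 \<le> l i" shows "wd e u I * (\<Prod>i\<in>I. l i) \<le> width (\<Phi> (bx e l)) u"
  unfolding width_box_expansion[OF assms]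
  by (rule member_le_sum) (auto intro!: mult_nonneg_nonneg wd_nonneg prod_nonneg assms)

text \<open>All terms in the expansion of the width are nonnegative, so each of them alone is a
  lower bound, and a bound on the width yields a segment.\<close>

lemma W_segment:
  assumes e: "frame e" and l: "\<And>i. 0 \<le> l i" and v: "v \<in> W e I"
  shows "\<exists>a. a \<in> \<Phi> (bx e l) \<and> a + (\<Prod>i\<in>I. l i) *\<^sub>R v \<in> \<Phi> (bx e l)"
proof -
  have cb: "convex_body (\<Phi> (bx e l))" by (intro body convex_body_bx l)
  have "((\<Prod>i\<in>I. l i) *\<^sub>R v) \<bullet> u \<le> width (\<Phi> (bx e l)) u" for u
  proof -
    have "(\<Prod>i\<in>I. l i) * (v \<bullet> u) \<le> (\<Prod>i\<in>I. l i) * wd e u I"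
      by (rule mult_left_mono) (use v in \<open>auto simp: W_def wulff_def intro!: prod_nonneg l\<close>)
    then show ?thesis using wd_le_width[OF e, where l = l and I = I and u = u] l by (simp add: mult.commute)
  qed
  from segment_of_width[OF cb this] show ?thesis by metis
qed

section \<open>Bases taken from the blocks\<close>

definition class_basis :: "('n \<Rightarrow> real^'n) \<Rightarrow> ('n \<Rightarrow> real^'n) \<Rightarrow> ('n \<Rightarrow> 'n set) \<Rightarrow> bool" where
  "class_basis e b cl \<longleftrightarrow> frame b \<and> (\<forall>k. b k \<in> W e (cl k))"

text \<open>The image of a box has volume comparable to the product of all edge lengths, but it contains
  segments of lengths proportional to the products over the sets \<open>cl k\<close>; so these sets form a partition.\<close>

lemma classes_partition:
  assumes e: "frame e" and cb: "class_basis e b cl"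
  shows "\<exists>!k. i \<in> cl k"
proof -
  have b: "frame b" and cl: "\<And>k. b k \<in> W e (cl k)" using cb unfolding class_basis_def by auto
  obtain C where C: "C > 0" "\<And>K. convex_body K \<Longrightarrow> vol (\<Phi> K) \<le> C * vol K"
    using vc unfolding VC_def by blast
  let ?n = "CARD('n)"
  let ?m = "card {k. i \<in> cl k}"
  have "kap b * t ^ ?m \<le> (real ?n ^ ?n * (C * kap e)) * t" if t: "t > 0" for t
  proof -
    \<comment> \<open>Only the i-th edge varies, so exactly those segments grow with
      \<open>t\<close> whose class contains \<open>i\<close>. The volume of the image is thus at
      least of order \<open>t ^ ?m\<close> and at most of order \<open>t\<close>.\<close>
    let ?l = "(\<lambda>_. 1)(i := t)"
    have l: "0 \<le> ?l j" for j using t by simp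
    have pr: "(\<Prod>j\<in>I. ?l j) = (if i \<in> I then t else 1)" for I
    proof (cases "i \<in> I")
      case True
      then have "(\<Prod>j\<in>I. ?l j) = ?l i * (\<Prod>j\<in>I - {i}. ?l j)" by (intro prod.remove) auto
      also have "(\<Prod>j\<in>I - {i}. ?l j) = 1" by (rule prod.neutral) auto
      finally show ?thesis using True by simp
    qed (auto intro!: prod.neutral)
    let ?K = "\<Phi> (bx e ?l)"
    let ?c = "\<lambda>k. if i \<in> cl k then t else 1"
    have cb: "convex_body (bx e ?l)" by (rule convex_body_bx[OF l])
    have "\<exists>a. a \<in> ?K \<and> a + ?c k *\<^sub>R b k \<in> ?K" for k
      using W_segment[OF e _ cl[of k], of ?l, unfolded pr] l by blast
    then obtain a where a: "\<And>k. a k \<in> ?K" "\<And>k. a k + ?c k *\<^sub>R b k \<in> ?K" by metis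
    have frc: "frame (\<lambda>k. ?c k *\<^sub>R b k)"
      unfolding frame_def
    proof (intro allI impI)
      fix s k assume "cmb (\<lambda>k. ?c k *\<^sub>R b k) s = 0"
      then have "cmb b (\<lambda>k. s k * ?c k) = 0" unfolding cmb_def by simp
      then have "s k * ?c k = 0" by (rule frameD[OF b])
      then show "s k = 0" using t by (simp split: if_splits)
    qed
    have "kap b * (\<Prod>k\<in>UNIV. ?c k) = kap (\<lambda>k. ?c k *\<^sub>R b k)"
      by (rule kap_scaled[OF b, symmetric]) (use t in auto)
    also have "\<dots> \<le> real ?n ^ ?n * vol ?K" by (rule vol_ge_kap[OF body[OF cb] frc a])
    also have "\<dots> \<le> real ?n ^ ?n * (C * vol (bx e ?l))" by (intro mult_left_mono C cb) simp
    also have "vol (bx e ?l) = kap e * t" using vol_bx[OF e, of ?l] l pr[of UNIV] by simp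
    finally have "kap b * (\<Prod>k\<in>UNIV. ?c k) \<le> (real ?n ^ ?n * (C * kap e)) * t" by (simp add: mult.assoc)
    moreover have "(\<Prod>k\<in>UNIV. ?c k) = t ^ ?m"
      using prod.If_cases[of "UNIV::'n set" "\<lambda>k. i \<in> cl k" "\<lambda>_. t" "\<lambda>_. 1"] by simp
    ultimately show ?thesis by simp
  qed
  then have "?m = 1" by (rule power_growth_unique[OF kap_pos[OF b]])
  then obtain k where "{k. i \<in> cl k} = {k}" by (meson card_1_singletonE)
  then have "i \<in> cl k" "\<And>k'. i \<in> cl k' \<Longrightarrow> k' = k" by blast+
  then show ?thesis by (rule ex1I)
qed

lemma convex_body_W: "frame e \<Longrightarrow> convex_body (W e I)"
  unfolding W_def by (rule convex_body_wulff[OF wd_sublin])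

lemma sf_W: "frame e \<Longrightarrow> sf (W e I) u = wd e u I"
  unfolding W_def by (rule sf_wulff[OF wd_sublin])

lemma W_zero_iff: assumes e: "frame e" shows "W e I = {0} \<longleftrightarrow> (\<forall>u. wd e u I = 0)"
proof
  assume "W e I = {0}"
  then have "wd e u I = 0" for u
    using sf_W[OF e, of I u] sf_singleton[of 0 u] by simp
  then show "\<forall>u. wd e u I = 0" by blast
next
  assume 0: "\<forall>u. wd e u I = 0"
  have "v = 0" if "v \<in> W e I" for v
  proof -
    have "v \<bullet> v \<le> wd e v I" using that unfolding W_def wulff_def by blast
    then have "v \<bullet> v = 0" using 0 inner_ge_zero[of v] by simp
    then show ?thesis by simp
  qed
  moreover have "0 \<in> W e I" using 0 unfolding W_def wulff_def by simp
  ultimately show "W e I = {0}" by blast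
qed

lemma zero_in_W: "frame e \<Longrightarrow> 0 \<in> W e I"
  unfolding W_def wulff_def using wd_nonneg by simp

lemma width_unit_box_nonzero:
  assumes e: "frame e" and u: "u \<noteq> 0" shows "width (\<Phi> (bx e (\<lambda>_. 1))) u \<noteq> 0"
proof
  have cb: "convex_body (bx e (\<lambda>_. 1))" by (rule convex_body_bx) simp
  assume "width (\<Phi> (bx e (\<lambda>_. 1))) u = 0"
  then have "vol (\<Phi> (bx e (\<lambda>_. 1))) = 0" using vol_0_width[OF body[OF cb] u] by blast
  moreover obtain k where "k > 0" "k * vol (bx e (\<lambda>_. 1)) \<le> vol (\<Phi> (bx e (\<lambda>_. 1)))"
    using vc cb unfolding VC_def by blast
  moreover have "vol (bx e (\<lambda>_. 1)) > 0" using kap_pos[OF e] unfolding kap_def .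
  ultimately show False using mult_pos_pos[of k "vol (bx e (\<lambda>_. 1))"] by linarith
qed

text \<open>If all blocks were orthogonal to some nonzero \<open>u\<close>, the image of the unit
  box would have width 0 in direction \<open>u\<close>, against the lower volume bound.\<close>

lemma exists_classes:
  assumes e: "frame e"
  obtains b cl where "class_basis e b cl"
proof -
  have sp: "\<exists>v\<in>(\<Union>I. W e I). v \<bullet> u \<noteq> 0" if u: "u \<noteq> 0" for u
  proof (rule ccontr)
    assume "\<not> ?thesis"
    then have 0: "\<And>I v. v \<in> W e I \<Longrightarrow> v \<bullet> u = 0" by blast
    have "wd e u I = 0" for I
    proof -
      obtain v where "v \<in> W e I" "v \<bullet> u = sf (W e I) u" using sf_attained[OF convex_body_W[OF e]] by metis
      then show ?thesis using 0 sf_W[OF e, of I u] by simp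
    qed
    then show False using width_unit_box_nonzero[OF e u] by (simp add: width_box_expansion[OF e])
  qed
  obtain b :: "'n \<Rightarrow> real^'n" where b: "frame b" "\<And>k. b k \<in> (\<Union>I. W e I)"
    using frame_from_spanning[of "\<Union>I. W e I"] sp by blast
  have "\<forall>k. \<exists>I. b k \<in> W e I" using b(2) by blast
  then obtain cl where "\<forall>k. b k \<in> W e (cl k)" by (rule choice[THEN exE])
  then have "class_basis e b cl" using b(1) unfolding class_basis_def by blast
  then show ?thesis by (rule that)
qed

text \<open>A nonzero coordinate allows the vector to replace \<open>b k\<close>, which gives
  another basis of the same kind. Two partitions of the edges that differ at most in their k-th
  member coincide.\<close>

lemma class_of_coordinate:
  assumes e: "frame e" and b: "class_basis e b cl"
    and v: "cmb b a \<in> W e J" and k: "a k \<noteq> 0"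
  shows "cl k = J"
proof -
  let ?b = "b(k := cmb b a)" and ?cl = "cl(k := J)"
  have frb: "frame b" using b unfolding class_basis_def by blast
  have fr: "class_basis e ?b ?cl"
    using frame_exchange[OF frb, of "cmb b a" a k] k b v unfolding class_basis_def by simp
  show ?thesis
  proof (rule set_eqI)
    fix i
    obtain j where j: "i \<in> cl j" "\<forall>j'. i \<in> cl j' \<longrightarrow> j' = j"
      using classes_partition[OF e b, of i] by (auto simp: Ex1_def)
    obtain j2 where j2: "i \<in> ?cl j2" "\<forall>j'. i \<in> ?cl j' \<longrightarrow> j' = j2"
      using classes_partition[OF e fr, of i] by (auto simp: Ex1_def simp del: fun_upd_apply)
    show "i \<in> cl k \<longleftrightarrow> i \<in> J"
    proof
      assume "i \<in> cl k"
      then have "j = k" using j by blast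
      then have "i \<notin> ?cl j'" if "j' \<noteq> k" for j' using j(2) that by auto
      then have "j2 = k" using j2(1) by blast
      then show "i \<in> J" using j2(1) by simp
    next
      assume "i \<in> J"
      then have "i \<in> ?cl k" by simp
      then have "j2 = k" using j2(2) by blast
      then have "i \<notin> cl j'" if "j' \<noteq> k" for j' using j2(2)[THEN spec, of j'] that by auto
      then show "i \<in> cl k" using j(1) by metis
    qed
  qed
qed

lemma block_is_class:
  assumes e: "frame e" and b: "class_basis e b cl" and J: "W e J \<noteq> {0}"
  shows "\<exists>k. cl k = J"
proof -
  have frb: "frame b" using b unfolding class_basis_def by blast
  obtain v where v: "v \<in> W e J" "v \<noteq> 0" using J zero_in_W[OF e] by blast
  obtain a where a: "v = cmb b a" using frame_span[OF frb] by metis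
  have "\<exists>k. a k \<noteq> 0"
  proof (rule ccontr)
    assume "\<not> ?thesis"
    then have "a = (\<lambda>_. 0)" by auto
    then show False using a v(2) by simp
  qed
  then show ?thesis using class_of_coordinate[OF e b] v(1) a by blast
qed

lemma class_is_block: "class_basis e b cl \<Longrightarrow> W e (cl k) \<noteq> {0}"
  using frame_nonzero[of b k] unfolding class_basis_def by auto

text \<open>Every nonzero block occurs among the classes of one and the same basis, and these form a
  partition.\<close>

lemma blocks_disjoint:
  assumes e: "frame e" and "W e I \<noteq> {0}" "W e J \<noteq> {0}" "i \<in> I" "i \<in> J"
  shows "I = J"
proof -
  obtain b cl where b: "class_basis e b cl" using exists_classes[OF e] by blast
  obtain k where k: "cl k = I" using block_is_class[OF e b assms(2)] by blast
  obtain k' where k': "cl k' = J" using block_is_class[OF e b assms(3)] by blast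
  show ?thesis using classes_partition[OF e b, of i] k k' assms(4,5) by blast
qed

text \<open>A nonempty class occurs for only one basis vector.\<close>

lemma block_on_line:
  assumes e: "frame e" and J: "J \<noteq> {}"
  obtains d where "W e J \<subseteq> range (\<lambda>s. s *\<^sub>R d)"
proof -
  obtain b cl where b: "class_basis e b cl" using exists_classes[OF e] by blast
  have frb: "frame b" using b unfolding class_basis_def by blast
  obtain i where i: "i \<in> J" using J by blast
  obtain k where k: "i \<in> cl k" "\<forall>k'. i \<in> cl k' \<longrightarrow> k' = k"
    using classes_partition[OF e b, of i] by (auto simp: Ex1_def)
  have "v \<in> range (\<lambda>s. s *\<^sub>R b k)" if v: "v \<in> W e J" for v
  proof -
    obtain a where a: "v = cmb b a" using frame_span[OF frb] by metis
    have "a k' = 0" if "k' \<noteq> k" for k'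
    proof (rule ccontr)
      assume "a k' \<noteq> 0"
      then have "cl k' = J" using class_of_coordinate[OF e b] v a by blast
      then show False using k(2) i that by blast
    qed
    then have "a = ind {k} (a k)" unfolding ind_def by auto
    then have "v = a k *\<^sub>R b k" using a cmb_single by metis
    then show ?thesis by blast
  qed
  then show ?thesis using that[of "b k"] by blast
qed

end

section \<open>The two types of frames\<close>

lemma prod_ind_le:
  fixes Y :: "'n::finite set"
  assumes "s \<ge> 1" "I \<subseteq> Y \<Longrightarrow> card I \<le> m" shows "(\<Prod>j\<in>I. ind Y s j) \<le> s ^ m"
proof -
  have "(\<Prod>j\<in>I. ind Y s j) = (if I \<subseteq> Y then s ^ card I else 0)" by (rule prod_ind)
  then show ?thesis using assms by (simp add: power_increasing)
qed

context monotone_vc_valuation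
begin

text \<open>If \<open>J\<close> were a block with \<open>i, j \<in> J\<close> and \<open>y \<notin> J\<close>, then the coefficient of \<open>J\<close> vanishes whenever
  \<open>e i\<close> is replaced by \<open>e i + e y\<close> or by \<open>e i - e y\<close>. Comparing the box with edge \<open>2 e i / s\<close>
  with the one with edges \<open>(e i + e y) / s\<close> and \<open>(e i - e y) / s\<close>, where the edges belonging to
  \<open>J - {i}\<close> have length \<open>s\<close>, shows as \<open>s\<close> grows that the coefficient of \<open>J\<close> vanishes for \<open>e\<close> as well.\<close>

lemma no_mixed_block:
  assumes e: "frame e" and J: "W e J \<noteq> {0}" and ij: "i \<in> J" "j \<in> J" "i \<noteq> j" and y: "y \<notin> J"
  shows False
proof -
  define Y where "Y = J - {i}"
  define J' where "J' = insert y Y"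
  have iy: "i \<noteq> y" using ij y by auto
  have iY: "i \<notin> Y" and yY: "y \<notin> Y" and JY: "J = insert i Y" unfolding Y_def using ij y by auto
  have "j \<in> Y" unfolding Y_def using ij by simp
  then have cardY: "card Y \<ge> 1" by (simp add: Suc_le_eq card_gt_0_iff) blast
  \<comment> \<open>The frames \<open>e1\<close> and \<open>e2\<close> agree with \<open>e\<close>
    on \<open>J\<close>, so \<open>J\<close> remains a block for them; \<open>J'\<close> meets
    \<open>J\<close> in \<open>j\<close> without being equal to it, so its coefficient is 0. On
    \<open>J\<close> the frame \<open>f\<close> looks like \<open>e1\<close> on \<open>J'\<close>,
    and on \<open>J'\<close> it looks like \<open>e2\<close>; thus both coefficients vanish for
    \<open>f\<close>.\<close>
  define e1 where "e1 = e(y := e i + e y)"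
  define e2 where "e2 = e(y := e i - e y)"
  define f where "f = e(i := e i + e y, y := e i - e y)"
  have fr1: "frame e1" unfolding e1_def
    by (rule frame_exchange[OF e, of _ "\<lambda>m. ind {i} 1 m + ind {y} 1 m"])
      (use iy in \<open>simp_all add: cmb_add cmb_single\<close>)
  have fr2: "frame e2" unfolding e2_def
    by (rule frame_exchange[OF e, of _ "\<lambda>m. ind {i} 1 m - ind {y} 1 m"])
      (use iy in \<open>simp_all add: cmb_diff cmb_single\<close>)
  have f2: "f = e2(i := e i + e y)" unfolding f_def e2_def using iy by (simp add: fun_upd_twist)
  have frf: "frame f" unfolding f2
    by (rule frame_exchange[OF fr2, of _ "\<lambda>m. ind {i} 2 m - ind {y} 1 m"])
      (use iy in \<open>simp_all add: cmb_diff cmb_single e2_def scaleR_2\<close>)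
  have not_block: "wd e' u J' = 0" if e': "frame e'" "\<And>m. m \<in> J \<Longrightarrow> e' m = e m" for e' u
  proof -
    have "wd e' u J = wd e u J" for u by (rule wd_cong[OF e e'])
    then have "W e' J \<noteq> {0}" using J W_zero_iff[OF e] W_zero_iff[OF e'(1)] by simp
    moreover have "j \<in> J'" "J \<noteq> J'" unfolding J'_def Y_def using ij y by auto
    ultimately have "W e' J' = {0}" using blocks_disjoint[OF e'(1), of J J' j] ij(2) by blast
    then show ?thesis using W_zero_iff[OF e'(1)] by blast
  qed
  have ne_y: "m \<noteq> y" if "m \<in> J" for m using that y by auto
  have wfJ': "wd f u J' = 0" for u
  proof -
    have "wd f u J' = wd e2 u J'"
      by (rule wd_cong[OF fr2 frf]) (use iY iy in \<open>auto simp: f_def e2_def J'_def\<close>)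
    then show ?thesis using not_block[OF fr2] ne_y by (simp add: e2_def)
  qed
  have wfJ: "wd f u J = 0" for u
  proof -
    let ?p = "\<lambda>m. if m = i then y else m"
    have "wd f u J = wd e1 u J'"
    proof (rule wd_reindex[OF fr1 frf, of ?p])
      show "bij_betw ?p J J'" unfolding bij_betw_def inj_on_def J'_def JY using iY yY by auto
      show "f m = e1 (?p m)" if "m \<in> J" for m
        using that iy y by (auto simp: f_def e1_def)
    qed
    then show ?thesis using not_block[OF fr1] ne_y by (simp add: e1_def)
  qed
  have "wd e u J \<le> 0" for u
  proof (rule ccontr)
    assume "\<not> wd e u J \<le> 0"
    then have pos: "wd e u J > 0" by simp
    define B where "B = (\<Sum>I\<in>UNIV. wd f u I)"
    have B0: "B \<ge> 0" unfolding B_def by (intro sum_nonneg wd_nonneg frf)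
    have main: "2 * wd e u J \<le> B / s" if s: "s \<ge> 1" for s
    proof -
      define r where "r = 1 / s"
      have r: "r > 0" "r * s = 1" unfolding r_def using s by auto
      define le where "le = (ind Y s)(i := 2 * r)"
      define lf where "lf = (ind Y s)(i := r, y := r)"
      have le0: "0 \<le> le m" and lf0: "0 \<le> lf m" and l0: "0 \<le> ind Y s m" for m
        unfolding le_def lf_def using s r by auto
      \<comment> \<open>The edge \<open>2 *\<^sub>R e i\<close> is the diagonal of the parallelogram
        with edges \<open>e i + e y\<close> and \<open>e i - e y\<close>, so the coordinate is split
        in halves.\<close>
      have incl: "bx e le \<subseteq> bx f lf"
      proof
        fix x assume "x \<in> bx e le"
        then obtain t where t: "x = cmb e t" "\<And>m. 0 \<le> t m" "\<And>m. t m \<le> le m" by (rule bxE) blast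
        have ty: "t y = 0" using t(2,3)[of y] iy yY unfolding le_def by simp
        let ?t = "t(i := t i / 2, y := t i / 2)"
        have "cmb f ?t = x"
          unfolding f_def cmb_frame_upd cmb_upd t(1) using iy ty
          by (simp add: vec_eq_iff algebra_simps)
        moreover have "0 \<le> ?t m \<and> ?t m \<le> lf m" for m
          using t(2,3)[of m] t(2,3)[of i] iy unfolding lf_def le_def by auto
        ultimately show "x \<in> bx f lf" using bxI[of ?t lf f] by simp
      qed
      have "width (\<Phi> (bx e le)) u \<le> width (\<Phi> (bx f lf)) u"
        unfolding width_def by (intro add_mono sf_\<Phi>_mono convex_body_bx incl le0 lf0)
      moreover have "bx f (ind Y s) = bx e (ind Y s)"
        by (rule bx_reindex[of "\<lambda>m. m"]) (use iY yY s in \<open>auto simp: f_def bij_betw_def\<close>)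
      \<comment> \<open>Both boxes share the face spanned by \<open>Y\<close>. Subtracting its width
        removes the terms that do not involve \<open>i\<close> or \<open>y\<close>, which may be of
        higher order.\<close>
      ultimately have diff: "width (\<Phi> (bx e le)) u - width (\<Phi> (bx e (ind Y s))) u
          \<le> width (\<Phi> (bx f lf)) u - width (\<Phi> (bx f (ind Y s))) u" by simp
      have "wd e u J * (2 * r * s ^ card Y) \<le> width (\<Phi> (bx e le)) u - width (\<Phi> (bx e (ind Y s))) u"
      proof -
        have "(\<Prod>m\<in>J. le m) = 2 * r * s ^ card Y"
        proof -
          have "(\<Prod>m\<in>Y. le m) = (\<Prod>m\<in>Y. s)" by (rule prod.cong) (use iY in \<open>auto simp: le_def\<close>)
          then show ?thesis unfolding JY using iY by (simp add: le_def)
        qed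
        moreover have "(\<Prod>m\<in>J. ind Y s m) = 0" unfolding prod_ind using iY JY by auto
        moreover have "wd e u J * ((\<Prod>m\<in>J. le m) - (\<Prod>m\<in>J. ind Y s m))
            \<le> (\<Sum>I\<in>UNIV. wd e u I * ((\<Prod>m\<in>I. le m) - (\<Prod>m\<in>I. ind Y s m)))"
        proof (rule member_le_sum)
          fix I
          have "(\<Prod>m\<in>I. ind Y s m) \<le> (\<Prod>m\<in>I. le m)"
            by (rule prod_mono) (use l0 r iY in \<open>auto simp: le_def\<close>)
          then show "0 \<le> wd e u I * ((\<Prod>m\<in>I. le m) - (\<Prod>m\<in>I. ind Y s m))"
            by (intro mult_nonneg_nonneg wd_nonneg e) simp
        qed auto
        ultimately have "wd e u J * (2 * r * s ^ card Y)
            \<le> (\<Sum>I\<in>UNIV. wd e u I * ((\<Prod>m\<in>I. le m) - (\<Prod>m\<in>I. ind Y s m)))"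
          by (simp only: diff_0_right)
        then show ?thesis
          unfolding width_box_expansion[OF e le0] width_box_expansion[OF e l0]
          by (simp only: right_diff_distrib sum_subtractf)
      qed
      also note diff
      also have "width (\<Phi> (bx f lf)) u - width (\<Phi> (bx f (ind Y s))) u
          = (\<Sum>I\<in>UNIV. wd f u I * ((\<Prod>m\<in>I. lf m) - (\<Prod>m\<in>I. ind Y s m)))"
        unfolding width_box_expansion[OF frf lf0] width_box_expansion[OF frf l0]
        by (simp add: right_diff_distrib sum_subtractf)
      also have "\<dots> \<le> (\<Sum>I\<in>UNIV. wd f u I * (r * r * s ^ card Y))"
      proof (rule sum_mono)
        fix I
        have ind0: "(\<Prod>m\<in>I. ind Y s m) \<ge> 0" by (rule prod_nonneg) (use l0 in blast)
        \<comment> \<open>Apart from the two sets with vanishing coefficients, a set with just one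
          of \<open>i\<close>, \<open>y\<close> misses an element of \<open>Y\<close> or has product
          0. The missing factor \<open>s\<close> is traded for a second \<open>r\<close>, as
          \<open>r * s = 1\<close>.\<close>
        have single: "(\<Prod>m\<in>I. lf m) \<le> r * r * s ^ card Y"
          if a: "a \<in> I" "a' \<notin> I" "a = i \<and> a' = y \<or> a = y \<and> a' = i" "I \<noteq> insert a Y" for a a'
        proof -
          have la: "lf a = r" using a(3) iy unfolding lf_def by auto
          have "(\<Prod>m\<in>I. lf m) = lf a * (\<Prod>m\<in>I - {a}. lf m)" using a(1) by (intro prod.remove) auto
          also have "(\<Prod>m\<in>I - {a}. lf m) = (\<Prod>m\<in>I - {a}. ind Y s m)"
            by (rule prod.cong) (use a in \<open>auto simp: lf_def\<close>)
          also have "\<dots> \<le> s ^ (card Y - 1)"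
          proof (rule prod_ind_le[OF s])
            assume "I - {a} \<subseteq> Y"
            then have "I - {a} \<subset> Y" using a by blast
            then have "card (I - {a}) < card Y" by (intro psubset_card_mono) auto
            then show "card (I - {a}) \<le> card Y - 1" by simp
          qed
          finally have "(\<Prod>m\<in>I. lf m) \<le> r * s ^ (card Y - 1)" using la r by simp
          also have "\<dots> = r * (r * s) * s ^ (card Y - 1)" using r by simp
          also have "\<dots> = r * r * s ^ card Y"
            using cardY by (cases "card Y") auto
          finally show ?thesis .
        qed
        consider "i \<notin> I" "y \<notin> I" | "I = J" | "I = J'" | "i \<in> I" "y \<in> I"
          | "i \<in> I" "y \<notin> I" "I \<noteq> J" | "y \<in> I" "i \<notin> I" "I \<noteq> J'" by blast
        then show "wd f u I * ((\<Prod>m\<in>I. lf m) - (\<Prod>m\<in>I. ind Y s m)) \<le> wd f u I * (r * r * s ^ card Y)"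
        proof cases
          case 1
          then have "(\<Prod>m\<in>I. lf m) = (\<Prod>m\<in>I. ind Y s m)" by (intro prod.cong) (auto simp: lf_def)
          then show ?thesis using wd_nonneg[OF frf, of u I] r s by simp
        next
          case 2 then show ?thesis using wfJ by simp
        next
          case 3 then show ?thesis using wfJ' by simp
        next
          case 4
          have "(\<Prod>m\<in>I. lf m) = lf i * (\<Prod>m\<in>I - {i}. lf m)" using 4 by (intro prod.remove) auto
          also have "(\<Prod>m\<in>I - {i}. lf m) = lf y * (\<Prod>m\<in>I - {i} - {y}. lf m)" using 4 iy by (intro prod.remove) auto
          also have "(\<Prod>m\<in>I - {i} - {y}. lf m) = (\<Prod>m\<in>I - {i} - {y}. ind Y s m)"
            by (rule prod.cong) (auto simp: lf_def)
          also have "\<dots> \<le> s ^ card Y" by (rule prod_ind_le[OF s]) (simp add: card_mono)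
          finally have "(\<Prod>m\<in>I. lf m) \<le> r * r * s ^ card Y"
            using r iy unfolding lf_def by (simp add: mult_left_mono)
          then show ?thesis using ind0 by (intro mult_left_mono wd_nonneg frf) linarith
        next
          case 5
          have "(\<Prod>m\<in>I. lf m) \<le> r * r * s ^ card Y" by (rule single[of i y]) (use 5 JY in auto)
          then show ?thesis using ind0 by (intro mult_left_mono wd_nonneg frf) linarith
        next
          case 6
          have "(\<Prod>m\<in>I. lf m) \<le> r * r * s ^ card Y" by (rule single[of y i]) (use 6 J'_def in auto)
          then show ?thesis using ind0 by (intro mult_left_mono wd_nonneg frf) linarith
        qed
      qed
      also have "\<dots> = B * (r * r * s ^ card Y)" unfolding B_def by (simp add: sum_distrib_right)
      finally have "(r * s ^ card Y) * (2 * wd e u J) \<le> (r * s ^ card Y) * (B * r)" by (simp add: algebra_simps)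
      moreover have "r * s ^ card Y > 0" using r s by simp
      ultimately have "2 * wd e u J \<le> B * r" by (simp only: mult_le_cancel_left_pos)
      then show ?thesis unfolding r_def by simp
    qed
    \<comment> \<open>This \<open>s\<close> makes \<open>B / s\<close> at most
      \<open>wd e u J\<close>, contradicting the lower bound \<open>2 * wd e u J\<close>.\<close>
    define s where "s = B / wd e u J + 1"
    have s1: "s \<ge> 1" unfolding s_def using B0 pos by simp
    have "B / s \<le> wd e u J"
      using s1 pos B0 unfolding s_def by (simp add: field_simps)
    then show False using main[OF s1] pos by linarith
  qed
  then have "wd e u J = 0" for u using wd_nonneg[OF e, of u J] by (simp add: antisym)
  then show False using J W_zero_iff[OF e] by blast
qed

text \<open>The full set meets every nonempty set, so if it is a block, no other nonempty set is
  one. Otherwise \<open>no_mixed_block\<close> leaves only singletons, besides possibly the empty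
  set.\<close>

lemma blocks_dichotomy:
  assumes e: "frame e"
  shows "(W e UNIV \<noteq> {0} \<and> (\<forall>J. J \<noteq> {} \<longrightarrow> J \<noteq> UNIV \<longrightarrow> W e J = {0})) \<or> (\<forall>J. W e J \<noteq> {0} \<longrightarrow> (\<exists>i. J = {i}))"
proof (cases "W e UNIV = {0}")
  case False
  then have "W e J = {0}" if "J \<noteq> {}" "J \<noteq> UNIV" for J
    using blocks_disjoint[OF e, of J UNIV] that by (metis UNIV_I ex_in_conv)
  then show ?thesis using False by blast
next
  case True
  have single: "\<exists>i. J = {i}" if J: "W e J \<noteq> {0}" "J \<noteq> {}" for J
  proof (rule ccontr)
    assume ns: "\<not> ?thesis"
    obtain i where i: "i \<in> J" using J by blast
    then obtain j where "j \<in> J" "i \<noteq> j" using ns by blast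
    moreover have "J \<noteq> UNIV" using True J(1) by auto
    then obtain y where "y \<notin> J" by blast
    ultimately show False using no_mixed_block[OF e J(1) i] by blast
  qed
  have "W e {} = {0}"
  proof (rule ccontr)
    assume "W e {} \<noteq> {0}"
    obtain b cl where b: "class_basis e b cl" using exists_classes[OF e] by blast
    obtain k0 where k0: "cl k0 = {}" using block_is_class[OF e b \<open>W e {} \<noteq> {0}\<close>] by blast
    define h where "h i = (THE k. i \<in> cl k)" for i
    have h: "i \<in> cl (h i)" for i unfolding h_def by (rule theI'[OF classes_partition[OF e b]])
    \<comment> \<open>Each nonempty class is a singleton, so the n edges use up all n basis vectors
      and none is left for the empty class.\<close>
    have "inj h"
    proof (rule injI)
      fix i i' assume "h i = h i'"
      then have "i \<in> cl (h i)" "i' \<in> cl (h i)" using h[of i] h[of i'] by simp_all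
      moreover obtain m where "cl (h i) = {m}" using single[OF class_is_block[OF b], of "h i"] calculation by blast
      ultimately show "i = i'" by simp
    qed
    then have "surj h" using finite_UNIV_inj_surj[of h] by simp
    then obtain i where "h i = k0" unfolding surj_def by metis
    then show False using h[of i] k0 by simp
  qed
  then show ?thesis using single by blast
qed

lemma W_empty_iff: "frame e \<Longrightarrow> W e {} = {0} \<longleftrightarrow> (\<forall>u. width (\<Phi> {0}) u = 0)"
  by (simp add: W_zero_iff wd_def width_def cf_empty)

text \<open>With a trivial empty block, a full block would be the class of every basis vector, and
  two vectors cannot have the same nonempty class.\<close>

lemma blocks_point:
  assumes e: "frame e" and n: "CARD('n) \<ge> 2" and 0: "\<forall>u. width (\<Phi> {0}) u = 0" and J: "W e J \<noteq> {0}"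
  shows "\<exists>i. J = {i}"
proof -
  have "W e UNIV = {0}"
  proof (rule ccontr)
    assume U: "W e UNIV \<noteq> {0}"
    obtain b cl where b: "class_basis e b cl" using exists_classes[OF e] by blast
    have clU: "cl k = UNIV" for k
    proof -
      have "W e (cl k) \<noteq> {0}" by (rule class_is_block[OF b])
      moreover have "cl k \<noteq> {}" using calculation 0 W_empty_iff[OF e] by metis
      ultimately show ?thesis using blocks_disjoint[OF e _ U, of "cl k"] by (metis UNIV_I ex_in_conv)
    qed
    have "k = k'" for k k' :: 'n using classes_partition[OF e b, of k] clU by auto
    then have "CARD('n) \<le> 1" using card_le_Suc0_iff_eq[of "UNIV::'n set"] by simp
    then show False using n by simp
  qed
  then show ?thesis using blocks_dichotomy[OF e] J by blast
qed

text \<open>The empty set is a block here and is not a singleton, which excludes one alternative.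
  Vanishing of the symmetrized coefficient passes to both of its summands because they are
  nonnegative.\<close>

lemma blocks_full:
  assumes e: "frame e" and 0: "\<not> (\<forall>u. width (\<Phi> {0}) u = 0)"
  shows "W e UNIV \<noteq> {0}" "\<And>J u. J \<noteq> {} \<Longrightarrow> J \<noteq> UNIV \<Longrightarrow> cf e u J = 0"
proof -
  have "W e {} \<noteq> {0}" using 0 W_empty_iff[OF e] by blast
  then have d: "W e UNIV \<noteq> {0}" "\<And>J. J \<noteq> {} \<Longrightarrow> J \<noteq> UNIV \<Longrightarrow> W e J = {0}"
    using blocks_dichotomy[OF e] by blast+
  then show "W e UNIV \<noteq> {0}" by blast
  fix J :: "'n set" and u assume J: "J \<noteq> {}" "J \<noteq> UNIV"
  then have "wd e u J = 0" using d(2) W_zero_iff[OF e] by blast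
  then show "cf e u J = 0" using cf_nonneg[OF e J(1), of u] cf_nonneg[OF e J(1), of "-u"] unfolding wd_def by simp
qed

end

section \<open>The cylinder case\<close>

lemma cmb_axis: "cmb (\<lambda>i. axis i 1) (\<lambda>i. x $ i) = x"
  by (simp add: vec_eq_iff cmb_axis_nth)

lemma bx_axis: "bx (\<lambda>i. axis i 1) l = cbox 0 (\<chi> i. l i)" for l :: "'n::finite \<Rightarrow> real"
proof (intro set_eqI iffI)
  fix x assume "x \<in> bx (\<lambda>i. axis i 1) l"
  then show "x \<in> cbox 0 (\<chi> i. l i)" by (auto simp: mem_box_cart cmb_axis_nth elim!: bxE)
next
  fix x :: "real^'n" assume "x \<in> cbox 0 (\<chi> i. l i)"
  then have "cmb (\<lambda>i. axis i 1) (\<lambda>i. x $ i) \<in> bx (\<lambda>i. axis i 1) l" by (intro bxI) (simp add: mem_box_cart)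
  then show "x \<in> bx (\<lambda>i. axis i 1) l" by (simp add: cmb_axis)
qed

lemma convex_body_scale: "convex_body S \<Longrightarrow> convex_body ((\<lambda>x. r *\<^sub>R x) ` S)"
  unfolding convex_body_def by (simp add: compact_scaling convex_scaling)

lemma sf_scaled_body:
  assumes S: "convex_body S" and r: "r \<ge> 0" shows "sf ((\<lambda>x. r *\<^sub>R x) ` S) u = r * sf S u"
proof (rule antisym)
  show "sf ((\<lambda>x. r *\<^sub>R x) ` S) u \<le> r * sf S u"
    by (rule sf_least[OF convex_body_scale[OF S]]) (auto intro!: mult_left_mono r sf_upper[OF S])
  obtain x where "x \<in> S" "x \<bullet> u = sf S u" using sf_attained[OF S] by metis
  then show "r * sf S u \<le> sf ((\<lambda>x. r *\<^sub>R x) ` S) u"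
    using sf_upper[OF convex_body_scale[OF S, of r], of "r *\<^sub>R x" u] by auto
qed

lemma aff_dim_full_of_vol: "convex_body K \<Longrightarrow> vol K > 0 \<Longrightarrow> aff_dim K = int CARD('n)" for K :: "(real^'n) set"
proof -
  assume K: "convex_body K" "vol K > 0"
  then have "\<not> negligible K" using negligible_imp_measure0[of K] unfolding vol_def by auto
  then have "interior K \<noteq> {}" using K(1) negligible_convex_interior unfolding convex_body_def by blast
  then show ?thesis using aff_dim_nonempty_interior[of K] by simp
qed

lemma aff_dim_less_of_vol: "convex_body K \<Longrightarrow> vol K = 0 \<Longrightarrow> aff_dim K < int CARD('n)" for K :: "(real^'n) set"
proof -
  assume K: "convex_body K" "vol K = 0"
  have "negligible K" using negligible_iff_measure0[OF convex_body_lmeasurable[OF K(1)]] K(2) unfolding vol_def by simp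
  then have int: "interior K = {}" using K(1) negligible_convex_interior unfolding convex_body_def by blast
  have "aff_dim K \<noteq> int CARD('n)"
  proof
    assume "aff_dim K = int CARD('n)"
    then have "interior K = rel_interior K" using interior_rel_interior_gen[of K] by simp
    then show False using int rel_interior_eq_empty K(1) unfolding convex_body_def by blast
  qed
  then show ?thesis using aff_dim_le_DIM[of K] by simp
qed

lemma aff_dim_msum_line:
  fixes L S :: "(real^'n) set"
  assumes L: "L \<noteq> {}" and S: "0 \<in> S" "S \<subseteq> range (\<lambda>s. s *\<^sub>R d)"
  shows "aff_dim (msum L S) \<le> aff_dim L + 1"
proof -
  obtain l0 where l0: "l0 \<in> L" using L by blast
  let ?L = "(\<lambda>x. -l0 + x) ` L" and ?M = "(\<lambda>x. -l0 + x) ` msum L S"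
  have "l0 \<in> msum L S" unfolding msum_def using l0 S(1) by force
  then have "0 \<in> ?L" "0 \<in> ?M" using l0 by force+
  then have dims: "aff_dim ?L = int (dim ?L)" "aff_dim ?M = int (dim ?M)"
    by (simp_all add: aff_dim_zero hull_inc)
  have "?M \<subseteq> span (insert d ?L)"
  proof
    fix z assume "z \<in> ?M"
    then obtain x y where xy: "x \<in> L" "y \<in> S" "z = -l0 + (x + y)" unfolding msum_def by blast
    moreover obtain s where "y = s *\<^sub>R d" using xy(2) S(2) by blast
    ultimately have z: "x \<in> L" "z = (-l0 + x) + s *\<^sub>R d" by simp_all
    moreover have "- l0 + x \<in> span (insert d ?L)" by (rule span_base) (use z in auto)
    moreover have "s *\<^sub>R d \<in> span (insert d ?L)" by (rule span_scale, rule span_base) simp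
    ultimately show "z \<in> span (insert d ?L)" by (simp only: span_add)
  qed
  then have "dim ?M \<le> dim (insert d ?L)" using dim_subset[of ?M "span (insert d ?L)"] by simp
  also have "\<dots> \<le> dim ?L + 1" by (simp add: dim_insert)
  finally have "int (dim ?M) \<le> int (dim ?L) + 1" by linarith
  moreover have "aff_dim ?L = aff_dim L" "aff_dim ?M = aff_dim (msum L S)" by (rule aff_dim_translation_eq)+
  ultimately show ?thesis using dims by linarith
qed

lemma aff_dim_segment_line:
  assumes "0 \<in> S" "v \<in> S" "v \<noteq> 0" "S \<subseteq> range (\<lambda>s. s *\<^sub>R d)"
  shows "aff_dim S = 1"
proof (rule antisym)
  have "{0, v} \<subseteq> S" using assms by auto
  then show "1 \<le> aff_dim S" using aff_dim_subset[of "{0, v}" S] assms(3) by (simp add: aff_dim_2)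
  have "S \<subseteq> span {d}" using assms(4) by (auto simp: span_singleton)
  then have "aff_dim S \<le> int (dim (span {d}))" using aff_dim_subset[of S "span {d}"] by (simp add: aff_dim_subspace)
  also have "dim (span {d}) \<le> 1" using dim_le_card'[of "{d}"] by simp
  finally show "aff_dim S \<le> 1" by simp
qed

context monotone_vc_valuation
begin

text \<open>The excess of \<open>sf (\<Phi> K) u\<close> over its value at a point vanishes on
  bodies in coordinate hyperplanes, so it is a simple valuation and a multiple of volume. The
  multiple, as a function of \<open>u\<close>, is sublinear and yields \<open>S\<close>.\<close>

lemma full_block_form:
  assumes 0: "\<not> (\<forall>u. width (\<Phi> {0}) u = 0)"
  shows "\<exists>L S. convex_body L \<and> convex_body S \<and> 0 \<in> S \<and>
        aff_dim S = 1 \<and> aff_dim L = int CARD('n) - 1 \<and> aff_dim (msum L S) = int CARD('n) \<and>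
        (\<forall>K. convex_body K \<longrightarrow> \<Phi> K = msum L ((\<lambda>x. vol K *\<^sub>R x) ` S))"
proof -
  let ?e = "\<lambda>i. axis i 1 :: real^'n"
  define L where "L = \<Phi> {0}"
  have e: "frame ?e" by (rule frame_axis)
  define c where "c u = cf ?e u UNIV" for u
  have cc: "sublin c" unfolding c_def by (rule cf_sublin[OF e])
  have c0: "c u \<ge> 0" for u unfolding c_def by (rule cf_nonneg[OF e]) simp
  have box: "sf (\<Phi> (bx ?e l)) u = sf L u + c u * (\<Prod>i\<in>UNIV. l i)" if "\<And>i. 0 \<le> l i" for l u
  proof -
    have "sf (\<Phi> (bx ?e l)) u = (\<Sum>I\<in>UNIV. cf ?e u I * (\<Prod>i\<in>I. l i))" by (rule sf_box_expansion[OF e that])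
    also have "\<dots> = (\<Sum>I\<in>{{}, UNIV}. cf ?e u I * (\<Prod>i\<in>I. l i))"
      by (rule sum.mono_neutral_right) (use blocks_full(2)[OF e 0] in auto)
    also have "\<dots> = cf ?e u {} + cf ?e u UNIV * (\<Prod>i\<in>UNIV. l i)" by simp
    finally show ?thesis unfolding c_def L_def cf_empty[OF e] .
  qed
  have main: "sf (\<Phi> K) u = sf L u + c u * vol K" if K: "convex_body K" for K u
  proof -
    define \<psi> where "\<psi> K = sf (\<Phi> K) u - sf L u" for K
    \<comment> \<open>Such a body lies between one of its points and a box whose i-th edge is 0. The
      product of the edge lengths is 0, so both have the same image \<open>L\<close>.\<close>
    have deg: "\<psi> K = 0" if K: "convex_body K" "K \<subseteq> {x. x $ i = d}" for K i d
    proof -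
      obtain a b where ab: "K \<subseteq> cbox a b"
        using K(1) bounded_subset_cbox_symmetric[of K] compact_imp_bounded[of K] unfolding convex_body_def by metis
      obtain p where p: "p \<in> K" using K unfolding convex_body_def by auto
      have mab: "a $ j \<le> x $ j \<and> x $ j \<le> b $ j" if "x \<in> K" for x j
        using that ab mem_box_cart(2)[of x a b] by blast
      have pab: "a $ j \<le> b $ j" for j using mab[OF p, of j] by simp
      let ?a = "\<chi> j. if j = i then d else a $ j"
      let ?l = "\<lambda>j. if j = i then 0 else b $ j - a $ j"
      have l: "0 \<le> ?l j" for j using pab by simp
      have "K \<subseteq> (\<lambda>x. x + ?a) ` bx ?e ?l"
      proof
        fix x assume x: "x \<in> K"
        have "a $ j \<le> x $ j \<and> x $ j \<le> b $ j" for j using mab[OF x] .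
        moreover have "x $ i = d" using x K(2) by auto
        ultimately have "x - ?a \<in> bx ?e ?l" unfolding bx_axis by (auto simp: mem_box_cart)
        then show "x \<in> (\<lambda>x. x + ?a) ` bx ?e ?l" by (rule rev_image_eqI) simp
      qed
      then have "sf (\<Phi> K) u \<le> sf (\<Phi> ((\<lambda>x. x + ?a) ` bx ?e ?l)) u"
        by (intro sf_\<Phi>_mono K convex_body_translate convex_body_bx l)
      also have "\<dots> = sf (\<Phi> (bx ?e ?l)) u" by (simp only: trans[OF convex_body_bx[OF l]])
      also have "\<dots> = sf L u"
      proof -
        have "(\<Prod>j\<in>UNIV. ?l j) = 0" by (rule prod_zero) auto
        then show ?thesis using box[OF l] by simp
      qed
      finally have "sf (\<Phi> K) u \<le> sf L u" .
      moreover have "sf L u \<le> sf (\<Phi> K) u"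
      proof -
        have "\<Phi> {p} = L" using trans[OF convex_body_sing[of 0], of p] unfolding L_def by simp
        then show ?thesis using sf_\<Phi>_mono[OF convex_body_sing K(1), of p u] p by simp
      qed
      ultimately show ?thesis unfolding \<psi>_def by simp
    qed
    have "\<psi> K = \<psi> (cbox 0 1) * vol K"
    proof (rule simple_valuation_eq_vol[OF _ _ _ deg K])
      fix M :: "(real^'n) set" assume M: "convex_body M"
      show "\<psi> ((\<lambda>x. x + t) ` M) = \<psi> M" for t unfolding \<psi>_def using trans[OF M] by simp
      show "\<psi> M \<le> \<psi> N" if "convex_body N" "M \<subseteq> N" for N
        unfolding \<psi>_def using sf_\<Phi>_mono[OF M that] by simp
      fix i d assume ne: "M \<inter> {x. x $ i \<le> d} \<noteq> {}" "M \<inter> {x. x $ i \<ge> d} \<noteq> {}"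
      let ?A = "M \<inter> {x. x $ i \<le> d}" and ?B = "M \<inter> {x. x $ i \<ge> d}"
      have A: "convex_body ?A" and B: "convex_body ?B" by (rule convex_body_Int_halfspace[OF M] ne)+
      have AuB: "?A \<union> ?B = M" by auto
      \<comment> \<open>The valuation property needs a body as intersection; connectedness makes the
        section nonempty.\<close>
      have AiB: "?A \<inter> ?B \<noteq> {}"
      proof
        assume "?A \<inter> ?B = {}"
        moreover have "connected M" using M convex_connected unfolding convex_body_def by blast
        moreover have "{x. x $ i \<le> d} \<inter> {x. x $ i \<ge> d} \<inter> M = {}" using calculation(1) by blast
        moreover have "M \<subseteq> {x. x $ i \<le> d} \<union> {x. x $ i \<ge> d}" by auto
        ultimately show False using connected_closedD[of M "{x. x $ i \<le> d}" "{x. x $ i \<ge> d}"] ne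
            coordinate_halfspaces(1,2)[where i = i and c = d] by blast
      qed
      have D: "convex_body (?A \<inter> ?B)"
        using A B AiB unfolding convex_body_def by (simp add: compact_Int convex_Int)
      have "sf (\<Phi> ?A) u + sf (\<Phi> ?B) u = sf (\<Phi> M) u + sf (\<Phi> (?A \<inter> ?B)) u"
        using sf_valuation[OF A B _ D] M unfolding AuB by simp
      moreover have "\<psi> (?A \<inter> ?B) = 0" by (rule deg[OF D, of i d]) auto
      ultimately show "\<psi> M = \<psi> ?A + \<psi> ?B" unfolding \<psi>_def by simp
    qed
    moreover have "\<psi> (cbox 0 1) = c u"
    proof -
      have "bx ?e (\<lambda>_. 1) = cbox 0 1" unfolding bx_axis by (simp add: one_vec_def)
      then show ?thesis unfolding \<psi>_def using box[of "\<lambda>_. 1" u] by simp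
    qed
    ultimately show ?thesis unfolding \<psi>_def by simp
  qed
  define S where "S = wulff c"
  have S: "convex_body S" and sfS: "\<And>u. sf S u = c u"
    unfolding S_def using convex_body_wulff[OF cc] sf_wulff[OF cc] by auto
  have S0: "0 \<in> S" unfolding S_def wulff_def using c0 by simp
  have L: "convex_body L" unfolding L_def by (intro body convex_body_sing)
  have form: "\<Phi> K = msum L ((\<lambda>x. vol K *\<^sub>R x) ` S)" if K: "convex_body K" for K
    by (rule convex_body_eqI)
      (auto intro!: body K convex_body_msum L convex_body_scale S
        simp: sf_msum[OF L convex_body_scale[OF S]] sf_scaled_body[OF S vol_nonneg] main[OF K] sfS)
  obtain d where d: "W ?e UNIV \<subseteq> range (\<lambda>s. s *\<^sub>R d)" using block_on_line[OF e, of UNIV] by blast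
  \<comment> \<open>Nonnegativity of \<open>c\<close> gives \<open>c u \<le> c u + c (-u)\<close>,
    so \<open>S\<close> lies on the line carrying the block of all edges.\<close>
  have "S \<subseteq> W ?e UNIV"
  proof
    fix v assume "v \<in> S"
    then have "\<forall>u. v \<bullet> u \<le> c u" unfolding S_def wulff_def by blast
    then have "v \<bullet> u \<le> c u + c (-u)" for u using c0[of "-u"] by (simp add: add_increasing2)
    then have "v \<bullet> u \<le> wd ?e u UNIV" for u unfolding wd_def c_def .
    then show "v \<in> W ?e UNIV" unfolding W_def wulff_def by blast
  qed
  then have Sd: "S \<subseteq> range (\<lambda>s. s *\<^sub>R d)" using d by blast
  obtain v where v: "v \<in> S" "v \<noteq> 0"
  proof -
    have "\<not> S \<subseteq> {0}"
    proof
      assume "S \<subseteq> {0}"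
      then have "S = {0}" using S0 by blast
      then have "c u = 0" for u using sfS[of u] sf_singleton[of 0 u] by simp
      then have "W ?e UNIV = {0}" unfolding W_zero_iff[OF e] wd_def c_def by simp
      then show False using blocks_full(1)[OF e 0] by blast
    qed
    then show ?thesis using that by blast
  qed
  have dimS: "aff_dim S = 1" by (rule aff_dim_segment_line[OF S0 v Sd])
  obtain k C where kC: "k > 0" "\<And>K. convex_body K \<Longrightarrow> k * vol K \<le> vol (\<Phi> K) \<and> vol (\<Phi> K) \<le> C * vol K"
    using vc unfolding VC_def by blast
  have "L \<noteq> {}" using L unfolding convex_body_def by blast
  have cube: "convex_body (cbox 0 1 :: (real^'n) set)"
    by (auto simp: convex_body_def convex_box interval_ne_empty_cart)
  have vcube: "vol (cbox 0 1 :: (real^'n) set) = 1" unfolding vol_def by (simp add: content_cbox_cart interval_ne_empty_cart)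
  have LS: "\<Phi> (cbox 0 1) = msum L S" using form[OF cube] vcube by simp
  have "vol (\<Phi> (cbox 0 1)) > 0" using kC(1) kC(2)[OF cube] vcube by simp
  then have dimLS: "aff_dim (msum L S) = int CARD('n)"
    using aff_dim_full_of_vol[OF body[OF cube]] LS by simp
  \<comment> \<open>The upper volume bound at a point makes \<open>L\<close> flat, while adding
    \<open>S\<close>, which lies on a line, must raise the dimension to n. This leaves n - 1 for
    \<open>L\<close>.\<close>
  have "vol ({0} :: (real^'n) set) = 0" unfolding vol_def by simp
  then have "vol L = 0" using kC(2)[OF convex_body_sing[of 0]] vol_nonneg[of L] unfolding L_def by simp
  then have "aff_dim L < int CARD('n)" by (rule aff_dim_less_of_vol[OF L])
  moreover have "aff_dim (msum L S) \<le> aff_dim L + 1" by (rule aff_dim_msum_line[OF \<open>L \<noteq> {}\<close> S0 Sd])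
  ultimately have dimL: "aff_dim L = int CARD('n) - 1" using dimLS by simp
  show ?thesis using L S S0 dimS dimL dimLS form by blast
qed

end

section \<open>Seminorms that are absolute values of linear functionals\<close>

definition indep2 :: "real^'n \<Rightarrow> real^'n \<Rightarrow> bool" where
  "indep2 x y \<longleftrightarrow> (\<forall>a b. a *\<^sub>R x + b *\<^sub>R y = 0 \<longrightarrow> a = 0 \<and> b = 0)"

lemma frame_indep2: assumes e: "frame e" and ij: "i \<noteq> j" shows "indep2 (e i) (e j)"
  unfolding indep2_def
proof (intro allI impI)
  fix a b assume "a *\<^sub>R e i + b *\<^sub>R e j = 0"
  then have c: "cmb e (\<lambda>k. ind {i} a k + ind {j} b k) = 0" by (simp add: cmb_add cmb_single)
  show "a = 0 \<and> b = 0" using frameD[OF e c, of i] frameD[OF e c, of j] ij by simp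
qed

lemma dependent2_cases:
  assumes "\<not> indep2 x y" obtains "x = 0" | c where "y = c *\<^sub>R x"
proof -
  obtain a b where ab: "a *\<^sub>R x + b *\<^sub>R y = 0" "a \<noteq> 0 \<or> b \<noteq> 0" using assms unfolding indep2_def by blast
  show ?thesis
  proof (cases "b = 0")
    case True then show ?thesis using ab that by simp
  next
    case False
    have "y = (1 / b) *\<^sub>R (b *\<^sub>R y)" using False by simp
    also have "b *\<^sub>R y = - (a *\<^sub>R x)" using ab(1) by (simp add: eq_neg_iff_add_eq_0 add.commute)
    finally have "y = (- a / b) *\<^sub>R x" by simp
    then show ?thesis using that by blast
  qed
qed

lemma frame_containing:
  fixes x :: "real^'n" assumes "x \<noteq> 0" shows "\<exists>e i. frame e \<and> e i = x"
proof -
  obtain i where "x $ i \<noteq> 0" using assms by (auto simp: vec_eq_iff)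
  then have "frame ((\<lambda>i. axis i 1)(i := x))"
    using frame_exchange[OF frame_axis, of x "\<lambda>i. x $ i" i] cmb_axis[of x] by simp
  then show ?thesis by (metis fun_upd_same)
qed

lemma frame_containing2:
  fixes x y :: "real^'n" assumes xy: "indep2 x y"
  shows "\<exists>e i j. frame e \<and> i \<noteq> j \<and> e i = x \<and> e j = y"
proof -
  have "x \<noteq> 0" using xy unfolding indep2_def by (metis add.right_neutral scaleR_zero_left scaleR_zero_right zero_neq_one)
  then obtain e i where e: "frame e" "e i = x" using frame_containing by blast
  obtain a where a: "y = cmb e a" using frame_span[OF e(1)] by metis
  have "\<exists>j. j \<noteq> i \<and> a j \<noteq> 0"
  proof (rule ccontr)
    assume "\<not> ?thesis"
    then have "a = ind {i} (a i)" by (intro ext) (auto simp: ind_def)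
    then have "y = a i *\<^sub>R x" using a e(2) cmb_single[of e i "a i"] by simp
    then have "a i *\<^sub>R x + (-1) *\<^sub>R y = 0" by simp
    then show False using xy unfolding indep2_def by (metis neg_equal_0_iff_equal zero_neq_one)
  qed
  then obtain j where j: "j \<noteq> i" "a j \<noteq> 0" by blast
  have "frame (e(j := y))" using frame_exchange[OF e(1) a j(2)] .
  moreover have "(e(j := y)) i = x" "(e(j := y)) j = y" using e(2) j(1) by auto
  ultimately show ?thesis using j(1) by (intro exI[of _ "e(j := y)"] exI[of _ i] exI[of _ j]) simp
qed

text \<open>A basis selected from the n values of \<open>v\<close> has to use each index once, so it
  is \<open>v\<close> up to a permutation.\<close>

lemma frame_of_spanning_family:
  fixes v :: "'n \<Rightarrow> real^'n"
  assumes v: "\<And>u. u \<noteq> 0 \<Longrightarrow> \<exists>i. v i \<bullet> u \<noteq> 0" shows "frame v"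
proof -
  obtain b :: "'n \<Rightarrow> real^'n" where b: "frame b" "\<And>k. b k \<in> range v"
    using frame_from_spanning[of "range v"] v by blast
  have "\<forall>k. \<exists>i. b k = v i" using b(2) by blast
  then obtain \<sigma> where \<sigma>: "\<forall>k. b k = v (\<sigma> k)" by (rule choice[THEN exE])
  have "inj \<sigma>"
  proof (rule injI, rule ccontr)
    fix k k' assume k: "\<sigma> k = \<sigma> k'" "k \<noteq> k'"
    then have "1 *\<^sub>R b k + (-1) *\<^sub>R b k' = 0" using \<sigma> by simp
    then show False using frame_indep2[OF b(1) k(2)] unfolding indep2_def by (metis zero_neq_one)
  qed
  then have bij: "bij \<sigma>" using finite_UNIV_inj_surj[of \<sigma>] by (simp add: bij_def)
  show ?thesis unfolding frame_def
  proof (intro allI impI)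
    fix t i assume 0: "cmb v t = 0"
    have "cmb b (\<lambda>k. t (\<sigma> k)) = (\<Sum>k\<in>UNIV. t (\<sigma> k) *\<^sub>R v (\<sigma> k))" unfolding cmb_def using \<sigma> by simp
    also have "\<dots> = cmb v t" unfolding cmb_def
      using sum.reindex_bij_betw[OF bij, of "\<lambda>i. t i *\<^sub>R v i"] by simp
    finally have z: "cmb b (\<lambda>k. t (\<sigma> k)) = 0" using 0 by simp
    obtain k where "\<sigma> k = i" using bij by (metis bij_pointE)
    then show "t i = 0" using frameD[OF b(1) z, of k] by simp
  qed
qed

lemma dual_frame:
  fixes b :: "'n \<Rightarrow> real^'n"
  assumes b: "frame b"
  obtains e where "frame e" "\<And>j k. e j \<bullet> b k = (if j = k then 1 else 0)" "\<And>x. x = cmb e (\<lambda>k. x \<bullet> b k)"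
proof -
  have "\<exists>u. b j \<bullet> u = 1 \<and> (\<forall>k. k \<noteq> j \<longrightarrow> b k \<bullet> u = 0)" for j using frame_dual[OF b, of j] by metis
  then obtain e where e: "\<And>j. b j \<bullet> e j = 1 \<and> (\<forall>k. k \<noteq> j \<longrightarrow> b k \<bullet> e j = 0)" by metis
  have d: "e j \<bullet> b k = (if j = k then 1 else 0)" for j k unfolding inner_commute[of "e j"] using e[of j] by (cases "j = k") auto
  have c: "cmb e t \<bullet> b k = t k" for t k
    unfolding cmb_def inner_sum_left by (simp add: d if_distrib[of "\<lambda>x. _ * x"] cong: if_cong)
  have fr: "frame e" unfolding frame_def
  proof (intro allI impI)
    fix t i assume "cmb e t = 0" then show "t i = 0" using c[of t i] by simp
  qed
  have "x = cmb e (\<lambda>k. x \<bullet> b k)" for x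
  proof -
    obtain t where "x = cmb e t" using frame_span[OF fr] by metis
    then show ?thesis using c by simp
  qed
  then show ?thesis using that fr d by blast
qed

lemma abs_inner_eq:
  fixes a b :: "real^'n"
  assumes "\<And>u. \<bar>a \<bullet> u\<bar> = \<bar>b \<bullet> u\<bar>" shows "a = b \<or> a = - b"
proof -
  have "\<bar>a \<bullet> b\<bar> = a \<bullet> a" "\<bar>a \<bullet> b\<bar> = b \<bullet> b" using assms[of a] assms[of b] by (simp_all add: inner_commute)
  then have "(a - b) \<bullet> (a - b) = 0 \<or> (a + b) \<bullet> (a + b) = 0"
    by (simp add: inner_diff_left inner_diff_right inner_add_left inner_add_right inner_commute[of b a]) argo
  then show ?thesis by (auto simp: eq_neg_iff_add_eq_0)
qed

text \<open>The kernel of \<open>f\<close> meets every plane, so it has codimension at most one.\<close>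

lemma abs_linear_seminorm:
  fixes f :: "real^'n \<Rightarrow> real"
  assumes hom: "\<And>t x. f (t *\<^sub>R x) = \<bar>t\<bar> * f x" and add: "\<And>x y. f (x + y) \<le> f x + f y"
    and par: "\<And>x y. min (f (x + y)) (f (x - y)) \<le> \<bar>f x - f y\<bar>"
  shows "\<exists>v. \<forall>x. f x = \<bar>v \<bullet> x\<bar>"
proof -
  have neg: "f (- x) = f x" for x using hom[of "-1" x] by simp
  have f0: "f 0 = 0" using hom[of 0 0] by simp
  have nn: "f x \<ge> 0" for x using add[of x "-x"] f0 neg by simp
  show ?thesis
  proof (cases "\<forall>x. f x = 0")
    case True then show ?thesis by (intro exI[of _ 0]) simp
  next
    case False
    then obtain x1 where "f x1 \<noteq> 0" by blast
    then have "f x1 > 0" using nn[of x1] by simp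
    define x0 where "x0 = (1 / f x1) *\<^sub>R x1"
    have fx0: "f x0 = 1" unfolding x0_def hom using \<open>f x1 > 0\<close> by simp
    have ker: "f x = f y" if "f (x - y) = 0" for x y
      using add[of "x - y" y] add[of "y - x" x] neg[of "x - y"] that by simp
    \<comment> \<open>As \<open>f x0 = 1\<close>, the right-hand side of \<open>par\<close> for
      \<open>y\<close> and \<open>f y *\<^sub>R x0\<close> is 0, so the sum or the difference lies
      in the kernel.\<close>
    have ex: "\<exists>c. f (y - c *\<^sub>R x0) = 0" for y
    proof -
      have m: "min (f (y + f y *\<^sub>R x0)) (f (y - f y *\<^sub>R x0)) \<le> 0"
        using par[of y "f y *\<^sub>R x0"] nn[of y] by (simp add: hom fx0)
      show ?thesis
      proof (cases "f (y - f y *\<^sub>R x0) \<le> 0")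
        case True then show ?thesis using nn by (metis antisym)
      next
        case False
        then have "f (y - (- f y) *\<^sub>R x0) \<le> 0" using m by (simp add: min_def split: if_splits)
        then show ?thesis using nn by (metis antisym)
      qed
    qed
    then obtain c where c: "\<And>y. f (y - c y *\<^sub>R x0) = 0" by metis
    have uniq: "d = c y" if "f (y - d *\<^sub>R x0) = 0" for y d
    proof -
      have "f ((d - c y) *\<^sub>R x0) \<le> f (y - c y *\<^sub>R x0) + f (- (y - d *\<^sub>R x0))"
        using add[of "y - c y *\<^sub>R x0" "- (y - d *\<^sub>R x0)"] by (simp add: algebra_simps)
      then have "\<bar>d - c y\<bar> \<le> 0" using c that by (simp only: hom fx0 neg) simp
      then show ?thesis by simp
    qed
    have "linear c"
    proof (rule linearI)
      fix x y
      have "f ((x + y) - (c x + c y) *\<^sub>R x0) \<le> f (x - c x *\<^sub>R x0) + f (y - c y *\<^sub>R x0)"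
        using add[of "x - c x *\<^sub>R x0" "y - c y *\<^sub>R x0"] by (simp add: algebra_simps)
      then have "f ((x + y) - (c x + c y) *\<^sub>R x0) = 0" using c nn[of "(x + y) - (c x + c y) *\<^sub>R x0"] by simp
      then show "c (x + y) = c x + c y" using uniq by simp
    next
      fix t x
      have "f (t *\<^sub>R x - (t * c x) *\<^sub>R x0) = \<bar>t\<bar> * f (x - c x *\<^sub>R x0)"
        using hom[of t "x - c x *\<^sub>R x0"] by (simp add: algebra_simps)
      then show "c (t *\<^sub>R x) = t *\<^sub>R c x" using uniq c by simp
    qed
    moreover have "f x = \<bar>c x\<bar>" for x
    proof -
      have "f x = f (c x *\<^sub>R x0)" using ker c by blast
      then show ?thesis by (simp add: hom fx0)
    qed
    moreover have "c x = adjoint c 1 \<bullet> x" if "linear c" for x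
      using adjoint_works[OF that, of x 1] by (simp add: inner_commute)
    ultimately show ?thesis by metis
  qed
qed

text \<open>The body is the segment from \<open>-D\<close> to \<open>D\<close>, where
  \<open>D\<close> is its extreme point in direction \<open>d\<close>.\<close>

lemma even_body_on_line:
  fixes C :: "(real^'n) set"
  assumes C: "convex_body C" "C \<subseteq> range (\<lambda>s. s *\<^sub>R d)" and even: "\<And>u. sf C (-u) = sf C u"
  shows "\<exists>D. \<forall>u. sf C u = \<bar>D \<bullet> u\<bar>"
proof -
  obtain D where D: "D \<in> C" "D \<bullet> d = sf C d" using sf_attained[OF C(1)] by metis
  obtain s0 where s0: "D = s0 *\<^sub>R d" using D C by blast
  have "sf C u = \<bar>D \<bullet> u\<bar>" for u
  proof (rule antisym)
    show "\<bar>D \<bullet> u\<bar> \<le> sf C u"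
      using sf_upper[OF C(1) D(1), of u] sf_upper[OF C(1) D(1), of "-u"] even[of u] by simp
    show "sf C u \<le> \<bar>D \<bullet> u\<bar>"
    proof (rule sf_least[OF C(1)])
      fix v assume v: "v \<in> C"
      then obtain s where s: "v = s *\<^sub>R d" using C by blast
      have "\<bar>s\<bar> * (d \<bullet> d) \<le> s0 * (d \<bullet> d)"
        using sf_upper[OF C(1) v, of d] sf_upper[OF C(1) v, of "-d"] even[of d] D(2) s s0
        by (simp add: abs_if)
      then have "d = 0 \<or> \<bar>s\<bar> \<le> s0" by (auto simp: mult_le_cancel_right)
      then show "v \<bullet> u \<le> \<bar>D \<bullet> u\<bar>"
      proof
        assume "\<bar>s\<bar> \<le> s0"
        then have "\<bar>s\<bar> * \<bar>d \<bullet> u\<bar> \<le> \<bar>s0\<bar> * \<bar>d \<bullet> u\<bar>" by (intro mult_right_mono) auto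
        moreover have "s * (d \<bullet> u) \<le> \<bar>s\<bar> * \<bar>d \<bullet> u\<bar>" by (metis abs_ge_self abs_mult)
        ultimately show ?thesis unfolding s s0 by (simp add: abs_mult)
      qed (simp add: s)
    qed
  qed
  then show ?thesis by blast
qed

text \<open>The squares are quadratic polynomials in \<open>t\<close>; their values at 1, -1, 2 and
  -2 determine the constant terms.\<close>

lemma abs_eq_of_perturbation:
  fixes p q r s :: real
  assumes "\<And>t. t \<noteq> 0 \<Longrightarrow> \<bar>p + t * q\<bar> = \<bar>r + t * s\<bar>" shows "\<bar>p\<bar> = \<bar>r\<bar>"
proof -
  have "(p + t * q)\<^sup>2 = (r + t * s)\<^sup>2" if "t \<noteq> 0" for t using assms[OF that] by (metis power2_abs)
  from this[of 1] this[of "-1"] this[of 2] this[of "-2"] have "p\<^sup>2 = r\<^sup>2"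
    by (simp add: power2_eq_square algebra_simps)
  then show ?thesis by (metis real_sqrt_abs)
qed

section \<open>The difference body case\<close>

locale point_valuation = monotone_vc_valuation \<Phi>
  for \<Phi> :: "(real^'n) set \<Rightarrow> (real^'n) set" +
  assumes two: "CARD('n) \<ge> 2" and point: "width (\<Phi> {0}) u = 0"
begin

text \<open>The image of 0 has width 0 in every direction, so it is a single point and the choice is
  forced.\<close>

definition p :: "real^'n" where "p = (SOME p. p \<in> \<Phi> {0})"

lemma sf_point: "sf (\<Phi> {0}) u = p \<bullet> u"
proof -
  have cb: "convex_body (\<Phi> {0})" by (intro body convex_body_sing)
  then have "p \<in> \<Phi> {0}" unfolding p_def convex_body_def by (metis some_in_eq)
  then show ?thesis
    using sf_upper[OF cb, of p u] sf_upper[OF cb, of p "-u"] point[of u] unfolding width_def by simp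
qed

lemma sf_box_additive_cf:
  assumes e: "frame e" and l: "\<And>i. 0 \<le> l i"
  shows "sf (\<Phi> (bx e l)) u = p \<bullet> u + (\<Sum>i\<in>UNIV. cf e u {i} * l i)"
proof -
  have zero: "cf e u J = 0" if J: "J \<noteq> {}" "\<And>i. J \<noteq> {i}" for J
  proof -
    have "W e J = {0}" using blocks_point[OF e two] point J(2) by blast
    then have "wd e u J = 0" using W_zero_iff[OF e] by blast
    then show ?thesis using cf_nonneg[OF e J(1), of u] cf_nonneg[OF e J(1), of "-u"] unfolding wd_def by simp
  qed
  have inj: "inj (\<lambda>i::'n. {i})" by (rule injI) simp
  have "sf (\<Phi> (bx e l)) u = (\<Sum>J\<in>UNIV. cf e u J * (\<Prod>i\<in>J. l i))" by (rule sf_box_expansion[OF e l])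
  also have "\<dots> = (\<Sum>J\<in>insert {} (range (\<lambda>i. {i})). cf e u J * (\<Prod>i\<in>J. l i))"
  proof (rule sum.mono_neutral_right)
    show "\<forall>J\<in>UNIV - insert {} (range (\<lambda>i. {i})). cf e u J * (\<Prod>i\<in>J. l i) = 0"
    proof
      fix J :: "'n set" assume "J \<in> UNIV - insert {} (range (\<lambda>i. {i}))"
      then have "cf e u J = 0" by (intro zero) auto
      then show "cf e u J * (\<Prod>i\<in>J. l i) = 0" by simp
    qed
  qed auto
  also have "\<dots> = cf e u {} + (\<Sum>J\<in>range (\<lambda>i. {i}). cf e u J * (\<Prod>i\<in>J. l i))"
    by (subst sum.insert) auto
  also have "(\<Sum>J\<in>range (\<lambda>i. {i}). cf e u J * (\<Prod>i\<in>J. l i)) = (\<Sum>i\<in>UNIV. cf e u {i} * l i)"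
    by (subst sum.reindex[OF inj]) simp
  finally show ?thesis by (simp add: cf_empty[OF e] sf_point)
qed

section \<open>Images of segments\<close>

definition z :: "real^'n \<Rightarrow> real^'n \<Rightarrow> real" where
  "z x u = sf (\<Phi> (closed_segment 0 x)) u - p \<bullet> u"

lemma bx_single: "t \<ge> 0 \<Longrightarrow> bx e (ind {i} t) = closed_segment 0 (t *\<^sub>R e i)" for e :: "'n \<Rightarrow> real^'n"
proof (intro set_eqI iffI)
  assume t: "t \<ge> 0"
  fix x assume "x \<in> bx e (ind {i} t)"
  then obtain s where s: "x = cmb e s" "\<And>j. 0 \<le> s j" "\<And>j. s j \<le> ind {i} t j" by (rule bxE) blast
  have "s j = ind {i} (s i) j" for j using s(2)[of j] s(3)[of j] by (cases "j = i") auto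
  then have "s = ind {i} (s i)" by blast
  then have x: "x = s i *\<^sub>R e i" using s(1) cmb_single by metis
  show "x \<in> closed_segment 0 (t *\<^sub>R e i)"
  proof (cases "t = 0")
    case True then show ?thesis using s(2)[of i] s(3)[of i] x by simp
  next
    case False
    then have "x = (s i / t) *\<^sub>R t *\<^sub>R e i" using x by simp
    moreover have "0 \<le> s i / t" "s i / t \<le> 1" using s(2)[of i] s(3)[of i] t False by (auto simp: divide_simps)
    ultimately show ?thesis unfolding in_segment(1) by auto
  qed
next
  assume t: "t \<ge> 0"
  fix x assume "x \<in> closed_segment 0 (t *\<^sub>R e i)"
  then obtain u where u: "0 \<le> u" "u \<le> 1" "x = u *\<^sub>R t *\<^sub>R e i" unfolding in_segment(1) by auto
  then have "x = cmb e (ind {i} (u * t))" by (simp add: cmb_single)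
  moreover have "0 \<le> ind {i} (u * t) j \<and> ind {i} (u * t) j \<le> ind {i} t j" for j
    using u t by (cases "j = i") (auto intro: mult_left_le_one_le)
  ultimately show "x \<in> bx e (ind {i} t)" using bxI by metis
qed

lemma convex_body_segment: "convex_body (closed_segment a b)" for a b :: "real^'n"
  unfolding convex_body_def by auto

lemma sum_ind: "(\<Sum>j\<in>UNIV. c j * ind {i} t j) = c i * t" for c :: "'n \<Rightarrow> real"
proof -
  have "(\<Sum>j\<in>UNIV. c j * ind {i} t j) = (\<Sum>j\<in>UNIV. if j = i then c i * t else 0)"
    by (rule sum.cong) (auto simp: ind_def)
  then show ?thesis by simp
qed

lemma z_scale_cf: assumes "frame e" "t \<ge> 0" shows "z (t *\<^sub>R e i) u = t * cf e u {i}"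
  using sf_box_additive_cf[OF assms(1), of "ind {i} t" u] assms(2)
  by (simp add: z_def bx_single sum_ind)

lemma z_cf: "frame e \<Longrightarrow> cf e u {i} = z (e i) u"
  using z_scale_cf[of e 1 i u] by simp

lemma sf_box_additive:
  assumes e: "frame e" and l: "\<And>i. 0 \<le> l i"
  shows "sf (\<Phi> (bx e l)) u = p \<bullet> u + (\<Sum>i\<in>UNIV. l i * z (e i) u)"
  unfolding sf_box_additive_cf[OF e l] by (simp add: z_cf[OF e] mult.commute)

lemma z_0: "z 0 u = 0"
  unfolding z_def by (simp add: sf_point)

lemma z_nonneg: "z x u \<ge> 0"
proof -
  have "sf (\<Phi> {0}) u \<le> sf (\<Phi> (closed_segment 0 x)) u"
    by (intro sf_\<Phi>_mono convex_body_sing convex_body_segment) auto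
  then show ?thesis unfolding z_def sf_point by simp
qed

lemma z_uminus: "z (- x) u = z x u"
proof -
  have "(\<lambda>y. y + x) ` closed_segment 0 (- x) = closed_segment x 0"
    using closed_segment_translation[of x 0 "-x"] by (simp add: add.commute)
  then show ?thesis using trans[OF convex_body_segment, of x 0 "-x"] unfolding z_def
    by (simp add: closed_segment_commute)
qed

lemma z_hom: "z (t *\<^sub>R x) u = \<bar>t\<bar> * z x u"
proof (cases "x = 0")
  case True then show ?thesis by (simp add: z_0)
next
  case False
  then obtain e i where e: "frame e" "e i = x" using frame_containing by blast
  have pos: "z (s *\<^sub>R x) u = s * z x u" if "s \<ge> 0" for s
    using z_scale_cf[OF e(1) that, of i u] e(2) z_cf[OF e(1), of u i] by simp
  show ?thesis
  proof (cases "t \<ge> 0")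
    case True then show ?thesis using pos by simp
  next
    case False
    then show ?thesis using pos[of "-t"] z_uminus[of "t *\<^sub>R x" u] by simp
  qed
qed

text \<open>For independent vectors the segment from 0 to \<open>x + y\<close> is a diagonal of a
  parallelogram, whose image is known by additivity. Dependent vectors reduce to
  homogeneity.\<close>

lemma z_add: "z (x + y) u \<le> z x u + z y u"
proof (cases "indep2 x y")
  case True
  then obtain e i j where e: "frame e" "i \<noteq> j" "e i = x" "e j = y" using frame_containing2 by blast
  let ?l = "\<lambda>k. ind {i} 1 k + ind {j} 1 k"
  have cb: "convex_body (bx e ?l)" by (rule convex_body_bx) simp
  have "closed_segment 0 (x + y) \<subseteq> bx e ?l"
  proof (rule closed_segment_subset)
    have "cmb e (\<lambda>_. 0) \<in> bx e ?l" by (rule bxI) simp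
    then show "0 \<in> bx e ?l" by simp
    have "cmb e ?l \<in> bx e ?l" by (rule bxI) simp
    then show "x + y \<in> bx e ?l" by (simp add: cmb_add cmb_single e)
    show "convex (bx e ?l)" using cb unfolding convex_body_def by blast
  qed
  then have "sf (\<Phi> (closed_segment 0 (x + y))) u \<le> sf (\<Phi> (bx e ?l)) u"
    by (rule sf_\<Phi>_mono[OF convex_body_segment cb])
  also have "\<dots> = p \<bullet> u + (\<Sum>k\<in>UNIV. ?l k * z (e k) u)" by (rule sf_box_additive[OF e(1)]) simp
  also have "(\<Sum>k\<in>UNIV. ?l k * z (e k) u) = z x u + z y u"
    using sum_ind[of "\<lambda>k. z (e k) u" i 1] sum_ind[of "\<lambda>k. z (e k) u" j 1] e(3,4)
    by (simp add: algebra_simps sum.distrib)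
  finally show ?thesis unfolding z_def by simp
next
  case False
  then show ?thesis
  proof (rule dependent2_cases)
    assume "x = 0" then show ?thesis by (simp add: z_0)
  next
    fix c assume y: "y = c *\<^sub>R x"
    have "z (x + y) u = \<bar>1 + c\<bar> * z x u" using z_hom[of "1 + c" x u] y by (simp add: scaleR_left_distrib)
    also have "\<dots> \<le> (1 + \<bar>c\<bar>) * z x u" by (rule mult_right_mono[OF _ z_nonneg]) simp
    also have "\<dots> = z x u + z y u" using z_hom[of c x u] y by (simp add: distrib_right)
    finally show ?thesis .
  qed
qed

lemma z_sublin: "sublin (z x)"
proof -
  have cb: "convex_body (\<Phi> (closed_segment 0 x))" by (intro body convex_body_segment)
  show ?thesis unfolding sublin_def z_def
  proof (intro conjI allI impI)
    fix u v show "sf (\<Phi> (closed_segment 0 x)) (u + v) - p \<bullet> (u + v)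
        \<le> sf (\<Phi> (closed_segment 0 x)) u - p \<bullet> u + (sf (\<Phi> (closed_segment 0 x)) v - p \<bullet> v)"
      using sf_add_le[OF cb, of u v] by (simp add: inner_add_right)
  next
    fix t :: real and u assume "0 \<le> t"
    then show "sf (\<Phi> (closed_segment 0 x)) (t *\<^sub>R u) - p \<bullet> (t *\<^sub>R u)
        = t * (sf (\<Phi> (closed_segment 0 x)) u - p \<bullet> u)"
      using sf_scaleR[OF cb, of t u] by (simp add: right_diff_distrib)
  qed
qed

definition zw :: "real^'n \<Rightarrow> real^'n \<Rightarrow> real" where "zw x u = z x u + z x (-u)"

lemma zw_wd: "frame e \<Longrightarrow> wd e u {i} = zw (e i) u"
  unfolding wd_def zw_def by (simp add: z_cf)

lemma zw_hom: "zw (t *\<^sub>R x) u = \<bar>t\<bar> * zw x u"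
  unfolding zw_def by (simp add: z_hom distrib_left)

lemma zw_uminus: "zw (- x) u = zw x u"
  unfolding zw_def by (simp add: z_uminus)

lemma zw_add: "zw (x + y) u \<le> zw x u + zw y u"
  unfolding zw_def using z_add[of x y u] z_add[of x y "-u"] by simp

lemma z_le_zw: "z x u \<le> zw x u"
  unfolding zw_def using z_nonneg[of x "-u"] by simp

text \<open>A nonzero \<open>x\<close> belongs to some frame, where the block of its index is a
  symmetric body on a line.\<close>

lemma zw_abs_inner: "\<exists>D. \<forall>u. zw x u = \<bar>D \<bullet> u\<bar>"
proof (cases "x = 0")
  case True then show ?thesis by (intro exI[of _ 0]) (simp add: zw_def z_0)
next
  case False
  then obtain e i where e: "frame e" "e i = x" using frame_containing by blast
  obtain d where d: "W e {i} \<subseteq> range (\<lambda>s. s *\<^sub>R d)" using block_on_line[OF e(1), of "{i}"] by blast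
  have "\<exists>D. \<forall>u. sf (W e {i}) u = \<bar>D \<bullet> u\<bar>"
    by (rule even_body_on_line[OF convex_body_W[OF e(1)] d]) (simp add: sf_W[OF e(1)] wd_uminus)
  then show ?thesis by (simp add: sf_W[OF e(1)] zw_wd[OF e(1)] e(2))
qed

text \<open>The vector is determined up to sign only, and the signs for different \<open>x\<close>
  are chosen independently; \<open>D\<close> need not be linear.\<close>

definition D :: "real^'n \<Rightarrow> real^'n" where "D x = (SOME d. \<forall>u. zw x u = \<bar>d \<bullet> u\<bar>)"

lemma zw_D: "zw x u = \<bar>D x \<bullet> u\<bar>"
  using someI_ex[OF zw_abs_inner, of x] unfolding D_def by blast

lemma frame_D: assumes e: "frame e" shows "frame (\<lambda>i. D (e i))"
proof (rule frame_of_spanning_family, rule ccontr)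
  fix u :: "real^'n" assume u: "u \<noteq> 0" and "\<not> (\<exists>i. D (e i) \<bullet> u \<noteq> 0)"
  then have 0: "zw (e i) u = 0" for i by (simp add: zw_D)
  have "width (\<Phi> (bx e (\<lambda>_. 1))) u = (\<Sum>i\<in>UNIV. zw (e i) u)"
    unfolding width_def zw_def by (simp add: sf_box_additive[OF e] sum.distrib)
  then show False using 0 width_unit_box_nonzero[OF e u] by simp
qed

text \<open>Expand \<open>D (x + y)\<close> in the frame of the vectors \<open>D (e i)\<close> and
  test with dual vectors. Subadditivity annihilates the coordinates other than those of
  \<open>x\<close> and \<open>y\<close> and gives these two absolute value 1.\<close>

lemma zw_sum_sign:
  assumes xy: "indep2 x y"
  shows "\<exists>\<sigma>. \<bar>\<sigma>\<bar> = 1 \<and> (\<forall>u. zw (x + y) u = \<bar>D x \<bullet> u + \<sigma> * (D y \<bullet> u)\<bar>)"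
proof -
  obtain e i j where e: "frame e" "i \<noteq> j" "e i = x" "e j = y" using frame_containing2[OF xy] by blast
  let ?d = "\<lambda>i. D (e i)"
  have fr: "frame ?d" by (rule frame_D[OF e(1)])
  obtain g where g: "D (x + y) = cmb ?d g" using frame_span[OF fr] by metis
  have val: "zw (x + y) u = \<bar>\<Sum>k\<in>UNIV. g k * (?d k \<bullet> u)\<bar>" for u
    unfolding zw_D g cmb_def by (simp add: inner_sum_left)
  have dual: "zw (x + y) u = \<bar>g k\<bar>" if u: "?d k \<bullet> u = 1" "\<And>m. m \<noteq> k \<Longrightarrow> ?d m \<bullet> u = 0" for k u
  proof -
    have "(\<Sum>m\<in>UNIV. g m * (?d m \<bullet> u)) = (\<Sum>m\<in>UNIV. if m = k then g k else 0)"
      by (rule sum.cong) (use u in auto)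
    then show ?thesis unfolding val by simp
  qed
  have other: "g k = 0" if k: "k \<noteq> i" "k \<noteq> j" for k
  proof -
    obtain u where u: "?d k \<bullet> u = 1" "\<And>m. m \<noteq> k \<Longrightarrow> ?d m \<bullet> u = 0" using frame_dual[OF fr, of k] by blast
    have "zw x u = 0" "zw y u = 0" using u(2)[of i] u(2)[of j] k e(3,4) by (auto simp: zw_D)
    then show ?thesis using zw_add[of x y u] dual[OF u] by simp
  qed
  have unit: "\<bar>g k\<bar> = 1" if k: "k = i \<and> m = j \<or> k = j \<and> m = i" for k m
  proof -
    obtain u where u: "?d k \<bullet> u = 1" "\<And>m. m \<noteq> k \<Longrightarrow> ?d m \<bullet> u = 0" using frame_dual[OF fr, of k] by blast
    have "zw (e k) u = 1" "zw (e m) u = 0" using u(1) u(2)[of m] k e(2) by (auto simp: zw_D)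
    moreover have "x + y = e k + e m" using k e(3,4) by (auto simp: add.commute)
    \<comment> \<open>Subadditivity bounds the coordinate from above through \<open>x + y\<close>
      and from below through writing \<open>e k\<close> as \<open>(x + y) - e m\<close>.\<close>
    ultimately show ?thesis
      using zw_add[of "e k" "e m" u] zw_add[of "x + y" "- e m" u] zw_uminus[of "e m" u] dual[OF u] by simp
  qed
  have gi: "\<bar>g i\<bar> = 1" and gj: "\<bar>g j\<bar> = 1" using unit[of i j] unit[of j i] by simp_all
  have "zw (x + y) u = \<bar>D x \<bullet> u + (g j * g i) * (D y \<bullet> u)\<bar>" for u
  proof -
    have "(\<Sum>k\<in>UNIV. g k * (?d k \<bullet> u)) = (\<Sum>k\<in>{i, j}. g k * (?d k \<bullet> u))"
      by (rule sum.mono_neutral_right) (use other in auto)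
    also have "\<dots> = g i * (D x \<bullet> u) + g j * (D y \<bullet> u)" using e by simp
    also have "\<dots> = g i * (D x \<bullet> u + (g j * g i) * (D y \<bullet> u))"
    proof -
      have "g i * g i = 1" using gi by (metis abs_mult_self_eq mult_1)
      moreover have "g i * ((g j * g i) * (D y \<bullet> u)) = (g i * g i) * (g j * (D y \<bullet> u))"
        by (simp only: mult_ac)
      ultimately have "g i * ((g j * g i) * (D y \<bullet> u)) = g j * (D y \<bullet> u)" by simp
      then show ?thesis by (simp add: distrib_left)
    qed
    finally show ?thesis unfolding val by (simp add: abs_mult gi)
  qed
  moreover have "\<bar>g j * g i\<bar> = 1" by (simp add: abs_mult gi gj)
  ultimately show ?thesis by blast
qed

text \<open>For independent vectors, the relative signs belonging to \<open>x + y\<close> and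
  \<open>x - y\<close> are opposite: equal signs would make \<open>D (x + y)\<close> and
  \<open>D (x - y)\<close> equal up to sign, although \<open>x + y\<close> and \<open>x - y\<close>
  belong to a common frame. The smaller of the two widths is then a difference of absolute
  values.\<close>

lemma zw_parallelogram: "min (zw (x + y) u) (zw (x - y) u) \<le> \<bar>zw x u - zw y u\<bar>"
proof (cases "indep2 x y")
  case True
  have xmy: "indep2 x (- y)" unfolding indep2_def
  proof (intro allI impI)
    fix a b assume "a *\<^sub>R x + b *\<^sub>R (- y) = 0"
    then have "a *\<^sub>R x + (- b) *\<^sub>R y = 0" by simp
    then have "a = 0 \<and> - b = 0" using True unfolding indep2_def by blast
    then show "a = 0 \<and> b = 0" by simp
  qed
  obtain \<sigma> where \<sigma>: "\<bar>\<sigma>\<bar> = 1" "\<And>u. zw (x + y) u = \<bar>D x \<bullet> u + \<sigma> * (D y \<bullet> u)\<bar>"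
    using zw_sum_sign[OF True] by blast
  obtain \<tau>' where \<tau>': "\<bar>\<tau>'\<bar> = 1" "\<And>u. zw (x + - y) u = \<bar>D x \<bullet> u + \<tau>' * (D (- y) \<bullet> u)\<bar>"
    using zw_sum_sign[OF xmy] by blast
  have "\<bar>D (- y) \<bullet> u\<bar> = \<bar>D y \<bullet> u\<bar>" for u using zw_uminus[of y u] by (simp add: zw_D)
  then have Dy: "D (- y) = D y \<or> D (- y) = - D y" by (rule abs_inner_eq)
  \<comment> \<open>The sign chosen for \<open>D (- y)\<close> is unrelated to that of
    \<open>D y\<close>; \<tau> absorbs the discrepancy.\<close>
  define \<tau> where "\<tau> = (if D (- y) = D y then \<tau>' else - \<tau>')"
  have \<tau>: "\<bar>\<tau>\<bar> = 1" "zw (x - y) u = \<bar>D x \<bullet> u + \<tau> * (D y \<bullet> u)\<bar>" for u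
    using \<tau>' Dy unfolding \<tau>_def by auto
  have "\<tau> \<noteq> \<sigma>"
  proof
    assume "\<tau> = \<sigma>"
    then have "\<bar>D (x + y) \<bullet> u\<bar> = \<bar>D (x - y) \<bullet> u\<bar>" for u using \<sigma>(2)[of u] \<tau>(2)[of u] by (simp add: zw_D)
    then have eq: "D (x + y) = D (x - y) \<or> D (x + y) = - D (x - y)" by (rule abs_inner_eq)
    have "indep2 (x + y) (x - y)" unfolding indep2_def
    proof (intro allI impI)
      fix a b assume "a *\<^sub>R (x + y) + b *\<^sub>R (x - y) = 0"
      then have "(a + b) *\<^sub>R x + (a - b) *\<^sub>R y = 0" by (simp add: algebra_simps)
      then have "a + b = 0" "a - b = 0" using True unfolding indep2_def by blast+
      then show "a = 0 \<and> b = 0" by simp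
    qed
    then obtain e i j where e: "frame e" "i \<noteq> j" "e i = x + y" "e j = x - y" using frame_containing2 by blast
    have "indep2 (D (x + y)) (D (x - y))" using frame_indep2[OF frame_D[OF e(1)] e(2)] e(3,4) by simp
    moreover have "1 *\<^sub>R D (x + y) + (-1) *\<^sub>R D (x - y) = 0 \<or> 1 *\<^sub>R D (x + y) + 1 *\<^sub>R D (x - y) = 0"
      using eq by auto
    ultimately show False unfolding indep2_def by (metis zero_neq_one)
  qed
  then consider "\<sigma> = 1" "\<tau> = -1" | "\<sigma> = -1" "\<tau> = 1" using \<sigma>(1) \<tau>(1) by (auto simp: abs_if split: if_splits)
  then show ?thesis
  proof cases
    case 1
    then show ?thesis unfolding \<sigma>(2) \<tau>(2) zw_D[of x] zw_D[of y] by simp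
  next
    case 2
    then show ?thesis unfolding \<sigma>(2) \<tau>(2) zw_D[of x] zw_D[of y] by simp
  qed
next
  case False
  have nn: "zw v u \<ge> 0" for v using zw_D by simp
  show ?thesis using False
  proof (rule dependent2_cases)
    assume "x = 0" then show ?thesis using nn[of y] zw_hom[of 0 x u] by (simp add: zw_uminus)
  next
    fix c assume y: "y = c *\<^sub>R x"
    have f: "zw (x + y) u = \<bar>1 + c\<bar> * zw x u" "zw (x - y) u = \<bar>1 - c\<bar> * zw x u" "zw y u = \<bar>c\<bar> * zw x u"
      using zw_hom[of "1 + c" x u] zw_hom[of "1 - c" x u] zw_hom[of c x u] y
      by (simp_all add: scaleR_left_distrib scaleR_left_diff_distrib)
    have "\<bar>zw x u - zw y u\<bar> = \<bar>1 - \<bar>c\<bar>\<bar> * zw x u"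
      using abs_mult[of "1 - \<bar>c\<bar>" "zw x u"] nn[of x] f(3) by (simp add: left_diff_distrib)
    moreover have "\<bar>1 - \<bar>c\<bar>\<bar> = \<bar>1 + c\<bar> \<or> \<bar>1 - \<bar>c\<bar>\<bar> = \<bar>1 - c\<bar>" by (auto simp: abs_if)
    ultimately have "\<bar>zw x u - zw y u\<bar> = zw (x + y) u \<or> \<bar>zw x u - zw y u\<bar> = zw (x - y) u"
      unfolding f(1,2) by metis
    then show ?thesis by linarith
  qed
qed

lemma zw_abs_linear: "\<exists>v. \<forall>x. zw x u = \<bar>v \<bullet> x\<bar>"
  by (rule abs_linear_seminorm) (rule zw_hom zw_add zw_parallelogram)+

text \<open>The counterpart of \<open>D\<close> with the roles of point and direction exchanged,
  again determined up to sign.\<close>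

definition V :: "real^'n \<Rightarrow> real^'n" where "V u = (SOME v. \<forall>x. zw x u = \<bar>v \<bullet> x\<bar>)"

lemma zw_V: "zw x u = \<bar>V u \<bullet> x\<bar>"
  using someI_ex[OF zw_abs_linear, of u] unfolding V_def by blast

end

section \<open>Classification\<close>

context point_valuation
begin

text \<open>Signs are normalized against one axis vector \<open>o'\<close> by means of the sums with
  it, and \<open>A\<close> is the linear map taking the axis vectors to the resulting multiples of
  \<open>a i\<close>. For given \<open>u\<close> the coordinates of \<open>V u\<close> and the
  numbers \<open>A (axis i 1) \<bullet> u\<close> have the same squares and the same products with
  the entry at \<open>o'\<close>, so they agree up to one common sign if that entry is
  nonzero.\<close>

lemma zw_bilinear: "\<exists>A. linear A \<and> (\<forall>x u. zw x u = \<bar>A x \<bullet> u\<bar>)"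
proof -
  let ?e = "\<lambda>i. axis i 1 :: real^'n"
  define o' :: 'n where "o' = undefined"
  have e: "frame ?e" by (rule frame_axis)
  define a where "a i = D (?e i)" for i
  have fra: "frame a" unfolding a_def by (rule frame_D[OF e])
  have "\<exists>s. \<bar>s\<bar> = 1 \<and> (i \<noteq> o' \<longrightarrow> (\<forall>u. zw (?e o' + ?e i) u = \<bar>a o' \<bullet> u + s * (a i \<bullet> u)\<bar>)) \<and> (i = o' \<longrightarrow> s = 1)" for i
  proof (cases "i = o'")
    case True then show ?thesis by (intro exI[of _ 1]) simp
  next
    case False
    then show ?thesis using zw_sum_sign[OF frame_indep2[OF e, of o' i]] unfolding a_def by auto
  qed
  then obtain s where s: "\<And>i. \<bar>s i\<bar> = 1" "\<And>i u. i \<noteq> o' \<Longrightarrow> zw (?e o' + ?e i) u = \<bar>a o' \<bullet> u + s i * (a i \<bullet> u)\<bar>" "s o' = 1"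
    by metis
  define A where "A x = (\<Sum>i\<in>UNIV. x $ i *\<^sub>R (s i *\<^sub>R a i))" for x
  have linA: "linear A" unfolding A_def by (rule linear_frame)
  have generic: "zw x u = \<bar>A x \<bullet> u\<bar>" if u: "a o' \<bullet> u \<noteq> 0" for x u
  proof -
    define \<alpha> where "\<alpha> i = s i * (a i \<bullet> u)" for i
    define \<nu> where "\<nu> i = V u $ i" for i
    have \<nu>e: "V u \<bullet> ?e i = \<nu> i" for i unfolding \<nu>_def by (simp add: inner_axis)
    have abs: "\<bar>\<nu> i\<bar> = \<bar>\<alpha> i\<bar>" for i
      using zw_V[of "?e i" u] zw_D[of "?e i" u] s(1)[of i] \<nu>e[of i] unfolding \<alpha>_def a_def by (simp add: abs_mult)
    have abs2: "\<bar>\<nu> o' + \<nu> i\<bar> = \<bar>\<alpha> o' + \<alpha> i\<bar>" if "i \<noteq> o'" for i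
      using zw_V[of "?e o' + ?e i" u] s(2)[OF that, of u] s(3) \<nu>e[of i] \<nu>e[of o'] unfolding \<alpha>_def
      by (simp add: inner_add_right)
    have prod: "\<nu> o' * \<nu> i = \<alpha> o' * \<alpha> i" for i
    proof -
      have sq: "\<nu> j * \<nu> j = \<alpha> j * \<alpha> j" for j using abs[of j] by (metis abs_mult_self_eq)
      show ?thesis
      proof (cases "i = o'")
        case True then show ?thesis using sq by simp
      next
        case False
        have "(\<nu> o' + \<nu> i) * (\<nu> o' + \<nu> i) = (\<alpha> o' + \<alpha> i) * (\<alpha> o' + \<alpha> i)"
          using abs2[OF False] by (metis abs_mult_self_eq)
        then show ?thesis using sq[of i] sq[of o'] by (simp add: algebra_simps)
      qed
    qed
    have \<alpha>0: "\<alpha> o' \<noteq> 0" unfolding \<alpha>_def using u s(3) by simp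
    define \<epsilon> where "\<epsilon> = \<nu> o' / \<alpha> o'"
    have \<epsilon>: "\<bar>\<epsilon>\<bar> = 1" unfolding \<epsilon>_def using abs[of o'] \<alpha>0 by simp
    have "\<nu> i = \<epsilon> * \<alpha> i" for i
    proof -
      have "\<epsilon> * \<epsilon> = 1" using \<epsilon> by (metis abs_mult_self_eq mult_1)
      have "\<nu> o' = \<epsilon> * \<alpha> o'" unfolding \<epsilon>_def using \<alpha>0 by simp
      then have "\<alpha> o' * (\<epsilon> * \<nu> i) = \<alpha> o' * \<alpha> i" using prod[of i] by (simp add: algebra_simps)
      then have "\<alpha> i = \<epsilon> * \<nu> i" using \<alpha>0 by simp
      then show ?thesis using \<open>\<epsilon> * \<epsilon> = 1\<close> by (simp add: mult.assoc[symmetric])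
    qed
    then have "V u \<bullet> x = \<epsilon> * (\<Sum>i\<in>UNIV. x $ i * \<alpha> i)"
      unfolding inner_vec_def by (simp add: \<nu>_def[symmetric] sum_distrib_left mult.commute mult.left_commute)
    also have "(\<Sum>i\<in>UNIV. x $ i * \<alpha> i) = A x \<bullet> u" unfolding A_def \<alpha>_def by (simp add: inner_sum_left mult.assoc)
    finally show ?thesis unfolding zw_V by (simp add: abs_mult \<epsilon>)
  qed
  have "zw x u = \<bar>A x \<bullet> u\<bar>" for x u
  proof (cases "a o' \<bullet> u = 0")
    case False then show ?thesis by (rule generic)
  next
    \<comment> \<open>A direction orthogonal to \<open>a o'\<close> becomes generic after adding any
      nonzero multiple of \<open>a o'\<close>.\<close>
    case True
    have h: "a o' \<bullet> a o' \<noteq> 0" using frame_nonzero[OF fra, of o'] by simp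
    have "\<bar>D x \<bullet> u\<bar> = \<bar>A x \<bullet> u\<bar>"
    proof (rule abs_eq_of_perturbation)
      fix t :: real assume t: "t \<noteq> 0"
      have "a o' \<bullet> (u + t *\<^sub>R a o') \<noteq> 0" using True h t by (simp add: inner_add_right)
      from generic[OF this, of x]
      show "\<bar>D x \<bullet> u + t * (D x \<bullet> a o')\<bar> = \<bar>A x \<bullet> u + t * (A x \<bullet> a o')\<bar>"
        by (simp add: zw_D inner_add_right)
    qed
    then show ?thesis by (simp add: zw_D)
  qed
  then show ?thesis using linA by blast
qed

text \<open>As a function of \<open>x\<close>, \<open>z x u\<close> is even, homogeneous and
  subadditive, and it is dominated by \<open>zw x u\<close>. It vanishes on the kernel of
  \<open>V u\<close>, so it is constant on the cosets of the kernel and depends only on the absolute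
  value of \<open>V u \<bullet> x\<close>.\<close>

lemma z_proportional: "\<exists>\<beta>. \<forall>x. z x u = \<beta> * zw x u"
proof (cases "V u = 0")
  case True
  then have "z x u = 0" for x using z_le_zw[of x u] z_nonneg[of x u] zw_V[of x u] by simp
  then show ?thesis by (intro exI[of _ 0]) simp
next
  case False
  have "V u \<bullet> ((1 / (V u \<bullet> V u)) *\<^sub>R V u) = 1" using False by simp
  then obtain x0 where V0: "V u \<bullet> x0 = 1" by blast
  have "z x u = z x0 u * zw x u" for x
  proof -
    define s where "s = V u \<bullet> x"
    define k where "k = x - s *\<^sub>R x0"
    have "V u \<bullet> k = 0" using V0 unfolding k_def s_def by (simp add: inner_diff_right)
    then have "zw k u = 0" by (simp add: zw_V)
    then have k0: "z k u = 0" "z (- k) u = 0"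
      using z_le_zw[of k u] z_nonneg[of k u] z_uminus[of k u] by linarith+
    have x: "x = k + s *\<^sub>R x0" "s *\<^sub>R x0 = x + - k" unfolding k_def by simp_all
    have "z x u \<le> z (s *\<^sub>R x0) u" using z_add[of k "s *\<^sub>R x0" u] k0 unfolding x(1)[symmetric] by linarith
    moreover have "z (s *\<^sub>R x0) u \<le> z x u" using z_add[of x "- k" u] k0 unfolding x(2)[symmetric] by linarith
    ultimately have "z x u = z (s *\<^sub>R x0) u" by simp
    then show ?thesis unfolding z_hom zw_V s_def by simp
  qed
  then show ?thesis by blast
qed

text \<open>The sublinear function \<open>z x\<close> vanishes at both \<open>k\<close> and
  \<open>-k\<close>, so adding \<open>k\<close> cannot change it in either direction.\<close>

lemma z_orthogonal:
  assumes "D x \<bullet> k = 0" shows "z x (u + k) = z x u"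
proof -
  have k0: "z x k = 0" "z x (- k) = 0"
    using z_le_zw[of x k] z_nonneg[of x k] z_le_zw[of x "-k"] z_nonneg[of x "-k"] assms by (simp_all add: zw_D)
  have "z x (u + k) \<le> z x u" using sublin_add[OF z_sublin, of x u k] k0 by simp
  moreover have "z x u \<le> z x (u + k)" using sublin_add[OF z_sublin, of x "u + k" "-k"] k0 by simp
  ultimately show ?thesis by simp
qed

text \<open>For independent \<open>D x\<close>, \<open>D y\<close> the factors at \<open>g + h\<close> and \<open>g - h\<close>, where \<open>g\<close>, \<open>h\<close> are dual to
  \<open>D x\<close>, \<open>D y\<close>, agree as seen from \<open>x\<close>; as seen from \<open>y\<close> they are those of \<open>h\<close> and \<open>- h\<close>.\<close>

lemma z_half: "z y u = zw y u / 2"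
proof (cases "y = 0")
  case True then show ?thesis by (simp add: z_0 zw_def)
next
  case False
  then obtain e i where e: "frame e" "e i = y" using frame_containing by blast
  have "\<exists>j::'n. j \<noteq> i"
  proof (rule ccontr)
    assume "\<not> ?thesis"
    then have "(UNIV::'n set) = {i}" by auto
    then have "CARD('n) = 1" by (metis card_1_singleton_iff One_nat_def)
    then show False using two by simp
  qed
  then obtain j where j: "j \<noteq> i" by blast
  have fr: "frame (\<lambda>i. D (e i))" by (rule frame_D[OF e(1)])
  obtain h where h: "D (e i) \<bullet> h = 1" "\<And>k. k \<noteq> i \<Longrightarrow> D (e k) \<bullet> h = 0" using frame_dual[OF fr, of i] by blast
  obtain g where g: "D (e j) \<bullet> g = 1" "\<And>k. k \<noteq> j \<Longrightarrow> D (e k) \<bullet> g = 0" using frame_dual[OF fr, of j] by blast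
  have yh: "D y \<bullet> h = 1" "D y \<bullet> g = 0" using h(1) g(2)[of i] j e(2) by auto
  have xh: "D (e j) \<bullet> h = 0" using h(2)[OF j] .
  obtain \<beta>1 where \<beta>1: "\<And>x. z x (g + h) = \<beta>1 * zw x (g + h)" using z_proportional by metis
  obtain \<beta>2 where \<beta>2: "\<And>x. z x (g + - h) = \<beta>2 * zw x (g + - h)" using z_proportional by metis
  have "z (e j) (g + h) = z (e j) g" "z (e j) (g + - h) = z (e j) g"
    using z_orthogonal[of "e j" h g] z_orthogonal[of "e j" "-h" g] xh by simp_all
  \<comment> \<open>In both directions \<open>zw (e j)\<close> equals 1, so the factors are the two
    values of \<open>z (e j)\<close>, which coincide.\<close>
  then have "\<beta>1 = \<beta>2" using \<beta>1[of "e j"] \<beta>2[of "e j"] g(1) xh by (simp add: zw_D inner_add_right inner_diff_right)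
  then have "z y (g + h) = z y (g + - h)" using \<beta>1[of y] \<beta>2[of y] yh by (simp add: zw_D inner_add_right inner_diff_right)
  moreover have "z y (h + g) = z y h" "z y (- h + g) = z y (- h)"
    using z_orthogonal[of y g h] z_orthogonal[of y g "-h"] yh by simp_all
  ultimately have "z y h = z y (- h)" by (simp add: add.commute)
  moreover have "z y h + z y (- h) = 1" using zw_D[of y h] yh unfolding zw_def by simp
  ultimately have half: "z y h = 1/2" "z y (- h) = 1/2" by simp_all
  \<comment> \<open>The vectors \<open>u\<close> and \<open>?s *\<^sub>R h\<close> differ by one
    orthogonal to \<open>D y\<close>, so the values at \<open>h\<close> and \<open>-h\<close>
    determine \<open>z y\<close>.\<close>
  let ?s = "D y \<bullet> u"
  have "D y \<bullet> (u - ?s *\<^sub>R h) = 0" using yh by (simp add: inner_diff_right)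
  then have "z y u = z y (?s *\<^sub>R h)" using z_orthogonal[of y "u - ?s *\<^sub>R h" "?s *\<^sub>R h"] by simp
  also have "\<dots> = \<bar>?s\<bar> / 2"
  proof (cases "?s \<ge> 0")
    case True then show ?thesis using sublin_scaleR[OF z_sublin True, of y h] half by simp
  next
    case False
    then show ?thesis using sublin_scaleR[OF z_sublin, of "- ?s" y "- h"] half by simp
  qed
  finally show ?thesis by (simp add: zw_D)
qed

text \<open>A body lies between a segment and a box having the same width in the relevant direction.\<close>

lemma difference_body_form:
  "\<exists>g::real^'n^'n. \<exists>p::real^'n. invertible g \<and>
        (\<forall>K. convex_body K \<longrightarrow> \<Phi> K = (\<lambda>x. g *v x + p) ` msum K (reflect K))"
proof -
  obtain A where A: "linear A" "\<And>x u. zw x u = \<bar>A x \<bullet> u\<bar>" using zw_bilinear by blast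
  define B where "B x = (1/2) *\<^sub>R A x" for x
  have linB: "linear B" unfolding B_def using A(1) by (intro linear_compose_scale_right)
  have zB: "z x u = \<bar>B x \<bullet> u\<bar>" for x u unfolding z_half A(2) B_def by (simp add: abs_mult)
  have injB: "inj B" unfolding linear_injective_0[OF linB]
  proof (intro allI impI, rule ccontr)
    fix x assume B0: "B x = 0" and "x \<noteq> 0"
    then obtain e i where e: "frame e" "e i = x" using frame_containing by blast
    have "D x \<noteq> 0" using frame_nonzero[OF frame_D[OF e(1)], of i] e(2) by simp
    moreover have "zw x (D x) = 0" using B0 A(2)[of x "D x"] unfolding B_def by simp
    ultimately show False by (simp add: zw_D)
  qed
  have inv: "invertible (matrix B)"
    by (simp add: invertible_det_nz det_nz_iff_inj[OF linB] injB)
  have "\<Phi> K = (\<lambda>x. matrix B *v x + p) ` msum K (reflect K)" if K: "convex_body K" for K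
  proof -
    let ?M = "msum K (reflect K)"
    have M: "convex_body ?M" using K by (intro convex_body_msum convex_body_reflect)
    have eq: "(\<lambda>x. matrix B *v x + p) ` ?M = (\<lambda>x. x + p) ` (B ` ?M)"
      by (simp add: image_image fun_cong[OF matrix_vector_mul(2)[OF linB]])
    have BM: "convex_body ((\<lambda>x. x + p) ` (B ` ?M))"
      by (intro convex_body_translate convex_body_linear_image linB M)
    have "sf (\<Phi> K) u = sf ((\<lambda>x. x + p) ` (B ` ?M)) u" for u
    proof -
      \<comment> \<open>In terms of \<open>y\<close> the image of a segment from 0 to
        \<open>x\<close> has excess |x . y| over \<open>p \<bullet> u\<close>, so the claim concerns
        the width of \<open>K\<close> in direction \<open>y\<close>.\<close>
      define y where "y = adjoint B u"
      have y: "B x \<bullet> u = x \<bullet> y" for x unfolding y_def using adjoint_works[OF linB] by simp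
      have "sf ((\<lambda>x. x + p) ` (B ` ?M)) u = width K y + p \<bullet> u"
      proof (rule antisym)
        show "sf ((\<lambda>x. x + p) ` (B ` ?M)) u \<le> width K y + p \<bullet> u"
          by (rule sf_least[OF BM])
            (auto simp: inner_add_left y width_eq_sf[OF K] intro!: sf_upper[OF M])
        obtain m where "m \<in> ?M" "m \<bullet> y = sf ?M y" using sf_attained[OF M] by metis
        then show "width K y + p \<bullet> u \<le> sf ((\<lambda>x. x + p) ` (B ` ?M)) u"
          using sf_upper[OF BM, of "B m + p" u] by (auto simp: inner_add_left y width_eq_sf[OF K])
      qed
      moreover have "sf (\<Phi> K) u \<ge> width K y + p \<bullet> u"
      proof -
        \<comment> \<open>The segment joining extreme points of \<open>K\<close> in the directions
          \<open>y\<close> and \<open>-y\<close> realizes the full width.\<close>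
        obtain b where b: "b \<in> K" "b \<bullet> y = sf K y" using sf_attained[OF K] by metis
        obtain a where a: "a \<in> K" "a \<bullet> (-y) = sf K (-y)" using sf_attained[OF K] by metis
        have "closed_segment a b \<subseteq> K"
          using K a b unfolding convex_body_def by (intro closed_segment_subset) auto
        then have "sf (\<Phi> (closed_segment a b)) u \<le> sf (\<Phi> K) u" by (rule sf_\<Phi>_mono[OF convex_body_segment K])
        moreover have seg: "closed_segment a b = (\<lambda>x. x + a) ` closed_segment 0 (b - a)"
          using closed_segment_translation[of a 0 "b - a"] by (simp add: add.commute)
        have "\<Phi> (closed_segment a b) = \<Phi> (closed_segment 0 (b - a))"
          unfolding seg by (rule trans[OF convex_body_segment])
        then have "sf (\<Phi> (closed_segment a b)) u = z (b - a) u + p \<bullet> u" unfolding z_def by simp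
        moreover have "z (b - a) u = \<bar>width K y\<bar>" unfolding zB y
          using a(2) b(2) unfolding width_def by (simp add: inner_diff_left)
        ultimately show ?thesis by linarith
      qed
      moreover have "sf (\<Phi> K) u \<le> width K y + p \<bullet> u"
      proof -
        \<comment> \<open>A box dual to a frame containing \<open>y\<close> encloses
          \<open>K\<close>, with the widths of \<open>K\<close> as edge lengths. Only the edge dual
          to \<open>y\<close> is not orthogonal to \<open>y\<close>, so the remaining edges
          contribute nothing. For \<open>y = 0\<close> any frame serves.\<close>
        obtain b o' where b: "frame b" "y \<noteq> 0 \<longrightarrow> b o' = y"
        proof (cases "y = 0")
          case True then show ?thesis using that[OF frame_axis] by blast
        next
          case False then show ?thesis using frame_containing[of y] that by blast
        qed
        obtain e where e: "frame e" "\<And>j k. e j \<bullet> b k = (if j = k then 1 else 0)" "\<And>x. x = cmb e (\<lambda>k. x \<bullet> b k)"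
          using dual_frame[OF b(1)] by blast
        define m where "m k = - sf K (- b k)" for k
        define l where "l k = width K (b k)" for k
        have l0: "0 \<le> l k" for k unfolding l_def by (rule width_nonneg[OF K])
        have "K \<subseteq> (\<lambda>x. x + cmb e m) ` bx e l"
        proof
          fix x assume x: "x \<in> K"
          have "x = cmb e (\<lambda>k. x \<bullet> b k - m k) + cmb e m"
            unfolding cmb_diff using e(3)[of x] by simp
          moreover have "cmb e (\<lambda>k. x \<bullet> b k - m k) \<in> bx e l"
          proof (rule bxI)
            fix k show "0 \<le> x \<bullet> b k - m k \<and> x \<bullet> b k - m k \<le> l k"
              using sf_upper[OF K x, of "b k"] sf_upper[OF K x, of "- b k"]
              unfolding m_def l_def width_def by simp
          qed
          ultimately show "x \<in> (\<lambda>x. x + cmb e m) ` bx e l" by blast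
        qed
        then have "sf (\<Phi> K) u \<le> sf (\<Phi> ((\<lambda>x. x + cmb e m) ` bx e l)) u"
          by (intro sf_\<Phi>_mono K convex_body_translate convex_body_bx l0)
        also have "\<dots> = sf (\<Phi> (bx e l)) u" by (simp only: trans[OF convex_body_bx[OF l0]])
        also have "\<dots> = p \<bullet> u + (\<Sum>k\<in>UNIV. l k * z (e k) u)" by (rule sf_box_additive[OF e(1) l0])
        also have "(\<Sum>k\<in>UNIV. l k * z (e k) u) \<le> width K y"
        proof (cases "y = 0")
          case True
          then show ?thesis using width_nonneg[OF K, of y] by (simp add: zB y)
        next
          case False
          then have "b o' = y" using b by blast
          then have "e k \<bullet> y = (if k = o' then 1 else 0)" for k using e(2)[of k o'] by simp
          then have "(\<Sum>k\<in>UNIV. l k * z (e k) u) = (\<Sum>k\<in>UNIV. if k = o' then l o' else 0)"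
            by (intro sum.cong) (auto simp: zB y)
          then show ?thesis using \<open>b o' = y\<close> by (simp add: l_def)
        qed
        finally show ?thesis by simp
      qed
      ultimately show ?thesis by simp
    qed
    then show ?thesis unfolding eq by (intro convex_body_eqI body K BM)
  qed
  then show ?thesis using inv by blast
qed

end

section \<open>The converse direction\<close>

lemma cylinder_volume:
  fixes L S :: "(real^'n) set"
  assumes L: "convex_body L" and S: "convex_body S" "0 \<in> S" "aff_dim S = 1"
    and dimL: "aff_dim L < int CARD('n)" and dimLS: "aff_dim (msum L S) = int CARD('n)" and t: "t \<ge> 0"
  shows "vol (msum L ((\<lambda>x. t *\<^sub>R x) ` S)) = t * vol (msum L S)"
proof -
  obtain d where d: "d \<in> S" "d \<noteq> 0"
  proof -
    have "S \<noteq> {0}" using S(3) aff_dim_sing[of "0::real^'n"] by auto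
    then show ?thesis using that S(2) by blast
  qed
  have dimS: "dim S = 1" using aff_dim_zero[of S] S(2,3) by (simp add: hull_inc)
  have "S \<subseteq> span {d}"
    by (rule card_ge_dim_independent) (use d dimS in \<open>auto simp: dependent_single\<close>)
  then have Sd: "\<exists>s. x = s *\<^sub>R d" if "x \<in> S" for x using that by (auto simp: span_singleton)
  obtain l0 where l0: "l0 \<in> L" using L unfolding convex_body_def by blast
  let ?L = "(\<lambda>x. x + (- l0)) ` L"
  have "(\<lambda>x. x + (- l0)) ` L = (+) (- l0) ` L" by (simp add: add.commute image_def)
  then have "aff_dim ?L = aff_dim L" using aff_dim_translation_eq[of "- l0" L] by simp
  moreover have "0 \<in> ?L" using l0 by force
  ultimately have "dim ?L < DIM(real^'n)" using aff_dim_zero[of ?L] dimL by (simp add: hull_inc)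
  then obtain u where u: "u \<noteq> 0" "span ?L \<subseteq> {x. u \<bullet> x = 0}" using lowdim_subset_hyperplane by blast
  have uL: "u \<bullet> x = 0" if "x \<in> ?L" for x using u(2) span_base[OF that] by blast
  have LM: "msum L X = (\<lambda>x. x + l0) ` msum ?L X" for X
  proof (intro set_eqI iffI)
    fix z assume "z \<in> msum L X"
    then obtain a b where "a \<in> L" "b \<in> X" "z = (a + - l0) + b + l0" unfolding msum_def by auto
    then show "z \<in> (\<lambda>x. x + l0) ` msum ?L X" unfolding msum_def by blast
  next
    fix z assume "z \<in> (\<lambda>x. x + l0) ` msum ?L X"
    then obtain a b where "a \<in> L" "b \<in> X" "z = (a + - l0) + b + l0" unfolding msum_def by blast
    moreover have "z = a + b" using calculation(3) by simp
    ultimately show "z \<in> msum L X" unfolding msum_def by blast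
  qed
  have CL: "convex_body ?L" by (rule convex_body_translate[OF L])
  have pos: "vol (msum L S) \<noteq> 0"
    using aff_dim_less_of_vol[OF convex_body_msum[OF L S(1)]] dimLS by auto
  have ud: "u \<bullet> d \<noteq> 0"
  proof
    \<comment> \<open>Otherwise the translated \<open>L\<close> and \<open>S\<close> would lie in a
      common hyperplane, although their sum has full dimension.\<close>
    assume ud: "u \<bullet> d = 0"
    have "vol (msum ?L S) = 0"
    proof (rule vol_0_hyperplane[OF u(1)])
      fix x assume "x \<in> msum ?L S"
      then obtain a b where "a \<in> ?L" "b \<in> S" "x = a + b" unfolding msum_def by blast
      moreover obtain s where "b = s *\<^sub>R d" using Sd calculation(2) by blast
      ultimately show "u \<bullet> x = 0" using uL[of a] ud by (simp add: inner_add_right)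
    qed
    then show False using pos unfolding LM[of S] vol_translate by simp
  qed
  show ?thesis
  proof (cases "t = 0")
    case True
    \<comment> \<open>The stretching map used below is singular for t = 0. In this case the sum is
      \<open>L\<close>, which has volume 0 by its dimension.\<close>
    have "(\<lambda>x. t *\<^sub>R x) ` S = {0}" using True S(2) by auto
    moreover have "msum L {0} = L" unfolding msum_def by simp
    moreover have "vol L = 0"
    proof (rule ccontr)
      assume "vol L \<noteq> 0"
      then have "aff_dim L = int CARD('n)" using aff_dim_full_of_vol[OF L] vol_nonneg[of L] by simp
      then show False using dimL by simp
    qed
    ultimately show ?thesis using True by simp
  next
    case False
    then have tp: "t > 0" using t by simp
    \<comment> \<open>This map fixes the hyperplane containing the translated \<open>L\<close> and
      multiplies \<open>d\<close> by \<open>t\<close>, so it takes the sum with \<open>S\<close> to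
      the sum with the dilate of \<open>S\<close>.\<close>
    define T where "T x = x + ((t - 1) * (u \<bullet> x) / (u \<bullet> d)) *\<^sub>R d" for x
    have linT: "linear T"
      unfolding T_def by (rule linearI) (simp_all add: inner_add_right algebra_simps add_divide_distrib diff_divide_distrib)
    have Td: "T (s *\<^sub>R d) = t *\<^sub>R s *\<^sub>R d" for s
    proof -
      have "(t - 1) * (u \<bullet> (s *\<^sub>R d)) / (u \<bullet> d) = (t - 1) * s" using ud by simp
      then have "T (s *\<^sub>R d) = (s + (t - 1) * s) *\<^sub>R d" unfolding T_def by (simp only: scaleR_left_distrib)
      also have "s + (t - 1) * s = t * s" by (simp add: algebra_simps)
      finally show ?thesis by simp
    qed
    have Tu: "T x = x" if "u \<bullet> x = 0" for x unfolding T_def using that by simp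
    obtain b o' where b: "frame b" "b o' = u" using frame_containing[OF u(1)] by blast
    obtain e where e: "frame e" "\<And>j k. e j \<bullet> b k = (if j = k then 1 else 0)" "\<And>x. x = cmb e (\<lambda>k. x \<bullet> b k)"
      using dual_frame[OF b(1)] by blast
    let ?f = "e(o' := d)"
    have f: "frame ?f"
      by (rule frame_exchange[OF e(1) e(3)]) (use ud b(2) in \<open>simp add: inner_commute\<close>)
    have Tf: "(\<lambda>i. T (?f i)) = ?f(o' := t *\<^sub>R ?f o')"
    proof
      fix i
      have "u \<bullet> e i = 0" if "i \<noteq> o'" using e(2)[of i o'] b(2) that by (simp add: inner_commute)
      then show "T (?f i) = (?f(o' := t *\<^sub>R ?f o')) i" using Tu[of "e i"] Td[of 1] by (cases "i = o'") auto
    qed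
    have fT: "frame (\<lambda>i. T (?f i))" unfolding Tf
      by (rule frame_exchange[OF f, of _ "ind {o'} t"]) (use tp in \<open>simp_all add: cmb_single\<close>)
    have injT: "inj T" by (rule linear_inj_of_frames[OF linT f fT])
    have "t * kap ?f = vol (T ` cbox 0 1) * kap ?f"
      using kap_linear[OF linT injT, of ?f] kap_scale_one[OF f t, of o'] unfolding Tf by auto
    then have volT: "vol (T ` cbox 0 1) = t" using kap_pos[OF f] by simp
    have "T ` msum ?L S = msum ?L ((\<lambda>x. t *\<^sub>R x) ` S)"
    proof -
      have Tab: "T (a + b) = a + t *\<^sub>R b" if "a \<in> ?L" "b \<in> S" for a b
        using Tu[OF uL[OF that(1)]] Sd[OF that(2)] Td by (auto simp: linear_add[OF linT])
      show ?thesis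
      proof (intro set_eqI iffI)
        fix z assume "z \<in> T ` msum ?L S"
        then obtain a b where "a \<in> ?L" "b \<in> S" "z = T (a + b)" unfolding msum_def by blast
        then show "z \<in> msum ?L ((\<lambda>x. t *\<^sub>R x) ` S)" unfolding msum_def using Tab by blast
      next
        fix z assume "z \<in> msum ?L ((\<lambda>x. t *\<^sub>R x) ` S)"
        then obtain a b where "a \<in> ?L" "b \<in> S" "z = a + t *\<^sub>R b" unfolding msum_def by blast
        then have "z = T (a + b)" "a + b \<in> msum ?L S" unfolding msum_def using Tab by auto
        then show "z \<in> T ` msum ?L S" by blast
      qed
    qed
    then have "vol (msum ?L ((\<lambda>x. t *\<^sub>R x) ` S)) = t * vol (msum ?L S)"
      using vol_linear_image[OF linT injT convex_body_msum[OF CL S(1)]] volT by simp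
    then show ?thesis unfolding LM[of S] LM[of "(\<lambda>x. t *\<^sub>R x) ` S"] vol_translate .
  qed
qed

lemma vc_monotonic_difference_body:
  fixes \<Phi> :: "(real^'n) set \<Rightarrow> (real^'n) set" and g :: "real^'n^'n"
  assumes g: "invertible g" and \<Phi>: "\<And>K. convex_body K \<Longrightarrow> \<Phi> K = (\<lambda>x. g *v x + p) ` msum K (reflect K)"
  shows "VC \<Phi> \<and> monotonic \<Phi>"
proof
  let ?g = "\<lambda>x. g *v x"
  have lin: "linear ?g" by simp
  have inj: "inj ?g" using g by (simp add: inj_matrix_vector_mult)
  let ?c = "vol (?g ` cbox 0 1)"
  have "kap (\<lambda>i. ?g (axis i 1)) = ?c * kap (\<lambda>i. axis i 1 :: real^'n)" 
    using kap_linear[OF lin inj, of "\<lambda>i. axis i 1"] .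
  moreover have "frame (\<lambda>i. ?g (axis i 1))" unfolding frame_def
  proof (intro allI impI)
    fix t i assume "cmb (\<lambda>i. ?g (axis i 1)) t = 0"
    then have "?g (cmb (\<lambda>i. axis i 1) t) = ?g 0" using cmb_linear[OF lin, of "\<lambda>i. axis i 1" t] by simp
    then have "cmb (\<lambda>i. axis i 1) t = 0" using inj by (blast dest: injD)
    then show "t i = 0" by (rule frameD[OF frame_axis])
  qed
  ultimately have "?c \<noteq> 0" using kap_pos[of "\<lambda>i. ?g (axis i 1)"] by auto
  then have c: "?c > 0" using vol_nonneg[of "?g ` cbox 0 1"] by simp
  have vol\<Phi>: "vol (\<Phi> K) = ?c * vol (msum K (reflect K))" if K: "convex_body K" for K
  proof -
    have "\<Phi> K = (\<lambda>x. x + p) ` ?g ` msum K (reflect K)" unfolding \<Phi>[OF K] by (simp add: image_image)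
    then show ?thesis
      using vol_linear_image[OF lin inj convex_body_msum[OF K convex_body_reflect[OF K]]] by (simp only: vol_translate)
  qed
  show "VC \<Phi>" unfolding VC_def
  proof (intro exI conjI allI impI)
    show "?c > 0" "?c * (8 * real CARD('n)) ^ CARD('n) > 0" using c by simp_all
    fix K :: "(real^'n) set" assume K: "convex_body K"
    show "?c * vol K \<le> vol (\<Phi> K)"
      unfolding vol\<Phi>[OF K] using c vol_le_difference_body[OF K] by simp
    show "vol (\<Phi> K) \<le> ?c * (8 * real CARD('n)) ^ CARD('n) * vol K"
      unfolding vol\<Phi>[OF K] using c difference_body_vol_le[OF K] by (simp add: mult.assoc)
  qed
  show "monotonic \<Phi>" unfolding monotonic_def
  proof (intro allI impI)
    fix K L :: "(real^'n) set" assume KL: "convex_body K \<and> convex_body L \<and> K \<subseteq> L"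
    then have "msum K (reflect K) \<subseteq> msum L (reflect L)" unfolding msum_def reflect_def by blast
    then show "\<Phi> K \<subseteq> \<Phi> L" using KL \<Phi> by (simp add: image_mono)
  qed
qed

text \<open>The volume of the image is exactly \<open>vol (msum L S)\<close> times the volume of
  \<open>K\<close>. Since the convex set \<open>S\<close> contains 0, its dilates increase with the
  factor, which gives monotonicity.\<close>

lemma vc_monotonic_cylinder:
  fixes \<Phi> :: "(real^'n) set \<Rightarrow> (real^'n) set"
  assumes L: "convex_body L" and S: "convex_body S" "0 \<in> S" "aff_dim S = 1"
    and dimL: "aff_dim L = int CARD('n) - 1" and dimLS: "aff_dim (msum L S) = int CARD('n)"
    and \<Phi>: "\<And>K. convex_body K \<Longrightarrow> \<Phi> K = msum L ((\<lambda>x. vol K *\<^sub>R x) ` S)"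
  shows "VC \<Phi> \<and> monotonic \<Phi>"
proof
  have dimL': "aff_dim L < int CARD('n)" using dimL by simp
  have "vol (msum L S) \<noteq> 0"
    using aff_dim_less_of_vol[OF convex_body_msum[OF L S(1)]] dimLS by auto
  then have c: "vol (msum L S) > 0" using vol_nonneg[of "msum L S"] by simp
  have "vol (\<Phi> K) = vol (msum L S) * vol K" if "convex_body K" for K
    unfolding \<Phi>[OF that] using cylinder_volume[OF L S dimL' dimLS vol_nonneg] by (simp add: mult.commute)
  then show "VC \<Phi>" unfolding VC_def using c by (intro exI[of _ "vol (msum L S)"]) simp
  show "monotonic \<Phi>" unfolding monotonic_def
  proof (intro allI impI)
    fix K M :: "(real^'n) set" assume KM: "convex_body K \<and> convex_body M \<and> K \<subseteq> M"
    let ?a = "vol K" and ?b = "vol M"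
    have ab: "0 \<le> ?a" "?a \<le> ?b" using KM vol_nonneg vol_mono by auto
    have "?a *\<^sub>R x \<in> (\<lambda>x. ?b *\<^sub>R x) ` S" if x: "x \<in> S" for x
    proof (cases "?b = 0")
      case True
      then show ?thesis using ab S(2) by force
    next
      case False
      then have r: "0 \<le> ?a / ?b" "?a / ?b \<le> 1" using ab by (auto simp: divide_simps)
      have "(1 - ?a / ?b) *\<^sub>R 0 + (?a / ?b) *\<^sub>R x \<in> S"
        using S x r unfolding convex_body_def by (intro convexD_alt) auto
      then have "(?a / ?b) *\<^sub>R x \<in> S" by simp
      moreover have "?a *\<^sub>R x = ?b *\<^sub>R (?a / ?b) *\<^sub>R x" using False by simp
      ultimately show ?thesis by blast
    qed
    then have "(\<lambda>x. ?a *\<^sub>R x) ` S \<subseteq> (\<lambda>x. ?b *\<^sub>R x) ` S" by blast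
    then have "msum L ((\<lambda>x. ?a *\<^sub>R x) ` S) \<subseteq> msum L ((\<lambda>x. ?b *\<^sub>R x) ` S)"
      unfolding msum_def by blast
    then show "\<Phi> K \<subseteq> \<Phi> M" using KM by (simp only: \<Phi>)
  qed
qed

theorem theorem1p4:
  fixes \<Phi> :: "(real^'n) set \<Rightarrow> (real^'n) set"
  assumes "CARD('n) \<ge> 2"
    and "body_map \<Phi>"
    and "hausdorff_continuous \<Phi>"
    and "translation_invariant \<Phi>"
    and "minkowski_valuation \<Phi>"
  shows "(VC \<Phi> \<and> monotonic \<Phi>) \<longleftrightarrow>
    ((\<exists>g::real^'n^'n. \<exists>p::real^'n. invertible g \<and>
        (\<forall>K. convex_body K \<longrightarrow> \<Phi> K = (\<lambda>x. g *v x + p) ` msum K (reflect K)))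
     \<noteq>
     (\<exists>L S::(real^'n) set. convex_body L \<and> convex_body S \<and> 0 \<in> S \<and>
        aff_dim S = 1 \<and> aff_dim L = int CARD('n) - 1 \<and> aff_dim (msum L S) = int CARD('n) \<and>
        (\<forall>K. convex_body K \<longrightarrow> \<Phi> K = msum L ((\<lambda>x. vol K *\<^sub>R x) ` S))))"
    (is "?P \<longleftrightarrow> (?A \<noteq> ?B)")
proof -
  have forward: "?A \<or> ?B" if P: ?P
  proof -
    interpret monotone_vc_valuation \<Phi>
      using P assms by unfold_locales auto
    show ?thesis
    \<comment> \<open>An image of a point with positive width in some direction makes the empty set
      a block and leads to the cylinder; otherwise only singletons are blocks.\<close>
    proof (cases "\<forall>u. width (\<Phi> {0}) u = 0")
      case True
      interpret point_valuation \<Phi>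
        using True assms(1) by unfold_locales auto
      show ?thesis using difference_body_form by blast
    next
      case False
      show ?thesis using full_block_form[OF False] by blast
    qed
  qed
  have exclusive: "\<not> (?A \<and> ?B)"
  proof
    assume "?A \<and> ?B"
    then obtain g :: "real^'n^'n" and p :: "real^'n" and L S :: "(real^'n) set"
      where g: "\<forall>K. convex_body K \<longrightarrow> \<Phi> K = (\<lambda>x. g *v x + p) ` msum K (reflect K)"
        and L: "0 \<in> S" "aff_dim L = int CARD('n) - 1"
          "\<forall>K. convex_body K \<longrightarrow> \<Phi> K = msum L ((\<lambda>x. vol K *\<^sub>R x) ` S)" by blast
    \<comment> \<open>The two forms are told apart by the image of a point: a single point in the
      first, a body of dimension n - 1, hence at least 1, in the second.\<close>
    have "msum {0} (reflect {0}) = {0 :: real^'n}" by (auto simp: msum_def reflect_def)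
    then have "\<Phi> {0} = {p}" using g convex_body_sing[of "0 :: real^'n"] by simp
    moreover have "vol ({0} :: (real^'n) set) = 0" by (simp add: vol_def)
    then have "(\<lambda>x. vol ({0} :: (real^'n) set) *\<^sub>R x) ` S = {0}" using L(1) by auto
    then have "\<Phi> {0} = L" using L(3) convex_body_sing[of "0 :: real^'n"] by (simp add: msum_def)
    ultimately have "aff_dim L = 0" by (simp add: aff_dim_sing)
    then show False using L(2) assms(1) by simp
  qed
  have "?P" if ?A using that vc_monotonic_difference_body by blast
  moreover have "?P" if ?B using that vc_monotonic_cylinder by blast
  ultimately show ?thesis using forward exclusive by blast
qed

end
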